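(* Let $d\ge 2$ and let $E\subset\mathbb{R}^d$ be compact with $\dim_{\mathcal H}(E)>(3d+1)/4$. Then the set $$\left\{\left(\frac{|x-y|}{|z-w|},\ \frac{|x-w|}{|z-y|}\right)\in\mathbb{R}^2 : x,y,z,w\in E,\ z\ne w,\ z\ne y\right\}$$ has nonempty interior in $\mathbb{R}^2$.
   Context: $\dim_{\mathcal H}$ denotes Hausdorff dimension and $|\cdot|$ the Euclidean norm on $\mathbb{R}^d$. *)

theory Defs
  imports "HOL-Analysis.Analysis"
begin

text \<open>
  The summand \<open>diam(A)^s\<close> of the Hausdorff sums. The case distinction fixes the usual conventions
  \<open>diam({})^s = 0\<close> and \<open>diam(A)^0 = 1\<close> for nonempty \<open>A\<close>; plain \<^term>\<open>(powr)\<close> would give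
  \<open>0 powr 0 = 0\<close> for singletons. Only bounded sets are ever used, as \<^const>\<open>diameter\<close> has no
  meaning on unbounded ones.
\<close>
definition diam_powr :: "real \<Rightarrow> 'a::metric_space set \<Rightarrow> ennreal" where
  "diam_powr s A =
     (if A = {} then 0 else if s = 0 then 1 else ennreal (diameter A powr s))"

definition hausdorff_content :: "real \<Rightarrow> real \<Rightarrow> 'a::metric_space set \<Rightarrow> ennreal" where
  "hausdorff_content s \<delta> E =
     (INF C\<in>{C :: nat \<Rightarrow> 'a set.
               E \<subseteq> (\<Union>i. C i) \<and> (\<forall>i. bounded (C i) \<and> diameter (C i) \<le> \<delta>)}.
        \<Sum>i. diam_powr s (C i))"

text \<open>Without normalising constant, which does not affect the dimension.\<close>
definition hausdorff_measure :: "real \<Rightarrow> 'a::metric_space set \<Rightarrow> ennreal" where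
  "hausdorff_measure s E = (SUP \<delta>\<in>{0<..}. hausdorff_content s \<delta> E)"

definition hausdorff_dim :: "'a::metric_space set \<Rightarrow> ereal" where
  "hausdorff_dim E = (INF s\<in>{s. 0 \<le> s \<and> hausdorff_measure s E = 0}. ereal s)"

end

theory Submission
  imports Defs "HOL-Probability.Probability"
begin

text \<open>
  Choose points \<open>a\<close>, \<open>b\<close>, \<open>c\<close> of \<open>E\<close>, near each of which \<open>E\<close> has positive \<open>\<alpha>\<close>-dimensional content for some
  \<open>\<alpha> > d/2 + 3/4\<close> (note \<open>(3d+1)/4 \<ge> d/2 + 3/4\<close>), with \<open>|a - b| \<noteq> |a - c|\<close> and \<open>(a - b) \<bullet> (a - c) \<noteq> 0\<close>.
  Put Frostman weights at scale \<open>2\<^sup>-\<^sup>N\<close> on finite sets of points \<open>x, z\<close> near \<open>a\<close>, \<open>y\<close> near \<open>b\<close> and \<open>w\<close> near \<open>c\<close>,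
  and count with Gaussian weights of width \<open>\<delta>\<close> the quadruples for which
  \<open>u = |x-y|\<^sup>2 - s\<^sup>2 |z-w|\<^sup>2\<close> and \<open>v = |x-w|\<^sup>2 - t\<^sup>2 |z-y|\<^sup>2\<close> are nearly zero.

  Halving \<open>\<delta>\<close> in one variable changes the count by an integral over \<open>|\<tau>| \<ge> 1/\<delta>\<close> of the sum of
  \<open>cis (\<tau> u) exp (- v\<^sup>2 / 2\<delta>\<^sup>2)\<close>. Fix the value \<open>c\<close> of \<open>|x-w|\<^sup>2 \<approx> t\<^sup>2 |z-y|\<^sup>2\<close> by a Gaussian convolution: what remains
  is bilinear in \<open>(x, w)\<close> and \<open>(y, z)\<close> with the phase bilinear in \<open>(x - s\<^sup>2 w, w)\<close> and \<open>(y, z - y)\<close>.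
  By Cauchy-Schwarz and the large sieve it is controlled by Fourier transforms of smoothed thin shells
  \<open>t\<^sup>2 |z-y|\<^sup>2 = c + O(l)\<close>. These are of size about \<open>l\<close>, and they decay rapidly unless \<open>(x, w)\<close> is
  close to \<open>(x', w')\<close>: the constraint \<open>|x-w|\<^sup>2 \<approx> |x'-w'|\<^sup>2\<close> makes \<open>w - w'\<close> nearly orthogonal to
  \<open>(x-w) + (x'-w')\<close>, hence transversal to \<open>z - y\<close>. The counts therefore converge geometrically,
  uniformly in \<open>(s, t)\<close>. At a fixed coarse scale one cell of a finite grid of parameters \<open>(s, t)\<close> has a large
  count for infinitely many \<open>N\<close>; there the counts stay positive down to \<open>\<delta> = 2\<^sup>-\<^sup>N\<close>, and compactness gives
  exact solutions of \<open>u = v = 0\<close> on an open box.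
\<close>

subsection \<open>Gaussian integrals with quadratic phases\<close>

text \<open>The threshold is an exponent count. In the large sieve the box volume in the
  \<open>2 d\<close> variables \<open>(y, z - y)\<close> costs \<open>l\<close> to the power
  \<open>-2 d\<close>; the Frostman condition on \<open>(y, z)\<close> returns
  \<open>2 \<alpha>\<close>, and the kernel sum returns \<open>2 \<alpha>\<close> from near-diagonal
  pairs and \<open>1\<close> from the thickness of the shell. Half of the total
  \<open>4 \<alpha> - 2 d + 1\<close> must exceed \<open>2\<close>, because integrating over
  \<open>|\<tau>|\<close> of order \<open>1/\<delta>\<close> costs one factor
  \<open>1/\<delta>\<close> and the normalisation of the second Gaussian another. That is
  \<open>\<alpha> > d/2 + 3/4\<close>. Losses of powers of \<open>l powr \<mu>\<close> are paid from
  the surplus \<open>\<epsilon>\<close>.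

  Near-orthogonality of \<open>w - w'\<close> comes with a factor \<open>s\<^sup>2 - 1\<close>, so
  \<open>s\<close> and, after exchanging roles, \<open>t\<close> must avoid \<open>1\<close>; the
  base ratios are \<open>|a-b|/|a-c|\<close> and its inverse, whence
  \<open>|a - b| \<noteq> |a - c|\<close>. Taking \<open>x\<close> and \<open>z\<close> near the
  same point makes exchanging \<open>y\<close> with \<open>w\<close> and \<open>s\<close> with
  \<open>t\<close> preserve all hypotheses, so one estimate handles the halving in either
  variable.\<close>

lemma integrable_gaussian:
  assumes "0 < k"
  shows "integrable lborel (\<lambda>x::real. exp (- k * x\<^sup>2))"
proof -
  have "integrable lborel (\<lambda>x. normal_density 0 (sqrt (1/(2*k))) x * sqrt (pi / k))"
    using assms by (intro integrable_mult_left) auto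
  moreover have "normal_density 0 (sqrt (1/(2*k))) x * sqrt (pi / k) = exp (- k * x\<^sup>2)" for x
    using assms by (simp add: normal_density_def real_sqrt_divide power_divide real_sqrt_mult power_mult_distrib)
  ultimately show ?thesis by simp
qed

text \<open>The characteristic function of the standard normal law, rescaled by
  \<open>sqrt (2 * k)\<close>; the factor \<open>sqrt (2 * pi)\<close> removes the normalisation of
  the density.\<close>

lemma has_integral_gaussian_cis:
  assumes "0 < k"
  shows "has_bochner_integral lborel (\<lambda>x::real. complex_of_real (exp (- k * x\<^sup>2)) * cis (\<theta> * x))
    (complex_of_real (sqrt (pi / k) * exp (- \<theta>\<^sup>2 / (4 * k))))"
proof -
  have *: "has_bochner_integral lborel (\<lambda>x. std_normal_density x *\<^sub>R iexp (t * x)) (complex_of_real (exp (- t\<^sup>2 / 2)))" for t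
  proof -
    have "integrable lborel (\<lambda>x. std_normal_density x *\<^sub>R iexp (t * x))"
      by (rule Bochner_Integration.integrable_bound[of _ "std_normal_density"])
         auto
    moreover have "(\<integral>x. std_normal_density x *\<^sub>R iexp (t * x) \<partial>lborel) = complex_of_real (exp (- t\<^sup>2 / 2))"
      using fun_cong[OF char_std_normal_distribution, of t]
      unfolding char_def
      by (subst (asm) integral_density) auto
    ultimately show ?thesis by (simp add: has_bochner_integral_iff)
  qed
  have s: "sqrt (2*k) \<noteq> 0" using assms by simp
  define t where "t = \<theta> / sqrt (2*k)"
  have "has_bochner_integral lborel (\<lambda>x. std_normal_density (0 + sqrt (2*k) * x) *\<^sub>R iexp (t * (0 + sqrt (2*k) * x)))
     (complex_of_real (exp (- t\<^sup>2 / 2)) /\<^sub>R \<bar>sqrt (2*k)\<bar>)"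
    using lborel_has_bochner_integral_real_affine_iff[OF s, of "(\<lambda>x. std_normal_density x *\<^sub>R iexp (t * x))" _ 0] *
    by blast
  from has_bochner_integral_mult_right[OF this, where c= "complex_of_real (sqrt (2*pi))"]
  have "has_bochner_integral lborel (\<lambda>x. complex_of_real (sqrt (2*pi)) * (std_normal_density (sqrt (2*k) * x) *\<^sub>R iexp (\<theta> * x)))
     (complex_of_real (sqrt (2*pi)) * (complex_of_real (exp (- t\<^sup>2 / 2)) /\<^sub>R \<bar>sqrt (2*k)\<bar>))"
    using assms by (simp add: t_def mult.assoc)
  moreover have "complex_of_real (sqrt (2*pi)) * (std_normal_density (sqrt (2*k) * x) *\<^sub>R iexp (\<theta> * x))
     = complex_of_real (exp (- k * x\<^sup>2)) * cis (\<theta> * x)" for x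
    using assms by (simp add: std_normal_density_def scaleR_conv_of_real cis_conv_exp power_mult_distrib)
  moreover have "complex_of_real (sqrt (2*pi)) * (complex_of_real (exp (- t\<^sup>2 / 2)) /\<^sub>R \<bar>sqrt (2*k)\<bar>)
     = complex_of_real (sqrt (pi / k) * exp (- \<theta>\<^sup>2 / (4 * k)))"
  proof -
    have "- t\<^sup>2 / 2 = - \<theta>\<^sup>2 / (4 * k)" using assms by (simp add: t_def power_divide)
    moreover have "sqrt (2*pi) / sqrt (2*k) = sqrt (pi / k)" by (simp flip: real_sqrt_divide)
    moreover have "complex_of_real (sqrt (2*pi)) * (complex_of_real e /\<^sub>R \<bar>sqrt (2*k)\<bar>) =
       complex_of_real (sqrt (2*pi) / sqrt (2*k) * e)" for e
      using assms by (simp add: scaleR_conv_of_real divide_inverse)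
    ultimately show ?thesis by simp
  qed
  ultimately show ?thesis by simp
qed

lemma integral_gaussian:
  assumes "0 < k"
  shows "(LINT x|lborel. exp (- k * (x::real)\<^sup>2)) = sqrt (pi / k)"
proof -
  have "complex_of_real (LINT x|lborel. exp (- k * (x::real)\<^sup>2)) = complex_of_real (sqrt (pi / k))"
    using has_integral_gaussian_cis[OF assms, of 0]
    by (simp add: has_bochner_integral_iff flip: integral_complex_of_real)
  thus ?thesis using of_real_eq_iff by blast
qed

lemma has_integral_shifted_gaussian_cis:
  assumes "0 < k"
  shows "has_bochner_integral lborel (\<lambda>x::real. complex_of_real (exp (- k * (x - x0)\<^sup>2)) * cis (\<theta> * x))
    (complex_of_real (sqrt (pi / k) * exp (- \<theta>\<^sup>2 / (4 * k))) * cis (\<theta> * x0))"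
proof -
  let ?f = "\<lambda>x::real. complex_of_real (exp (- k * (x - x0)\<^sup>2)) * cis (\<theta> * x)"
  have "has_bochner_integral lborel (\<lambda>x. ?f (x0 + 1 * x)) (complex_of_real (sqrt (pi / k) * exp (- \<theta>\<^sup>2 / (4 * k))) * cis (\<theta> * x0) /\<^sub>R \<bar>1\<bar>)"
  proof -
    have "?f (x0 + 1 * x) = complex_of_real (exp (- k * x\<^sup>2)) * cis (\<theta> * x) * cis (\<theta> * x0)" for x
      by (simp add: cis_mult algebra_simps)
    thus ?thesis using has_bochner_integral_mult_left[OF has_integral_gaussian_cis[OF assms], where c="cis (\<theta> * x0)"]
      by (simp add: mult.assoc)
  qed
  thus ?thesis using lborel_has_bochner_integral_real_affine_iff[of 1 ?f _ x0] by simp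
qed

lemma integrable_gaussian_pair:
  assumes "0 < k"
  shows "integrable (lborel \<Otimes>\<^sub>M lborel) (\<lambda>(x::real, y::real). exp (- k * (x\<^sup>2 + y\<^sup>2)))"
proof (rule lborel_pair.Fubini_integrable)
  have eq: "exp (- k * (x\<^sup>2 + y\<^sup>2)) = exp (- k * x\<^sup>2) * exp (- k * y\<^sup>2)" for x y :: real
    by (simp add: exp_add[symmetric] algebra_simps)
  show "integrable lborel (\<lambda>x. LINT y|lborel. norm (case (x, y) of (x, y) \<Rightarrow> exp (- k * (x\<^sup>2 + y\<^sup>2))))"
    unfolding prod.case eq using integrable_gaussian[OF assms] by simp
  show "AE x in lborel. integrable lborel (\<lambda>y. case (x, y) of (x, y) \<Rightarrow> exp (- k * (x\<^sup>2 + y\<^sup>2)))"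
    unfolding prod.case eq using integrable_gaussian[OF assms] by simp
qed measurable

lemma cis_measurable [measurable]: "cis \<in> borel_measurable borel"
  by (intro borel_measurable_continuous_onI continuous_intros)

lemma cnj_measurable [measurable]: "cnj \<in> borel_measurable borel"
  by (intro borel_measurable_continuous_onI continuous_intros)

lemma integrable_gaussian_cis:
  assumes "0 < k" "g \<in> borel_measurable borel"
  shows "integrable lborel (\<lambda>x::real. complex_of_real (exp (- k * (x - x0)\<^sup>2)) * cis (g x))"
proof (rule Bochner_Integration.integrable_bound)
  show "integrable lborel (\<lambda>x::real. complex_of_real (exp (- k * (x - x0)\<^sup>2)) * cis (0 * x))"
    using has_integral_shifted_gaussian_cis[OF assms(1), of x0 0] by (simp add: has_bochner_integral_iff)
qed (use assms(2) in \<open>auto simp: norm_mult\<close>)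

text \<open>The squared modulus is a double integral in which shearing the variables removes the quadratic phase.\<close>
lemma norm_chirp_gaussian_centered:
  assumes k: "0 < k"
  shows "(norm (LINT x|lborel. complex_of_real (exp (- k * x\<^sup>2)) * cis (R * x\<^sup>2 + L * x)))\<^sup>2
     = pi / sqrt (k\<^sup>2 + R\<^sup>2) * exp (- k * L\<^sup>2 / (2 * (k\<^sup>2 + R\<^sup>2)))"
proof -
  define f where "f x = complex_of_real (exp (- k * x\<^sup>2)) * cis (R * x\<^sup>2 + L * x)" for x
  define I where "I = (LINT x|lborel. f x)"
  have [measurable]: "f \<in> borel_measurable borel" unfolding f_def by measurable
  have int: "integrable lborel f"
    using integrable_gaussian_cis[OF k, of "\<lambda>x. R * x\<^sup>2 + L * x" 0] unfolding f_def by simp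
  have shear: "f (y + D) * cnj (f y) =
     complex_of_real (exp (- (2*k) * (y - (- D/2))\<^sup>2)) * cis (2*R*D * y) *
     (complex_of_real (exp (- (k/2) * D\<^sup>2)) * cis (R * D\<^sup>2 + L * D))" for y D
  proof -
    have "exp (- k * (y + D)\<^sup>2) * exp (- k * y\<^sup>2) = exp (- (2*k) * (y - (- D/2))\<^sup>2) * exp (- (k/2) * D\<^sup>2)"
      by (simp add: exp_add[symmetric] power2_eq_square field_simps)
    moreover have "cis (R * (y + D)\<^sup>2 + L * (y + D)) * cis (- (R * y\<^sup>2 + L * y)) = cis (2*R*D * y) * cis (R * D\<^sup>2 + L * D)"
      unfolding cis_mult by (rule arg_cong[of _ _ cis]) (simp add: power2_eq_square algebra_simps)
    moreover have "f (y + D) * cnj (f y) = complex_of_real (exp (- k * (y + D)\<^sup>2) * exp (- k * y\<^sup>2)) *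
       (cis (R * (y + D)\<^sup>2 + L * (y + D)) * cis (- (R * y\<^sup>2 + L * y)))"
      by (simp only: f_def cis_cnj of_real_mult complex_cnj_mult complex_cnj_complex_of_real mult_ac)
    ultimately show ?thesis
      by (simp only: of_real_mult mult_ac)
  qed
  have inner: "(LINT y|lborel. f (y + D) * cnj (f y)) =
      complex_of_real (sqrt (pi / (2*k))) *
      (complex_of_real (exp (- (k/2 + R\<^sup>2 / (2*k)) * D\<^sup>2)) * cis (L * D))" for D
  proof -
    have "(LINT y|lborel. f (y + D) * cnj (f y)) =
      complex_of_real (sqrt (pi / (2*k)) * exp (- (2*R*D)\<^sup>2 / (4 * (2*k)))) * cis (2*R*D * (- D/2)) *
      (complex_of_real (exp (- (k/2) * D\<^sup>2)) * cis (R * D\<^sup>2 + L * D))"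
      unfolding shear
      using has_integral_shifted_gaussian_cis[of "2*k" "- D/2" "2*R*D"] k
      by (simp add: has_bochner_integral_iff)
    moreover have "exp (- (2*R*D)\<^sup>2 / (4 * (2*k))) * exp (- (k/2) * D\<^sup>2) = exp (- (k/2 + R\<^sup>2 / (2*k)) * D\<^sup>2)"
      using k by (simp add: exp_add[symmetric] power2_eq_square field_simps)
    moreover have "cis (2*R*D * (- D/2)) * cis (R * D\<^sup>2 + L * D) = cis (L * D)"
      unfolding cis_mult by (rule arg_cong[of _ _ cis]) (simp add: power2_eq_square algebra_simps)
    moreover have "complex_of_real (a * b) * c * (complex_of_real e * f) = complex_of_real a * (complex_of_real (b * e) * (c * f))"
      for a b c e f by simp
    ultimately show ?thesis by metis
  qed
  \<comment> \<open>Fubini needs joint decay in \<open>y\<close> and \<open>D\<close>. The quadratic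
    form \<open>(y + D)\<^sup>2 + y\<^sup>2\<close> is positive definite, so it dominates a small
    multiple of \<open>y\<^sup>2 + D\<^sup>2\<close>; \<open>1/4\<close> is small enough.\<close>
  have pair: "integrable (lborel \<Otimes>\<^sub>M lborel) (\<lambda>(y, D). f (y + D) * cnj (f y))"
  proof (rule Bochner_Integration.integrable_bound)
    show "integrable (lborel \<Otimes>\<^sub>M lborel) (\<lambda>(x::real, y::real). exp (- (k/4) * (x\<^sup>2 + y\<^sup>2)))"
      using k by (intro integrable_gaussian_pair) auto
    have "(y + D)\<^sup>2 + y\<^sup>2 \<ge> (y\<^sup>2 + D\<^sup>2) / 4" for y D :: real
    proof -
      have "(y + D)\<^sup>2 + y\<^sup>2 - (y\<^sup>2 + D\<^sup>2) / 4 = 7/4 * (y + 4/7 * D)\<^sup>2 + 5/28 * D\<^sup>2"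
        by (simp add: power2_eq_square field_simps)
      thus ?thesis using zero_le_power2[of "y + 4/7 * D"] zero_le_power2[of D] by linarith
    qed
    hence "k * ((y + D)\<^sup>2 + y\<^sup>2) \<ge> k * ((y\<^sup>2 + D\<^sup>2) / 4)" for y D :: real
      using k by (intro mult_left_mono) auto
    note H = this
    have *: "exp (- k * (y + D)\<^sup>2) * exp (- k * y\<^sup>2) \<le> exp (- (k/4) * (y\<^sup>2 + D\<^sup>2))" for y D :: real
      using H[of y D] by (simp add: exp_add[symmetric] algebra_simps)
    show "AE x in lborel \<Otimes>\<^sub>M lborel. norm (case x of (y, D) \<Rightarrow> f (y + D) * cnj (f y))
            \<le> norm (case x of (x, y) \<Rightarrow> exp (- (k/4) * (x\<^sup>2 + y\<^sup>2)))"
      using * by (auto simp: f_def norm_mult split: prod.splits)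
  qed measurable
  \<comment> \<open>Translation invariance: integrating out the shift \<open>D\<close> first
    restores \<open>I\<close>, so the double integral is \<open>|I|\<^sup>2\<close>.\<close>
  have tr: "(LINT D|lborel. f (y + D) * cnj (f y)) = I * cnj (f y)" for y
    unfolding I_def using lborel_integral_real_affine[of 1 f y] by simp
  have s1: "I * cnj I = (LINT y|lborel. LINT D|lborel. f (y + D) * cnj (f y))"
    unfolding tr using int by (simp add: I_def)
  have s2: "\<dots> = (LINT D|lborel. LINT y|lborel. f (y + D) * cnj (f y))"
    using lborel_pair.Fubini_integral[OF pair] by simp
  have s3: "\<dots> = complex_of_real (sqrt (pi / (2*k))) *
       complex_of_real (sqrt (pi / (k/2 + R\<^sup>2 / (2*k))) * exp (- L\<^sup>2 / (4 * (k/2 + R\<^sup>2 / (2*k)))))"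
    unfolding inner using has_integral_gaussian_cis[of "k/2 + R\<^sup>2 / (2*k)" L] k
    by (simp add: has_bochner_integral_iff add_pos_nonneg)
  have "complex_of_real ((norm I)\<^sup>2) = complex_of_real (sqrt (pi / (2*k)) *
       (sqrt (pi / (k/2 + R\<^sup>2 / (2*k))) * exp (- L\<^sup>2 / (4 * (k/2 + R\<^sup>2 / (2*k))))))"
    unfolding complex_norm_square s1 s2 s3 by simp
  hence nI: "(norm I)\<^sup>2 = sqrt (pi / (2*k)) * sqrt (pi / (k/2 + R\<^sup>2 / (2*k))) * exp (- L\<^sup>2 / (4 * (k/2 + R\<^sup>2 / (2*k))))"
    unfolding of_real_eq_iff by simp
  have e1: "sqrt (pi / (2*k)) * sqrt (pi / (k/2 + R\<^sup>2 / (2*k))) = pi / sqrt (k\<^sup>2 + R\<^sup>2)"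
  proof -
    have "pi / (2*k) * (pi / (k/2 + R\<^sup>2 / (2*k))) = pi\<^sup>2 / (k\<^sup>2 + R\<^sup>2)"
      using k by (simp add: power2_eq_square field_simps add_pos_nonneg)
    thus ?thesis unfolding real_sqrt_mult[symmetric] by (simp add: real_sqrt_divide)
  qed
  have eq: "k/2 + R\<^sup>2 / (2*k) = (k\<^sup>2 + R\<^sup>2) / (2*k)"
    using k by (simp add: power2_eq_square field_simps)
  have e2: "- L\<^sup>2 / (4 * (k/2 + R\<^sup>2 / (2*k))) = - k * L\<^sup>2 / (2 * (k\<^sup>2 + R\<^sup>2))"
  proof -
    have "- L\<^sup>2 / (4 * (S / (2*k))) = - k * L\<^sup>2 / (2 * S)" if "0 < S" for S
      using k that by (simp add: field_simps)
    moreover have "0 < k\<^sup>2 + R\<^sup>2" using k by (simp add: add_pos_nonneg)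
    ultimately show ?thesis unfolding eq by blast
  qed
  show ?thesis using nI unfolding e1 e2 by (simp only: I_def f_def[abs_def])
qed

text \<open>Translation by \<open>x0\<close> adds \<open>2 * R * x0\<close> to the linear frequency,
  up to a unimodular constant. The Gaussian factor thus measures the derivative of the phase at the
  centre \<open>x0\<close>.\<close>

lemma norm_chirp_gaussian:
  assumes k: "0 < k"
  shows "(norm (LINT x|lborel. complex_of_real (exp (- k * (x - x0)\<^sup>2)) * cis (R * x\<^sup>2 + L * x)))\<^sup>2
     = pi / sqrt (k\<^sup>2 + R\<^sup>2) * exp (- k * (2 * R * x0 + L)\<^sup>2 / (2 * (k\<^sup>2 + R\<^sup>2)))"
proof -
  let ?f = "\<lambda>x. complex_of_real (exp (- k * (x - x0)\<^sup>2)) * cis (R * x\<^sup>2 + L * x)"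
  have sh: "?f (x0 + 1 * x) = complex_of_real (exp (- k * x\<^sup>2)) * cis (R * x\<^sup>2 + (2 * R * x0 + L) * x) * cis (R * x0\<^sup>2 + L * x0)" for x
  proof -
    have "R * (x0 + x)\<^sup>2 + L * (x0 + x) = R * x\<^sup>2 + (2 * R * x0 + L) * x + (R * x0\<^sup>2 + L * x0)"
      by (simp add: power2_eq_square algebra_simps)
    thus ?thesis by (simp add: cis_mult)
  qed
  have "norm (LINT x|lborel. ?f x) = norm (LINT x|lborel. ?f (x0 + 1 * x))"
    using lborel_integral_real_affine[of 1 ?f x0] by simp
  hence n: "norm (LINT x|lborel. ?f x) = norm (LINT x|lborel. complex_of_real (exp (- k * x\<^sup>2)) * cis (R * x\<^sup>2 + (2 * R * x0 + L) * x))"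
    unfolding sh by (simp add: norm_mult)
  show ?thesis unfolding n by (rule norm_chirp_gaussian_centered[OF k])
qed

section \<open>Gaussian integrals in several variables\<close>

lemma has_integral_prod_Basis:
  fixes F :: "'a::euclidean_space \<Rightarrow> real \<Rightarrow> complex"
  assumes "\<And>b. b \<in> Basis \<Longrightarrow> integrable lborel (F b)"
  shows "has_bochner_integral lborel (\<lambda>x::'a. \<Prod>b\<in>Basis. F b (x \<bullet> b)) (\<Prod>b\<in>Basis. LINT x|lborel. F b x)"
proof -
  interpret product_sigma_finite "\<lambda>_::'a. lborel :: real measure"
    by standard
  let ?M = "\<Pi>\<^sub>M b\<in>(Basis::'a set). (lborel :: real measure)"
  have [measurable]: "\<And>b. b \<in> Basis \<Longrightarrow> F b \<in> borel_measurable borel"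
    using assms borel_measurable_integrable by fastforce
  have meas: "(\<lambda>x::'a. \<Prod>b\<in>Basis. F b (x \<bullet> b)) \<in> borel_measurable borel"
    by measurable
  have comp: "(\<Prod>b\<in>Basis. F b ((\<Sum>c\<in>Basis. f c *\<^sub>R c) \<bullet> b)) = (\<Prod>b\<in>Basis. F b (f b))" for f :: "'a \<Rightarrow> real"
    by (intro prod.cong refl) (simp add: inner_sum_left_Basis)
  have m: "(\<lambda>f. \<Sum>b\<in>Basis. f b *\<^sub>R b) \<in> measurable ?M (borel :: 'a measure)"
    by measurable
  have "integrable lborel (\<lambda>x::'a. \<Prod>b\<in>Basis. F b (x \<bullet> b))"
    unfolding lborel_eq[where 'a='a]
    by (subst integrable_distr_eq[OF m meas]) (simp add: comp product_integrable_prod assms)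
  moreover have "(LINT x|lborel. (\<Prod>b\<in>Basis. F b ((x::'a) \<bullet> b))) = (\<Prod>b\<in>Basis. LINT x|lborel. F b x)"
    unfolding lborel_eq[where 'a='a]
    by (subst integral_distr[OF m meas]) (simp add: comp product_integral_prod assms)
  ultimately show ?thesis by (simp add: has_bochner_integral_iff)
qed

lemma cis_sum: "finite A \<Longrightarrow> cis (\<Sum>i\<in>A. f i) = (\<Prod>i\<in>A. cis (f i))"
  by (induction A rule: finite_induct) (auto simp: cis_mult[symmetric])

text \<open>The quadratic coefficients depend on the coordinate because, for pairs, only the second
  component will carry a quadratic phase.\<close>

definition chirp :: "real \<Rightarrow> 'v::euclidean_space \<Rightarrow> ('v \<Rightarrow> real) \<Rightarrow> 'v \<Rightarrow> 'v \<Rightarrow> complex" where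
  "chirp k Y0 R \<theta> Y = complex_of_real (exp (- k * (norm (Y - Y0))\<^sup>2)) * cis ((\<Sum>b\<in>Basis. R b * (Y \<bullet> b)\<^sup>2) + \<theta> \<bullet> Y)"

lemma
  fixes Y0 \<theta> :: "'v::euclidean_space"
  assumes k: "0 < k"
  shows integrable_chirp: "integrable lborel (chirp k Y0 R \<theta>)"
    and norm_integral_chirp: "(norm (LINT Y|lborel. chirp k Y0 R \<theta> Y))\<^sup>2 =
      (\<Prod>b\<in>Basis. pi / sqrt (k\<^sup>2 + (R b)\<^sup>2) * exp (- k * (2 * R b * (Y0 \<bullet> b) + \<theta> \<bullet> b)\<^sup>2 / (2 * (k\<^sup>2 + (R b)\<^sup>2))))"
proof -
  let ?F = "\<lambda>b x. complex_of_real (exp (- k * (x - Y0 \<bullet> b)\<^sup>2)) * cis (R b * x\<^sup>2 + (\<theta> \<bullet> b) * x)"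
  have eq: "chirp k Y0 R \<theta> = (\<lambda>Y. \<Prod>b\<in>Basis. ?F b (Y \<bullet> b))"
  proof
    fix Y
    have "(norm (Y - Y0))\<^sup>2 = (\<Sum>b\<in>Basis. (Y \<bullet> b - Y0 \<bullet> b)\<^sup>2)"
      unfolding power2_norm_eq_inner by (subst euclidean_inner) (simp add: power2_eq_square inner_diff_left)
    hence 1: "exp (- k * (norm (Y - Y0))\<^sup>2) = (\<Prod>b\<in>Basis. exp (- k * (Y \<bullet> b - Y0 \<bullet> b)\<^sup>2))"
      by (simp add: exp_sum[symmetric] sum_distrib_left sum_negf)
    have "(\<Sum>b\<in>Basis. R b * (Y \<bullet> b)\<^sup>2) + \<theta> \<bullet> Y = (\<Sum>b\<in>Basis. R b * (Y \<bullet> b)\<^sup>2 + (\<theta> \<bullet> b) * (Y \<bullet> b))"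
      by (subst euclidean_inner) (simp add: sum.distrib)
    hence 2: "cis ((\<Sum>b\<in>Basis. R b * (Y \<bullet> b)\<^sup>2) + \<theta> \<bullet> Y) = (\<Prod>b\<in>Basis. cis (R b * (Y \<bullet> b)\<^sup>2 + (\<theta> \<bullet> b) * (Y \<bullet> b)))"
      by (simp only: cis_sum[OF finite_Basis])
    show "chirp k Y0 R \<theta> Y = (\<Prod>b\<in>Basis. ?F b (Y \<bullet> b))"
      unfolding chirp_def 1 2 by (simp add: prod.distrib)
  qed
  have int: "integrable lborel (?F b)" for b
    by (rule integrable_gaussian_cis[OF k]) simp
  note * = has_integral_prod_Basis[of ?F, OF int]
  show "integrable lborel (chirp k Y0 R \<theta>)" unfolding eq using * by (simp only: has_bochner_integral_iff)
  have I: "(LINT Y|lborel. chirp k Y0 R \<theta> Y) = (\<Prod>b\<in>Basis. (LINT x|lborel. ?F b x))"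
    unfolding eq using * by (simp only: has_bochner_integral_iff)
  show "(norm (LINT Y|lborel. chirp k Y0 R \<theta> Y))\<^sup>2 =
      (\<Prod>b\<in>Basis. pi / sqrt (k\<^sup>2 + (R b)\<^sup>2) * exp (- k * (2 * R b * (Y0 \<bullet> b) + \<theta> \<bullet> b)\<^sup>2 / (2 * (k\<^sup>2 + (R b)\<^sup>2))))"
    unfolding I prod_norm[symmetric] prod_power_distrib norm_chirp_gaussian[OF k] by (rule refl)
qed

lemma prod_Basis_prod_eq:
  fixes f :: "('a::euclidean_space \<times> 'b::euclidean_space) \<Rightarrow> 'c::comm_monoid_mult"
  shows "prod f Basis = (\<Prod>i\<in>Basis. f (i, 0)) * (\<Prod>i\<in>Basis. f (0, i))"
proof -
  have "inj_on (\<lambda>u. (u::'a, 0::'b)) Basis" "inj_on (\<lambda>u. (0::'a, u::'b)) Basis"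
    by (auto intro!: inj_onI Pair_inject)
  thus ?thesis
    unfolding Basis_prod_def
    by (subst prod.union_disjoint) (auto simp: Basis_prod_def prod.reindex)
qed

lemma sum_Basis_Pair_eq:
  fixes f :: "('a::euclidean_space \<times> 'b::euclidean_space) \<Rightarrow> 'c::comm_monoid_add"
  shows "sum f Basis = (\<Sum>i\<in>Basis. f (i, 0)) + (\<Sum>i\<in>Basis. f (0, i))"
proof -
  have "inj_on (\<lambda>u. (u::'a, 0::'b)) Basis" "inj_on (\<lambda>u. (0::'a, u::'b)) Basis"
    by (auto intro!: inj_onI Pair_inject)
  thus ?thesis
    unfolding Basis_prod_def
    by (subst sum.union_disjoint) (auto simp: Basis_prod_def sum.reindex)
qed

subsection \<open>Fourier transforms of smoothed shells\<close>

text \<open>A smoothed indicator of the set of points \<open>(y, p)\<close> within \<open>O(k powr (-1/2))\<close> of \<open>g\<close> satisfying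
  \<open>t\<^sup>2 |p|\<^sup>2 = c + O(l)\<close>.\<close>
definition shell :: "real \<Rightarrow> real \<Rightarrow> real \<Rightarrow> real \<Rightarrow> 'a::euclidean_space \<times> 'a \<Rightarrow> 'a \<times> 'a \<Rightarrow> real" where
  "shell k t c l g Y = exp (- k * (norm (Y - g))\<^sup>2) * exp (- (t\<^sup>2 * (norm (snd Y))\<^sup>2 - c)\<^sup>2 / (2 * l\<^sup>2))"

definition shell_ft :: "real \<Rightarrow> real \<Rightarrow> real \<Rightarrow> real \<Rightarrow> 'a::euclidean_space \<times> 'a \<Rightarrow> 'a \<times> 'a \<Rightarrow> complex" where
  "shell_ft k t c l g \<theta> = (LINT Y|lborel. complex_of_real (shell k t c l g Y) * cis (\<theta> \<bullet> Y))"

text \<open>What remains of \<open>shell\<close> after its thin factor has been written as a Fourier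
  integral in an auxiliary frequency \<open>r\<close>, with
  \<open>R = r * t\<^sup>2\<close>.\<close>

definition pchirp :: "real \<Rightarrow> 'a::euclidean_space \<times> 'a \<Rightarrow> real \<Rightarrow> 'a \<times> 'a \<Rightarrow> 'a \<times> 'a \<Rightarrow> complex" where
  "pchirp k g R \<theta> Y = complex_of_real (exp (- k * (norm (Y - g))\<^sup>2)) * cis (R * (norm (snd Y))\<^sup>2 + \<theta> \<bullet> Y)"

lemma
  fixes g \<theta> :: "'a::euclidean_space \<times> 'a"
  assumes k: "0 < k"
  shows integrable_pchirp: "integrable lborel (pchirp k g R \<theta>)"
    and norm_integral_pchirp: "(norm (LINT Y|lborel. pchirp k g R \<theta> Y))\<^sup>2 =
       (pi / k) ^ DIM('a) * exp (- (norm (fst \<theta>))\<^sup>2 / (2 * k)) *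
       ((pi / sqrt (k\<^sup>2 + R\<^sup>2)) ^ DIM('a) * exp (- k * (norm ((2 * R) *\<^sub>R snd g + snd \<theta>))\<^sup>2 / (2 * (k\<^sup>2 + R\<^sup>2))))"
proof -
  define S where "S = (\<lambda>b::'a\<times>'a. if fst b = 0 then R else 0)"
  have n: "(\<Sum>b\<in>Basis. (v \<bullet> b)\<^sup>2) = (norm v)\<^sup>2" for v :: 'a
    unfolding power2_norm_eq_inner by (subst euclidean_inner) (simp add: power2_eq_square)
  have eq: "pchirp k g R \<theta> = chirp k g S \<theta>"
  proof
    fix Y
    have "(\<Sum>b\<in>Basis. S b * (Y \<bullet> b)\<^sup>2) = R * (norm (snd Y))\<^sup>2"
    proof -
      have "(\<Sum>i\<in>Basis. S (i, 0) * (Y \<bullet> (i, 0))\<^sup>2) = 0"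
        by (intro sum.neutral) (auto simp: S_def)
      thus ?thesis unfolding sum_Basis_Pair_eq by (cases Y) (simp add: S_def n flip: sum_distrib_left)
    qed
    thus "pchirp k g R \<theta> Y = chirp k g S \<theta> Y"
      by (simp add: pchirp_def chirp_def)
  qed
  show "integrable lborel (pchirp k g R \<theta>)" unfolding eq by (rule integrable_chirp[OF k])
  have "(\<Prod>b\<in>Basis. pi / sqrt (k\<^sup>2 + (S b)\<^sup>2) * exp (- k * (2 * S b * (g \<bullet> b) + \<theta> \<bullet> b)\<^sup>2 / (2 * (k\<^sup>2 + (S b)\<^sup>2))))
    = (\<Prod>b\<in>Basis. pi / k * exp (- (1 / (2 * k)) * (fst \<theta> \<bullet> b)\<^sup>2)) *
      (\<Prod>b\<in>Basis. pi / sqrt (k\<^sup>2 + R\<^sup>2) * exp (- (k / (2 * (k\<^sup>2 + R\<^sup>2))) * (((2 * R) *\<^sub>R snd g + snd \<theta>) \<bullet> b)\<^sup>2))"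
    unfolding prod_Basis_prod_eq using k
    by (cases g; cases \<theta>) (auto intro!: arg_cong2[of _ _ _ _ "(*)"] prod.cong simp: S_def inner_add_left power2_eq_square)
  also have "\<dots> = (pi / k) ^ DIM('a) * exp (- (1 / (2 * k)) * (norm (fst \<theta>))\<^sup>2) *
      ((pi / sqrt (k\<^sup>2 + R\<^sup>2)) ^ DIM('a) * exp (- (k / (2 * (k\<^sup>2 + R\<^sup>2))) * (norm ((2 * R) *\<^sub>R snd g + snd \<theta>))\<^sup>2))"
    unfolding prod.distrib exp_sum[symmetric, OF finite_Basis] sum_distrib_left[symmetric] n by simp
  finally show "(norm (LINT Y|lborel. pchirp k g R \<theta> Y))\<^sup>2 =
       (pi / k) ^ DIM('a) * exp (- (norm (fst \<theta>))\<^sup>2 / (2 * k)) *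
       ((pi / sqrt (k\<^sup>2 + R\<^sup>2)) ^ DIM('a) * exp (- k * (norm ((2 * R) *\<^sub>R snd g + snd \<theta>))\<^sup>2 / (2 * (k\<^sup>2 + R\<^sup>2))))"
    unfolding eq norm_integral_chirp[OF k] by simp
qed

text \<open>The thin factor of the shell is a Gaussian average of \<open>cis\<close> over auxiliary
  frequencies \<open>r\<close> up to about \<open>1/l\<close>. By Fubini the transform becomes the
  same average of chirp integrals, so any pointwise bound \<open>h\<close> for these passes through;
  the position \<open>c\<close> of the shell enters as a unimodular factor and disappears.\<close>

lemma shell_ft_le:
  fixes g \<theta> :: "'a::euclidean_space \<times> 'a"
  assumes k: "0 < k" and l: "0 < l"
    and h: "\<And>r. norm (LINT Y|lborel. pchirp k g (r * t\<^sup>2) \<theta> Y) \<le> h r"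
    and hint: "integrable lborel (\<lambda>r. exp (- (l\<^sup>2/2) * r\<^sup>2) * h r)"
  shows "norm (shell_ft k t c l g \<theta>) \<le> l / sqrt (2*pi) * (LINT r|lborel. exp (- (l\<^sup>2/2) * r\<^sup>2) * h r)"
proof -
  define G where "G r Y = complex_of_real (exp (- (l\<^sup>2/2) * r\<^sup>2)) * cis (- c * r) * pchirp k g (r * t\<^sup>2) \<theta> Y" for r Y
  define K where "K = complex_of_real (l / sqrt (2*pi))"
  have thin: "complex_of_real (exp (- v\<^sup>2 / (2 * l\<^sup>2))) = K * (LINT r|lborel. complex_of_real (exp (- (l\<^sup>2/2) * r\<^sup>2)) * cis (v * r))" for v
  proof -
    have "(LINT r|lborel. complex_of_real (exp (- (l\<^sup>2/2) * r\<^sup>2)) * cis (v * r)) =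
       complex_of_real (sqrt (pi / (l\<^sup>2/2)) * exp (- v\<^sup>2 / (4 * (l\<^sup>2/2))))"
      using has_integral_gaussian_cis[of "l\<^sup>2/2" v] l by (simp add: has_bochner_integral_iff)
    moreover have "l / sqrt (2*pi) * (sqrt (pi / (l\<^sup>2/2)) * exp (- v\<^sup>2 / (4 * (l\<^sup>2/2)))) = exp (- v\<^sup>2 / (2 * l\<^sup>2))"
      using l by (simp add: real_sqrt_divide real_sqrt_mult)
    ultimately show ?thesis
      unfolding K_def by (simp only: flip: of_real_mult)
  qed
  have G_alt: "G r Y = complex_of_real (exp (- k * (norm (Y - g))\<^sup>2)) * cis (\<theta> \<bullet> Y) *
       (complex_of_real (exp (- (l\<^sup>2/2) * r\<^sup>2)) * cis ((t\<^sup>2 * (norm (snd Y))\<^sup>2 - c) * r))" for r Y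
  proof -
    have "cis (- c * r) * cis (r * t\<^sup>2 * (norm (snd Y))\<^sup>2 + \<theta> \<bullet> Y) = cis (\<theta> \<bullet> Y) * cis ((t\<^sup>2 * (norm (snd Y))\<^sup>2 - c) * r)"
      unfolding cis_mult by (rule arg_cong[of _ _ cis]) (simp add: algebra_simps)
    moreover have "a * b * (e * f) = e * a * (b * f)" for a b e f :: complex by simp
    ultimately show ?thesis unfolding G_def pchirp_def by (simp add: mult.assoc mult.left_commute)
  qed
  have 1: "complex_of_real (shell k t c l g Y) * cis (\<theta> \<bullet> Y) = K * (LINT r|lborel. G r Y)" for Y
    unfolding shell_def of_real_mult thin G_alt by simp
  have normG: "norm (G r Y) = exp (- (l\<^sup>2/2) * r\<^sup>2) * exp (- k * (norm (Y - g))\<^sup>2)" for r Y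
    by (simp add: G_def pchirp_def norm_mult)
  have l2: "0 < l\<^sup>2/2" using l by simp
  have intY: "integrable lborel (\<lambda>Y. exp (- k * (norm (Y - g))\<^sup>2))"
    using integrable_norm[OF integrable_pchirp[OF k, of g 0 0]] by (simp add: pchirp_def norm_mult)
  have pair: "integrable (lborel \<Otimes>\<^sub>M lborel) (\<lambda>(r, Y). G r Y)"
  proof (rule lborel_pair.Fubini_integrable)
    show "(\<lambda>(r, Y). G r Y) \<in> borel_measurable (lborel \<Otimes>\<^sub>M lborel)"
      unfolding G_def pchirp_def lborel_prod split_beta'
      by (simp, intro borel_measurable_continuous_onI continuous_intros, simp)
    show "integrable lborel (\<lambda>x. LINT y|lborel. norm (case (x, y) of (r, Y) \<Rightarrow> G r Y))"
      unfolding prod.case normG using integrable_gaussian[OF l2] by simp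
    show "AE x in lborel. integrable lborel (\<lambda>y. case (x, y) of (r, Y) \<Rightarrow> G r Y)"
      unfolding prod.case G_def by (intro AE_I2 integrable_mult_right integrable_pchirp k)
  qed
  have "shell_ft k t c l g \<theta> = K * (LINT Y|lborel. LINT r|lborel. G r Y)"
    unfolding shell_ft_def 1 by simp
  moreover have "(LINT Y|lborel. LINT r|lborel. G r Y) = (LINT r|lborel. LINT Y|lborel. G r Y)"
    using lborel_pair.Fubini_integral[OF pair] by simp
  moreover have "norm (LINT r|lborel. LINT Y|lborel. G r Y) \<le> (LINT r|lborel. exp (- (l\<^sup>2/2) * r\<^sup>2) * h r)"
  proof (rule Bochner_Integration.integral_norm_bound_integral[OF _ hint])
    show "integrable lborel (\<lambda>r. LINT Y|lborel. G r Y)"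
      using lborel_pair.integrable_fst'[OF pair] by simp
    show "norm (LINT Y|lborel. G r Y) \<le> exp (- (l\<^sup>2/2) * r\<^sup>2) * h r" for r
      unfolding G_def using h[of r] by (simp add: norm_mult mult_left_mono)
  qed
  moreover have "norm K = l / sqrt (2*pi)" using l unfolding K_def norm_of_real by simp
  ultimately show ?thesis
    using l by (simp only: norm_mult) (intro mult_left_mono, auto)
qed

lemma inverse_sqrt_one_plus_square_le_1: "1 / sqrt (1 + r\<^sup>2) \<le> (1::real)"
proof -
  have "1 \<le> sqrt (1 + r\<^sup>2)" by simp
  hence "1 / sqrt (1 + r\<^sup>2) \<le> 1 / 1" by (intro divide_left_mono) (auto simp: add_pos_nonneg)
  thus ?thesis by simp
qed

text \<open>The dispersive factor decays like \<open>R powr (- DIM('a) / 2)\<close>. For dimension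
  at least \<open>2\<close> this is at least as good as \<open>1 / R\<close>, which later makes the
  integral over \<open>|r| \<le> 1/l\<close> lose only a logarithm.\<close>

lemma norm_integral_pchirp_le:
  fixes g \<theta> :: "'a::euclidean_space \<times> 'a"
  assumes k: "1 \<le> k" and d: "2 \<le> DIM('a)"
  shows "norm (LINT Y|lborel. pchirp k g R \<theta> Y) \<le>
       pi ^ DIM('a) * exp (- (norm (fst \<theta>))\<^sup>2 / (4 * k)) * (1 / sqrt (1 + R\<^sup>2)) *
       exp (- k * (norm ((2 * R) *\<^sub>R snd g + snd \<theta>))\<^sup>2 / (4 * (k\<^sup>2 + R\<^sup>2)))"
    (is "?I \<le> pi ^ _ * ?e1 * ?s * ?e2")
proof (rule power2_le_imp_le)
  let ?d = "DIM('a)"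
  have "(pi / k) ^ ?d \<le> pi ^ ?d"
    using k by (intro power_mono) (auto simp: divide_le_eq mult_le_cancel_left1)
  moreover have "(pi / sqrt (k\<^sup>2 + R\<^sup>2)) ^ ?d \<le> pi ^ ?d * (1 / (1 + R\<^sup>2))"
  proof -
    have "sqrt (1 + R\<^sup>2) \<le> sqrt (k\<^sup>2 + R\<^sup>2)" using k by simp
    moreover have "0 < sqrt (1 + R\<^sup>2)" by (simp add: add_pos_nonneg)
    ultimately have "1 / sqrt (k\<^sup>2 + R\<^sup>2) \<le> 1 / sqrt (1 + R\<^sup>2)"
      by (intro divide_left_mono mult_pos_pos) (auto intro: less_le_trans)
    hence "(1 / sqrt (k\<^sup>2 + R\<^sup>2)) ^ ?d \<le> (1 / sqrt (1 + R\<^sup>2)) ^ ?d"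
      using k by (intro power_mono) auto
    also have "\<dots> \<le> (1 / sqrt (1 + R\<^sup>2))\<^sup>2"
      using d inverse_sqrt_one_plus_square_le_1[of R] by (intro power_decreasing) auto
    also have "\<dots> = 1 / (1 + R\<^sup>2)" by (simp add: power_divide add_nonneg_nonneg)
    finally have "pi ^ ?d * (1 / sqrt (k\<^sup>2 + R\<^sup>2)) ^ ?d \<le> pi ^ ?d * (1 / (1 + R\<^sup>2))"
      by (intro mult_left_mono) auto
    thus ?thesis by (simp add: power_divide)
  qed
  ultimately have "?I\<^sup>2 \<le> pi ^ ?d * exp (- (norm (fst \<theta>))\<^sup>2 / (2 * k)) *
       ((pi ^ ?d * (1 / (1 + R\<^sup>2))) * exp (- k * (norm ((2 * R) *\<^sub>R snd g + snd \<theta>))\<^sup>2 / (2 * (k\<^sup>2 + R\<^sup>2))))"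
    using k by (subst norm_integral_pchirp, simp, intro mult_mono order.refl mult_nonneg_nonneg) simp_all
  also have "\<dots> = (pi ^ ?d * ?e1 * ?s * ?e2)\<^sup>2"
  proof -
    have sq: "(exp (a / (4 * b)))\<^sup>2 = exp (a / (2 * b))" for a b :: real
      by (simp add: power2_eq_square exp_add[symmetric] field_simps)
    show ?thesis unfolding power_mult_distrib sq
      by (simp add: power_divide add_nonneg_nonneg power2_eq_square)
  qed
  finally show "?I\<^sup>2 \<le> (pi ^ ?d * ?e1 * ?s * ?e2)\<^sup>2" .
qed simp

lemma shell_ft_le_const:
  fixes g \<theta> :: "'a::euclidean_space \<times> 'a"
  assumes k: "0 < k" and l: "0 < l" and h: "\<And>r. norm (LINT Y|lborel. pchirp k g (r * t\<^sup>2) \<theta> Y) \<le> B"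
  shows "norm (shell_ft k t c l g \<theta>) \<le> B"
proof -
  have l2: "0 < l\<^sup>2/2" using l by simp
  have "norm (shell_ft k t c l g \<theta>) \<le> l / sqrt (2*pi) * (LINT r|lborel. exp (- (l\<^sup>2/2) * r\<^sup>2) * B)"
    using integrable_gaussian[OF l2] by (intro shell_ft_le[OF k l h]) simp
  also have "\<dots> = l / sqrt (2*pi) * (sqrt (pi / (l\<^sup>2/2)) * B)"
    using integral_gaussian[OF l2] by simp
  also have "\<dots> = B" using l by (simp add: real_sqrt_divide real_sqrt_mult)
  finally show ?thesis .
qed

text \<open>The shell leaves the first component unconstrained, so its transform decays there like
  that of a plain Gaussian, whatever the second component does.\<close>

lemma shell_ft_le_fst:
  fixes g \<theta> :: "'a::euclidean_space \<times> 'a"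
  assumes k: "1 \<le> k" and l: "0 < l" and d: "2 \<le> DIM('a)"
  shows "norm (shell_ft k t c l g \<theta>) \<le> pi ^ DIM('a) * exp (- (norm (fst \<theta>))\<^sup>2 / (4 * k))"
proof (rule shell_ft_le_const)
  show "norm (LINT Y|lborel. pchirp k g (r * t\<^sup>2) \<theta> Y) \<le> pi ^ DIM('a) * exp (- (norm (fst \<theta>))\<^sup>2 / (4 * k))" for r
  proof (rule order.trans[OF norm_integral_pchirp_le[OF k d]])
    let ?R = "r * t\<^sup>2"
    let ?e2 = "exp (- k * (norm ((2 * ?R) *\<^sub>R snd g + snd \<theta>))\<^sup>2 / (4 * (k\<^sup>2 + ?R\<^sup>2)))"
    have "1 / sqrt (1 + ?R\<^sup>2) * ?e2 \<le> 1 * 1"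
      using k inverse_sqrt_one_plus_square_le_1[of ?R] by (intro mult_mono) auto
    thus "pi ^ DIM('a) * exp (- (norm (fst \<theta>))\<^sup>2 / (4 * k)) * (1 / sqrt (1 + ?R\<^sup>2)) * ?e2
        \<le> pi ^ DIM('a) * exp (- (norm (fst \<theta>))\<^sup>2 / (4 * k))"
      unfolding mult.assoc by (intro mult_left_mono mult_left_le) auto
  qed
qed (use k l in auto)

text \<open>Nonstationary phase, uniformly in the auxiliary frequency: the vector in
  \<open>V\<close> is the gradient of the phase in the second component, at the centre of the
  Gaussian. If its square is at least \<open>q * (k\<^sup>2 + r\<^sup>2)\<close> for every
  \<open>r\<close>, the exponent is of order \<open>k * q\<close> no matter which \<open>r\<close>
  dominates. The factor \<open>T ^ 4\<close> comes from comparing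
  \<open>(r * t\<^sup>2)\<^sup>2\<close> with \<open>r\<^sup>2\<close>.\<close>

lemma shell_ft_le_snd:
  fixes g \<theta> :: "'a::euclidean_space \<times> 'a"
  assumes k: "1 \<le> k" and l: "0 < l" and d: "2 \<le> DIM('a)" and t: "1 \<le> T" "\<bar>t\<bar> \<le> T"
    and q: "0 < q" and V: "\<And>r. q * (k\<^sup>2 + r\<^sup>2) \<le> (norm ((2 * (r * t\<^sup>2)) *\<^sub>R snd g + snd \<theta>))\<^sup>2"
  shows "norm (shell_ft k t c l g \<theta>) \<le> pi ^ DIM('a) * exp (- k * q / (4 * T ^ 4))"
proof (rule shell_ft_le_const)
  show "norm (LINT Y|lborel. pchirp k g (r * t\<^sup>2) \<theta> Y) \<le> pi ^ DIM('a) * exp (- k * q / (4 * T ^ 4))" for r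
  proof (rule order.trans[OF norm_integral_pchirp_le[OF k d]])
    let ?R = "r * t\<^sup>2"
    let ?V = "(norm ((2 * ?R) *\<^sub>R snd g + snd \<theta>))\<^sup>2"
    have pos: "0 < k\<^sup>2 + ?R\<^sup>2" using k by (simp add: add_pos_nonneg)
    have t4: "t ^ 4 \<le> T ^ 4" using t power_mono[of "\<bar>t\<bar>" T 4] by simp
    have T1: "1 \<le> T ^ 4" using t by simp
    have "?R\<^sup>2 = r\<^sup>2 * t ^ 4" by (simp add: power_mult_distrib flip: power_mult)
    also have "\<dots> \<le> r\<^sup>2 * T ^ 4" using t4 by (intro mult_left_mono) auto
    finally have "k\<^sup>2 + ?R\<^sup>2 \<le> T ^ 4 * (k\<^sup>2 + r\<^sup>2)"
      using mult_right_mono[OF T1, of "k\<^sup>2"] by (simp add: algebra_simps)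
    hence "q * (k\<^sup>2 + ?R\<^sup>2) \<le> T ^ 4 * ?V"
      using order.trans[OF mult_left_mono[of "k\<^sup>2 + ?R\<^sup>2" "T ^ 4 * (k\<^sup>2 + r\<^sup>2)" q], of "T ^ 4 * ?V"]
        mult_left_mono[OF V[of r], of "T ^ 4"] q T1
      by (simp only: mult.left_commute[of q])
    hence "k * (q * (k\<^sup>2 + ?R\<^sup>2)) \<le> k * (T ^ 4 * ?V)" using k by (intro mult_left_mono) auto
    hence "k * q / (4 * T ^ 4) \<le> k * ?V / (4 * (k\<^sup>2 + ?R\<^sup>2))"
      using pos T1 t by (simp add: divide_simps) (simp add: algebra_simps)
    hence e2: "exp (- k * ?V / (4 * (k\<^sup>2 + ?R\<^sup>2))) \<le> exp (- k * q / (4 * T ^ 4))" by simp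
    have "exp (- (norm (fst \<theta>))\<^sup>2 / (4 * k)) * (1 / sqrt (1 + ?R\<^sup>2)) \<le> 1 * 1"
      using k inverse_sqrt_one_plus_square_le_1[of ?R] by (intro mult_mono) auto
    hence "exp (- (norm (fst \<theta>))\<^sup>2 / (4 * k)) * (1 / sqrt (1 + ?R\<^sup>2)) * exp (- k * ?V / (4 * (k\<^sup>2 + ?R\<^sup>2)))
        \<le> 1 * exp (- k * q / (4 * T ^ 4))"
      using e2 by (intro mult_mono) auto
    hence "pi ^ DIM('a) * (exp (- (norm (fst \<theta>))\<^sup>2 / (4 * k)) * (1 / sqrt (1 + ?R\<^sup>2)) * exp (- k * ?V / (4 * (k\<^sup>2 + ?R\<^sup>2))))
        \<le> pi ^ DIM('a) * (1 * exp (- k * q / (4 * T ^ 4)))"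
      by (intro mult_left_mono) auto
    thus "pi ^ DIM('a) * exp (- (norm (fst \<theta>))\<^sup>2 / (4 * k)) * (1 / sqrt (1 + ?R\<^sup>2)) * exp (- k * ?V / (4 * (k\<^sup>2 + ?R\<^sup>2)))
        \<le> pi ^ DIM('a) * exp (- k * q / (4 * T ^ 4))"
      by (simp only: mult_ac mult_1_left mult_1_right)
  qed
qed (use k l in auto)

text \<open>The Gaussian cuts off at \<open>|r| = 1/l\<close>. Inside, \<open>arsinh\<close> is the
  primitive and produces a logarithm, which is bounded by a small power; outside,
  \<open>1 / sqrt (1 + r\<^sup>2)\<close> is below \<open>l\<close> while the Gaussian has mass of
  order \<open>1/l\<close>.\<close>

lemma integral_gaussian_over_sqrt:
  assumes l: "0 < l" "l \<le> 1" and \<mu>: "0 < \<mu>"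
  shows "integrable lborel (\<lambda>r::real. exp (- (l\<^sup>2/2) * r\<^sup>2) * (1 / sqrt (1 + r\<^sup>2)))" (is ?int)
    and "(LINT r|lborel. exp (- (l\<^sup>2/2) * r\<^sup>2) * (1 / sqrt (1 + r\<^sup>2))) \<le> (2 * 3 powr \<mu> / \<mu> + sqrt (2 * pi)) * l powr (-\<mu>)"
proof -
  have l2: "0 < l\<^sup>2/2" using l by simp
  show int: ?int
  proof (rule Bochner_Integration.integrable_bound[OF integrable_gaussian[OF l2]])
    show "AE r in lborel. norm (exp (- (l\<^sup>2/2) * r\<^sup>2) * (1 / sqrt (1 + r\<^sup>2))) \<le> norm (exp (- (l\<^sup>2/2) * r\<^sup>2))"
      using inverse_sqrt_one_plus_square_le_1 by (intro AE_I2) (simp add: abs_mult mult_left_le del: times_divide_eq_right)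
  qed auto
  have hb: "has_bochner_integral lborel (\<lambda>r. 1 / sqrt (1 + r\<^sup>2) * indicator {-(1/l)..1/l} r) (arsinh (1/l) - arsinh (-(1/l)))"
  proof (rule has_bochner_integral_FTC_Icc_real)
    show "(arsinh has_real_derivative 1 / sqrt (1 + r\<^sup>2)) (at r)" for r :: real
      by (auto intro!: derivative_eq_intros simp: add.commute)
    have "sqrt (1 + r\<^sup>2) \<noteq> 0" for r :: real by (simp add: add_nonneg_eq_0_iff)
    thus "isCont (\<lambda>r. 1 / sqrt (1 + r\<^sup>2)) r" for r :: real
      by (intro continuous_intros) auto
  qed (use l in auto)
  have "(LINT r|lborel. exp (- (l\<^sup>2/2) * r\<^sup>2) * (1 / sqrt (1 + r\<^sup>2))) \<le>
      (LINT r|lborel. 1 / sqrt (1 + r\<^sup>2) * indicator {-(1/l)..1/l} r + l * exp (- (l\<^sup>2/2) * r\<^sup>2))"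
  proof (rule integral_mono[OF int])
    show "integrable lborel (\<lambda>r. 1 / sqrt (1 + r\<^sup>2) * indicator {-(1/l)..1/l} r + l * exp (- (l\<^sup>2/2) * r\<^sup>2))"
      using hb integrable_gaussian[OF l2] by (auto simp: has_bochner_integral_iff)
    show "exp (- (l\<^sup>2/2) * r\<^sup>2) * (1 / sqrt (1 + r\<^sup>2)) \<le> 1 / sqrt (1 + r\<^sup>2) * indicator {-(1/l)..1/l} r + l * exp (- (l\<^sup>2/2) * r\<^sup>2)" for r :: real
    proof (cases "r \<in> {-(1/l)..1/l}")
      case True
      have "exp (- (l\<^sup>2/2) * r\<^sup>2) * (1 / sqrt (1 + r\<^sup>2)) \<le> 1 * (1 / sqrt (1 + r\<^sup>2))"
        by (intro mult_right_mono) auto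
      thus ?thesis using True l by (simp add: add_increasing2)
    next
      case False
      hence "1 / l \<le> \<bar>r\<bar>" by auto
      also have "\<bar>r\<bar> \<le> sqrt (1 + r\<^sup>2)" by (rule real_le_rsqrt) simp
      finally have "1 / l \<le> sqrt (1 + r\<^sup>2)" .
      moreover have "0 < sqrt (1 + r\<^sup>2)" by (simp add: add_pos_nonneg)
      ultimately have "1 / sqrt (1 + r\<^sup>2) \<le> l"
        using l by (simp only: divide_le_eq mult.commute if_True)
      hence "exp (- (l\<^sup>2/2) * r\<^sup>2) * (1 / sqrt (1 + r\<^sup>2)) \<le> exp (- (l\<^sup>2/2) * r\<^sup>2) * l"
        by (intro mult_left_mono) auto
      thus ?thesis using False by (simp add: mult.commute)
    qed
  qed
  also have "\<dots> = 2 * arsinh (1/l) + sqrt (2 * pi)"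
    using hb integrable_gaussian[OF l2] integral_gaussian[OF l2] l
    by (simp add: has_bochner_integral_iff real_sqrt_divide real_sqrt_mult)
  also have "arsinh (1/l) \<le> 3 powr \<mu> / \<mu> * l powr (-\<mu>)"
  proof -
    have "sqrt ((1/l)\<^sup>2 + 1) \<le> 2 / l"
      using l power_le_one[of l 2] by (intro real_le_lsqrt) (auto simp: power_divide divide_simps)
    hence "1/l + sqrt ((1/l)\<^sup>2 + 1) \<le> 3 / l" by simp
    moreover have "0 < 1/l + sqrt ((1/l)\<^sup>2 + 1)" using l by (simp add: add_pos_nonneg)
    ultimately have "arsinh (1/l) \<le> ln (3 / l)"
      unfolding arsinh_real_def using l by (subst ln_le_cancel_iff) auto
    also have "\<dots> \<le> (3 / l) powr \<mu> / \<mu>" using l \<mu> by (intro ln_powr_bound) auto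
    finally show ?thesis using l by (simp add: powr_divide powr_minus_divide mult.commute)
  qed
  finally have 1: "(LINT r|lborel. exp (- (l\<^sup>2/2) * r\<^sup>2) * (1 / sqrt (1 + r\<^sup>2))) \<le> 2 * (3 powr \<mu> / \<mu> * l powr (-\<mu>)) + sqrt (2 * pi)"
    by simp
  have "1 \<le> l powr (-\<mu>)" using l \<mu> by (simp add: powr_minus_divide powr_le1)
  hence 2: "sqrt (2 * pi) * 1 \<le> sqrt (2 * pi) * l powr (-\<mu>)" by (intro mult_left_mono) auto
  have "(2 * 3 powr \<mu> / \<mu> + sqrt (2 * pi)) * l powr (-\<mu>) =
      2 * (3 powr \<mu> / \<mu> * l powr (-\<mu>)) + sqrt (2 * pi) * l powr (-\<mu>)"
    by (simp add: distrib_right)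
  with 1 2 show "(LINT r|lborel. exp (- (l\<^sup>2/2) * r\<^sup>2) * (1 / sqrt (1 + r\<^sup>2))) \<le> (2 * 3 powr \<mu> / \<mu> + sqrt (2 * pi)) * l powr (-\<mu>)"
    by linarith
qed

text \<open>Up to an arbitrarily small power, the transform is at most the measure of a shell of
  thickness \<open>l\<close>. The lower bound \<open>t1\<close> on \<open>t\<close> keeps the level
  sets of \<open>t\<^sup>2 |p|\<^sup>2\<close> from thickening; the exponent \<open>-\<mu>\<close>
  pays for the logarithm of \<open>integral_gaussian_over_sqrt\<close>.\<close>

lemma shell_ft_le_thickness:
  assumes d: "2 \<le> DIM('a::euclidean_space)" and t1: "0 < t1" and \<mu>: "0 < \<mu>"
  obtains C where "0 \<le> C" "\<And>k t c l (g::'a\<times>'a) \<theta>. 1 \<le> k \<Longrightarrow> t1 \<le> t \<Longrightarrow> 0 < l \<Longrightarrow> l \<le> 1 \<Longrightarrow>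
     norm (shell_ft k t c l g \<theta>) \<le> C * l powr (1 - \<mu>)"
proof
  define q where "q = min 1 (t1\<^sup>2)"
  have q: "0 < q" "q \<le> 1" "q \<le> t1\<^sup>2" using t1 by (auto simp: q_def)
  define A where "A = 2 * 3 powr \<mu> / \<mu> + sqrt (2 * pi)"
  have A: "0 \<le> A" using \<mu> by (simp add: A_def)
  define C where "C = pi ^ DIM('a) / q * A / sqrt (2 * pi)"
  show "0 \<le> C" using q A by (simp add: C_def)
  fix k t c l :: real and g \<theta> :: "'a\<times>'a"
  assume k: "1 \<le> k" and t: "t1 \<le> t" and l: "0 < l" "l \<le> 1"
  note I = integral_gaussian_over_sqrt[OF l \<mu>]
  have "norm (LINT Y|lborel. pchirp k g (r * t\<^sup>2) \<theta> Y) \<le> pi ^ DIM('a) / q * (1 / sqrt (1 + r\<^sup>2))" for r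
  proof (rule order.trans[OF norm_integral_pchirp_le[OF k d]])
    let ?R = "r * t\<^sup>2"
    let ?e1 = "exp (- (norm (fst \<theta>))\<^sup>2 / (4 * k))"
    let ?e2 = "exp (- k * (norm ((2 * ?R) *\<^sub>R snd g + snd \<theta>))\<^sup>2 / (4 * (k\<^sup>2 + ?R\<^sup>2)))"
    have "?e1 * ?e2 \<le> 1 * 1"
      using k by (intro mult_mono) (auto intro!: divide_nonneg_nonneg add_nonneg_nonneg)
    moreover have "1 / sqrt (1 + ?R\<^sup>2) \<le> 1 / q * (1 / sqrt (1 + r\<^sup>2))"
    proof -
      have "t1\<^sup>2 \<le> t\<^sup>2" using t t1 by (intro power_mono) auto
      hence "q\<^sup>2 \<le> (t\<^sup>2)\<^sup>2" using q by (intro power_mono) auto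
      moreover have "q\<^sup>2 \<le> 1" using q by (simp add: power_le_one)
      ultimately have "q\<^sup>2 + r\<^sup>2 * q\<^sup>2 \<le> 1 + r\<^sup>2 * (t\<^sup>2)\<^sup>2"
        by (intro add_mono mult_left_mono) auto
      hence "q * sqrt (1 + r\<^sup>2) \<le> sqrt (1 + ?R\<^sup>2)"
        using q by (intro real_le_rsqrt) (auto simp: power_mult_distrib algebra_simps add_nonneg_nonneg)
      moreover have "0 < q * sqrt (1 + r\<^sup>2)" using q by (simp add: add_pos_nonneg)
      ultimately have "1 / sqrt (1 + ?R\<^sup>2) \<le> 1 / (q * sqrt (1 + r\<^sup>2))"
        using order.strict_trans2 by (intro divide_left_mono mult_pos_pos[of "sqrt (1 + ?R\<^sup>2)"]) (auto simp: add_pos_nonneg)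
      thus ?thesis by simp
    qed
    ultimately have "(1 / sqrt (1 + ?R\<^sup>2)) * (?e1 * ?e2) \<le> 1 / q * (1 / sqrt (1 + r\<^sup>2)) * (1 * 1)"
      using q k by (intro mult_mono) (auto intro!: divide_nonneg_nonneg add_nonneg_nonneg)
    hence "pi ^ DIM('a) * ((1 / sqrt (1 + ?R\<^sup>2)) * (?e1 * ?e2)) \<le> pi ^ DIM('a) * (1 / q * (1 / sqrt (1 + r\<^sup>2)) * (1 * 1))"
      by (intro mult_left_mono) auto
    thus "pi ^ DIM('a) * ?e1 * (1 / sqrt (1 + ?R\<^sup>2)) * ?e2 \<le> pi ^ DIM('a) / q * (1 / sqrt (1 + r\<^sup>2))"
      by (simp add: mult_ac)
  qed
  hence "norm (shell_ft k t c l g \<theta>) \<le> l / sqrt (2*pi) * (LINT r|lborel. exp (- (l\<^sup>2/2) * r\<^sup>2) * (pi ^ DIM('a) / q * (1 / sqrt (1 + r\<^sup>2))))"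
    using k l integrable_mult_right[OF I(1), of "pi ^ DIM('a) / q"]
    by (intro shell_ft_le) (simp_all only: mult.left_commute)
  also have "\<dots> = l / sqrt (2*pi) * (pi ^ DIM('a) / q * (LINT r|lborel. exp (- (l\<^sup>2/2) * r\<^sup>2) * (1 / sqrt (1 + r\<^sup>2))))"
    unfolding mult.left_commute[of "exp _" "pi ^ DIM('a) / q"] integral_mult_right_zero by (rule refl)
  also have "\<dots> \<le> l / sqrt (2*pi) * (pi ^ DIM('a) / q * (A * l powr (-\<mu>)))"
    using I(2) l q unfolding A_def by (intro mult_left_mono) auto
  also have "\<dots> = C * l powr (1 - \<mu>)"
    using l by (simp add: C_def powr_diff powr_minus_divide mult_ac)
  finally show "norm (shell_ft k t c l g \<theta>) \<le> C * l powr (1 - \<mu>)" .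
qed

subsection \<open>The large sieve\<close>

lemma sin_over_self_ge_half:
  fixes u :: real
  assumes "\<bar>u\<bar> \<le> 1" "u \<noteq> 0"
  shows "1 / 2 \<le> sin u / u"
proof -
  have *: "v / 2 \<le> sin v" if "0 < v" "v \<le> 1" for v :: real
  proof -
    have "\<bar>sin v - (\<Sum>k<3. sin_coeff k * v ^ k)\<bar> \<le> inverse (fact 3) * \<bar>v\<bar> ^ 3"
      by (rule Maclaurin_sin_bound)
    moreover have "(\<Sum>k<3. sin_coeff k * v ^ k) = v"
      by (simp add: eval_nat_numeral sin_coeff_def)
    moreover have "v ^ 3 \<le> v" using that by (simp add: power_le_one eval_nat_numeral mult_le_one mult_left_le)
    moreover have "(fact 3 :: real) = 6" by (simp add: eval_nat_numeral)
    ultimately have "\<bar>sin v - v\<bar> \<le> v / 6" using that by simp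
    thus ?thesis using that by linarith
  qed
  show ?thesis
  proof (cases "0 < u")
    case True thus ?thesis using *[of u] assms by (simp add: field_simps)
  next
    case False thus ?thesis using *[of "-u"] assms by (simp add: field_simps)
  qed
qed

text \<open>The multiplier by which averaging over an interval of half-length \<open>h\<close> acts
  on the frequency \<open>\<theta>\<close> is \<open>sinq (\<theta> * h)\<close>; the value at
  \<open>0\<close> is the limit.\<close>

definition sinq :: "real \<Rightarrow> real" where "sinq u = (if u = 0 then 1 else sin u / u)"

lemma sinq_ge_half: "\<bar>u\<bar> \<le> 1 \<Longrightarrow> 1 / 2 \<le> sinq u"
  using sin_over_self_ge_half by (auto simp: sinq_def)

lemma has_integral_interval_cis:
  assumes "0 < h"
  shows "has_bochner_integral lborel (\<lambda>x. indicator {y-h..y+h} x * cis (\<theta> * x)) (complex_of_real (2 * h * sinq (\<theta> * h)) * cis (\<theta> * y))"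
proof (cases "\<theta> = 0")
  case True
  have "has_bochner_integral lborel (indicator {y-h..y+h} :: real \<Rightarrow> complex) (complex_of_real (measure lborel {y-h..y+h}))"
    using has_bochner_integral_indicator[of "{y-h..y+h}" lborel "1 :: complex"]
    by (simp add: scaleR_conv_of_real of_real_indicator emeasure_lborel_Icc_eq del: measure_lborel_Icc)
  thus ?thesis unfolding True using assms by (simp add: sinq_def del: atLeastatMost_empty_iff)
next
  case False
  have "has_bochner_integral lborel (\<lambda>x. indicator {y-h..y+h} x *\<^sub>R cis (\<theta> * x))
     (cis (\<theta> * (y + h)) / (\<i> * \<theta>) - cis (\<theta> * (y - h)) / (\<i> * \<theta>))"
  proof (rule has_bochner_integral_FTC_Icc)
    fix x assume "y - h \<le> x" "x \<le> y + h"
    show "((\<lambda>x. cis (\<theta> * x) / (\<i> * \<theta>)) has_vector_derivative cis (\<theta> * x)) (at x within {y - h..y + h})"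
    proof -
      have "((\<lambda>z. exp (\<i> * \<theta> * z) / (\<i> * \<theta>)) has_field_derivative exp (\<i> * \<theta> * of_real x)) (at (of_real x))"
        using False by (auto intro!: derivative_eq_intros)
      from has_vector_derivative_real_field[OF this, of "{y - h..y + h}"] show ?thesis
        by (simp add: cis_conv_exp mult.assoc)
    qed
  qed (use assms in \<open>auto intro!: continuous_intros\<close>)
  also have "cis (\<theta> * (y + h)) / (\<i> * \<theta>) - cis (\<theta> * (y - h)) / (\<i> * \<theta>) = complex_of_real (2 * h * sinq (\<theta> * h)) * cis (\<theta> * y)"
  proof -
    have "cis (\<theta> * (y + h)) - cis (\<theta> * (y - h)) = cis (\<theta> * y) * (cis (\<theta> * h) - cis (- (\<theta> * h)))"
      by (simp add: cis_mult algebra_simps)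
    also have "cis (\<theta> * h) - cis (- (\<theta> * h)) = 2 * \<i> * complex_of_real (sin (\<theta> * h))"
      by (simp add: complex_eq_iff)
    finally have "cis (\<theta> * (y + h)) / (\<i> * \<theta>) - cis (\<theta> * (y - h)) / (\<i> * \<theta>)
      = cis (\<theta> * y) * (2 * \<i> * complex_of_real (sin (\<theta> * h))) / (\<i> * \<theta>)"
      by (simp only: diff_divide_distrib[symmetric])
    thus ?thesis using False assms by (simp add: sinq_def field_simps)
  qed
  finally show ?thesis by (simp add: scaleR_conv_of_real of_real_indicator)
qed

lemma has_integral_cbox_cis:
  fixes Y \<theta> :: "'v::euclidean_space"
  assumes "0 < h"
  shows "has_bochner_integral lborel (\<lambda>Z. indicator (cbox (Y - h *\<^sub>R One) (Y + h *\<^sub>R One)) Z * cis (\<theta> \<bullet> Z))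
     (complex_of_real ((2 * h) ^ DIM('v) * (\<Prod>b\<in>Basis. sinq ((\<theta> \<bullet> b) * h))) * cis (\<theta> \<bullet> Y))"
proof -
  let ?F = "\<lambda>b x. indicator {Y \<bullet> b - h..Y \<bullet> b + h} x * cis ((\<theta> \<bullet> b) * x)"
  have c: "cis (\<theta> \<bullet> Z) = (\<Prod>b\<in>Basis. cis ((\<theta> \<bullet> b) * (Z \<bullet> b)))" for Z
    by (subst euclidean_inner) (simp add: cis_sum[OF finite_Basis])
  have eq: "indicator (cbox (Y - h *\<^sub>R One) (Y + h *\<^sub>R One)) Z * cis (\<theta> \<bullet> Z) = (\<Prod>b\<in>Basis. ?F b (Z \<bullet> b))" for Z :: 'v
  proof -
    have "(indicator (cbox (Y - h *\<^sub>R One) (Y + h *\<^sub>R One)) Z :: complex) = (\<Prod>b\<in>Basis. indicator {Y \<bullet> b - h..Y \<bullet> b + h} (Z \<bullet> b))"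
    proof (cases "Z \<in> cbox (Y - h *\<^sub>R One) (Y + h *\<^sub>R One)")
      case True
      thus ?thesis by (auto simp: mem_box inner_diff_left inner_add_left intro!: prod.neutral[symmetric])
    next
      case False
      then obtain b where "b \<in> Basis" "\<not> (Y \<bullet> b - h \<le> Z \<bullet> b \<and> Z \<bullet> b \<le> Y \<bullet> b + h)"
        by (auto simp: mem_box inner_diff_left inner_add_left)
      thus ?thesis using False by (auto intro!: prod_zero[symmetric] bexI[of _ b])
    qed
    thus ?thesis unfolding c by (simp add: prod.distrib)
  qed
  have "has_bochner_integral lborel (\<lambda>Z::'v. \<Prod>b\<in>Basis. ?F b (Z \<bullet> b)) (\<Prod>b\<in>Basis. LINT x|lborel. ?F b x)"
    using has_integral_interval_cis[OF assms] by (intro has_integral_prod_Basis) (simp only: has_bochner_integral_iff)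
  moreover have "(\<Prod>b\<in>Basis. LINT x|lborel. ?F b x) =
      complex_of_real ((2 * h) ^ DIM('v) * (\<Prod>b\<in>Basis. sinq ((\<theta> \<bullet> b) * h))) * cis (\<theta> \<bullet> Y)"
    using has_integral_interval_cis[OF assms]
    by (simp add: has_bochner_integral_iff prod.distrib c)
  ultimately show ?thesis unfolding eq by simp
qed

text \<open>Local constancy: an exponential sum is the average over a small box of the sum with the
  coefficients divided by values of \<open>sinq\<close>, so that its square is at most the mean square there.\<close>
lemma exponential_sum_le_box:
  fixes \<xi> :: "'i \<Rightarrow> 'v::euclidean_space" and a :: "'i \<Rightarrow> complex"
  assumes h: "0 < h" and I: "finite I" and small: "\<And>i b. i \<in> I \<Longrightarrow> b \<in> Basis \<Longrightarrow> \<bar>\<xi> i \<bullet> b\<bar> * h \<le> 1"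
  obtains a' where "\<And>i. i \<in> I \<Longrightarrow> norm (a' i) \<le> 2 ^ DIM('v) * norm (a i)"
    "\<And>Y. (2 * h) ^ DIM('v) * (norm (\<Sum>i\<in>I. a i * cis (\<xi> i \<bullet> Y)))\<^sup>2 \<le>
       (LINT Z|lborel. indicator (cbox (Y - h *\<^sub>R One) (Y + h *\<^sub>R One)) Z * (norm (\<Sum>i\<in>I. a' i * cis (\<xi> i \<bullet> Z)))\<^sup>2)"
proof -
  define s where "s i = (\<Prod>b\<in>Basis. sinq ((\<xi> i \<bullet> b) * h))" for i
  define a' where "a' i = a i / complex_of_real (s i)" for i
  have s: "(1/2) ^ DIM('v) \<le> s i" if "i \<in> I" for i
  proof -
    have "(\<Prod>b\<in>(Basis::'v set). 1/2) \<le> s i"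
      unfolding s_def using small[OF that] h by (intro prod_mono conjI sinq_ge_half) (auto simp: abs_mult)
    thus ?thesis by simp
  qed
  have s0: "0 < s i" if "i \<in> I" for i
    using s[OF that] by (rule less_le_trans[rotated]) simp
  show ?thesis
  proof
    fix i assume i: "i \<in> I"
    have "norm (a' i) = norm (a i) / s i" using s0[OF i] by (simp add: a'_def norm_divide)
    also have "\<dots> \<le> norm (a i) / (1/2) ^ DIM('v)"
      using s[OF i] s0[OF i] by (intro divide_left_mono) auto
    finally show "norm (a' i) \<le> 2 ^ DIM('v) * norm (a i)" by (simp add: power_divide mult.commute)
  next
    fix Y :: 'v
    define V where "V = (2 * h) ^ DIM('v)"
    have V: "0 < V" using h by (simp add: V_def)
    let ?B = "cbox (Y - h *\<^sub>R One) (Y + h *\<^sub>R One)"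
    define f where "f Z = (\<Sum>i\<in>I. a' i * cis (\<xi> i \<bullet> Z))" for Z
    define A where "A = (\<Sum>i\<in>I. a i * cis (\<xi> i \<bullet> Y))"
    have hb: "has_bochner_integral lborel (\<lambda>Z. indicator ?B Z * f Z) (complex_of_real V * A)"
    proof -
      have "has_bochner_integral lborel (\<lambda>Z. \<Sum>i\<in>I. a' i * (indicator ?B Z * cis (\<xi> i \<bullet> Z)))
         (\<Sum>i\<in>I. a' i * (complex_of_real (V * s i) * cis (\<xi> i \<bullet> Y)))"
        unfolding s_def V_def by (intro has_bochner_integral_sum has_bochner_integral_mult_right has_integral_cbox_cis h)
      moreover have "(\<Sum>i\<in>I. a' i * (complex_of_real (V * s i) * cis (\<xi> i \<bullet> Y))) = complex_of_real V * A"
        unfolding A_def sum_distrib_left using s0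
        by (intro sum.cong refl) (auto simp: a'_def less_imp_neq[THEN not_sym])
      moreover have "(\<Sum>i\<in>I. a' i * (indicator ?B Z * cis (\<xi> i \<bullet> Z))) = indicator ?B Z * f Z" for Z
        unfolding f_def sum_distrib_left by (intro sum.cong refl) (simp add: mult_ac)
      ultimately show ?thesis by simp
    qed
    have cont: "continuous_on S f" for S unfolding f_def by (intro continuous_intros)
    have int2: "integrable lborel (\<lambda>Z. indicator ?B Z * (norm (f Z))\<^sup>2)"
      using borel_integrable_compact[of ?B "\<lambda>Z. (norm (f Z))\<^sup>2"] cont
      by (simp add: continuous_intros)
    have intB: "integrable lborel (\<lambda>Z. indicator ?B Z :: real)" "(LINT Z|lborel. indicator ?B Z) = V"
    proof -
      have "has_bochner_integral lborel (indicator ?B :: 'v \<Rightarrow> real) (measure lborel ?B)"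
        by (intro has_bochner_integral_real_indicator) (auto simp: emeasure_lborel_cbox_eq)
      moreover have "measure lborel ?B = V"
        using h by (subst measure_lborel_cbox_eq) (simp add: V_def inner_diff_left inner_add_left)
      ultimately show "integrable lborel (\<lambda>Z. indicator ?B Z :: real)" "(LINT Z|lborel. indicator ?B Z) = V"
        by (auto simp: has_bochner_integral_iff)
    qed
    have intc: "integrable lborel (\<lambda>Z. Re (cnj A * (indicator ?B Z * f Z)))"
      "(LINT Z|lborel. Re (cnj A * (indicator ?B Z * f Z))) = V * (norm A)\<^sup>2"
    proof -
      have "has_bochner_integral lborel (\<lambda>Z. cnj A * (indicator ?B Z * f Z)) (cnj A * (complex_of_real V * A))"
        by (intro has_bochner_integral_mult_right hb)
      hence "has_bochner_integral lborel (\<lambda>Z. Re (cnj A * (indicator ?B Z * f Z))) (Re (cnj A * (complex_of_real V * A)))"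
        by (rule has_bochner_integral_Re)
      moreover have "Re (cnj A * (complex_of_real V * A)) = V * (norm A)\<^sup>2"
      proof -
        have "cnj A * (complex_of_real V * A) = complex_of_real (V * (norm A)\<^sup>2)"
          unfolding of_real_mult complex_norm_square by (simp add: mult_ac)
        thus ?thesis by (simp only: Re_complex_of_real)
      qed
      ultimately show "integrable lborel (\<lambda>Z. Re (cnj A * (indicator ?B Z * f Z)))"
        "(LINT Z|lborel. Re (cnj A * (indicator ?B Z * f Z))) = V * (norm A)\<^sup>2"
        by (auto simp: has_bochner_integral_iff)
    qed
    \<comment> \<open>The mean square deviation of \<open>f\<close> from its box mean
      \<open>A\<close> is nonnegative: Jensen's inequality for the average.\<close>
    have expand: "indicator ?B Z * (norm (f Z))\<^sup>2 - 2 * Re (cnj A * (indicator ?B Z * f Z)) + (norm A)\<^sup>2 * indicator ?B Z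
       = indicator ?B Z * (norm (f Z - A))\<^sup>2" for Z
    proof -
      have "(norm (f Z - A))\<^sup>2 = (norm (f Z))\<^sup>2 - 2 * Re (cnj A * f Z) + (norm A)\<^sup>2"
        unfolding cmod_power2 by (simp add: power2_eq_square algebra_simps)
      thus ?thesis by (cases "Z \<in> ?B") auto
    qed
    have "has_bochner_integral lborel (\<lambda>Z. indicator ?B Z * (norm (f Z))\<^sup>2 - 2 * Re (cnj A * (indicator ?B Z * f Z)) + (norm A)\<^sup>2 * indicator ?B Z)
      ((LINT Z|lborel. indicator ?B Z * (norm (f Z))\<^sup>2) - 2 * (V * (norm A)\<^sup>2) + (norm A)\<^sup>2 * V)"
      by (intro has_bochner_integral_add has_bochner_integral_diff has_bochner_integral_mult_right)
         (simp_all only: has_bochner_integral_iff int2 intc intB simp_thms)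
    note exp_int = this[unfolded expand]
    have "0 \<le> (LINT Z|lborel. indicator ?B Z * (norm (f Z - A))\<^sup>2)"
      by (intro integral_nonneg_AE AE_I2) simp
    also have "\<dots> = (LINT Z|lborel. indicator ?B Z * (norm (f Z))\<^sup>2) - 2 * (V * (norm A)\<^sup>2) + (norm A)\<^sup>2 * V"
      by (rule has_bochner_integral_integral_eq[OF exp_int])
    finally have "V * (norm A)\<^sup>2 \<le> (LINT Z|lborel. indicator ?B Z * (norm (f Z))\<^sup>2)"
      by (simp only: mult.commute[of "(norm A)\<^sup>2" V])
    thus "(2 * h) ^ DIM('v) * (norm (\<Sum>i\<in>I. a i * cis (\<xi> i \<bullet> Y)))\<^sup>2 \<le>
       (LINT Z|lborel. indicator ?B Z * (norm (\<Sum>i\<in>I. a' i * cis (\<xi> i \<bullet> Z)))\<^sup>2)"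
      by (simp only: V_def A_def f_def)
  qed
qed

text \<open>By local constancy each sample is replaced by an integral over a box, so the sample
  weights are smeared into a function below \<open>D * \<omega>\<close>. Expanding the square then
  brings in only the Fourier transform of \<open>\<omega>\<close> at differences of frequencies. The
  constant \<open>(2 / h) ^ DIM('v)\<close> is \<open>4 ^ DIM('v)\<close>, from dividing both
  coefficients by values of \<open>sinq\<close>, over the box volume
  \<open>(2 * h) ^ DIM('v)\<close>.\<close>

lemma large_sieve_majorant:
  fixes \<xi> :: "'i \<Rightarrow> 'v::euclidean_space" and a :: "'i \<Rightarrow> complex" and Y :: "'j \<Rightarrow> 'v"
  assumes h: "0 < h" and I: "finite I" and J: "finite J"
    and small: "\<And>i b. i \<in> I \<Longrightarrow> b \<in> Basis \<Longrightarrow> \<bar>\<xi> i \<bullet> b\<bar> * h \<le> 1"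
    and b: "\<And>j. j \<in> J \<Longrightarrow> 0 \<le> b j"
    and \<omega>: "integrable lborel \<omega>" and D: "0 \<le> D"
    and maj: "\<And>Z. (\<Sum>j | j \<in> J \<and> Y j \<in> cbox (Z - h *\<^sub>R One) (Z + h *\<^sub>R One). b j) \<le> D * \<omega> Z"
  shows "(\<Sum>j\<in>J. b j * (norm (\<Sum>i\<in>I. a i * cis (\<xi> i \<bullet> Y j)))\<^sup>2) \<le>
    D * (2 / h) ^ DIM('v) * (\<Sum>i\<in>I. \<Sum>i'\<in>I. norm (a i) * norm (a i') *
        norm (LINT Z|lborel. complex_of_real (\<omega> Z) * cis ((\<xi> i - \<xi> i') \<bullet> Z)))"
proof -
  define W where "W \<theta> = (LINT Z|lborel. complex_of_real (\<omega> Z) * cis (\<theta> \<bullet> Z))" for \<theta>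
  obtain a' where a': "\<And>i. i \<in> I \<Longrightarrow> norm (a' i) \<le> 2 ^ DIM('v) * norm (a i)"
    "\<And>Y. (2 * h) ^ DIM('v) * (norm (\<Sum>i\<in>I. a i * cis (\<xi> i \<bullet> Y)))\<^sup>2 \<le>
       (LINT Z|lborel. indicator (cbox (Y - h *\<^sub>R One) (Y + h *\<^sub>R One)) Z * (norm (\<Sum>i\<in>I. a' i * cis (\<xi> i \<bullet> Z)))\<^sup>2)"
    by (rule exponential_sum_le_box[OF h I small, where a=a]) blast+
  define f where "f Z = (\<Sum>i\<in>I. a' i * cis (\<xi> i \<bullet> Z))" for Z
  let ?B = "\<lambda>Y. cbox (Y - h *\<^sub>R One) (Y + h *\<^sub>R One)"
  have cont: "continuous_on S f" for S unfolding f_def by (intro continuous_intros)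
  have int2: "integrable lborel (\<lambda>Z. indicator (?B Y) Z * (norm (f Z))\<^sup>2)" for Y
    using borel_integrable_compact[of "?B Y" "\<lambda>Z. (norm (f Z))\<^sup>2"] cont
    by (simp add: continuous_intros)
  have fmeas [measurable]: "f \<in> borel_measurable borel" using cont by (rule borel_measurable_continuous_onI)
  have fle: "norm (f Z) \<le> (\<Sum>i\<in>I. norm (a' i))" for Z
    unfolding f_def by (rule order.trans[OF norm_sum]) (simp add: norm_mult)
  have int3: "integrable lborel (\<lambda>Z. D * \<omega> Z * (norm (f Z))\<^sup>2)"
  proof (rule Bochner_Integration.integrable_bound)
    show "integrable lborel (\<lambda>Z. D * (\<Sum>i\<in>I. norm (a' i))\<^sup>2 * \<omega> Z)" using \<omega> by simp
    have "(norm (f Z))\<^sup>2 \<le> (\<Sum>i\<in>I. norm (a' i))\<^sup>2" for Z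
      using fle by (intro power_mono) auto
    from mult_left_mono[OF this, of "D * \<bar>\<omega> Z\<bar>" for Z]
    show "AE Z in lborel. norm (D * \<omega> Z * (norm (f Z))\<^sup>2) \<le> norm (D * (\<Sum>i\<in>I. norm (a' i))\<^sup>2 * \<omega> Z)"
      using D by (intro AE_I2) (simp add: abs_mult mult_ac)
  qed (use \<omega> in \<open>simp add: borel_measurable_integrable\<close>)
  have "(2 * h) ^ DIM('v) * (\<Sum>j\<in>J. b j * (norm (\<Sum>i\<in>I. a i * cis (\<xi> i \<bullet> Y j)))\<^sup>2)
     = (\<Sum>j\<in>J. b j * ((2 * h) ^ DIM('v) * (norm (\<Sum>i\<in>I. a i * cis (\<xi> i \<bullet> Y j)))\<^sup>2))"
    by (simp add: sum_distrib_left mult_ac)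
  also have "\<dots> \<le> (\<Sum>j\<in>J. b j * (LINT Z|lborel. indicator (?B (Y j)) Z * (norm (f Z))\<^sup>2))"
    using a'(2) b unfolding f_def by (intro sum_mono mult_left_mono) auto
  also have "\<dots> = (LINT Z|lborel. (\<Sum>j\<in>J. b j * (indicator (?B (Y j)) Z * (norm (f Z))\<^sup>2)))"
    using int2 by (subst Bochner_Integration.integral_sum) auto
  also have "\<dots> \<le> (LINT Z|lborel. D * \<omega> Z * (norm (f Z))\<^sup>2)"
  proof (rule integral_mono[OF _ int3])
    show "integrable lborel (\<lambda>Z. \<Sum>j\<in>J. b j * (indicator (?B (Y j)) Z * (norm (f Z))\<^sup>2))"
      using int2 by (intro Bochner_Integration.integrable_sum) auto
    fix Z :: 'v
    have "Z \<in> ?B X \<longleftrightarrow> X \<in> ?B Z" for X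
      by (auto simp: mem_box inner_diff_left inner_add_left algebra_simps)
    hence "(\<Sum>j\<in>J. b j * indicator (?B (Y j)) Z) = (\<Sum>j | j \<in> J \<and> Y j \<in> ?B Z. b j)"
      using J by (simp add: indicator_def of_bool_def if_distrib sum.inter_filter cong: if_cong)
    also have "\<dots> \<le> D * \<omega> Z" by (rule maj)
    finally have "(\<Sum>j\<in>J. b j * indicator (?B (Y j)) Z) * (norm (f Z))\<^sup>2 \<le> D * \<omega> Z * (norm (f Z))\<^sup>2"
      by (intro mult_right_mono) auto
    thus "(\<Sum>j\<in>J. b j * (indicator (?B (Y j)) Z * (norm (f Z))\<^sup>2)) \<le> D * \<omega> Z * (norm (f Z))\<^sup>2"
      by (simp add: sum_distrib_right mult.assoc)
  qed
  also have "\<dots> \<le> D * (\<Sum>i\<in>I. \<Sum>i'\<in>I. norm (a' i) * norm (a' i') * norm (W (\<xi> i - \<xi> i')))"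
  proof -
    have intW: "integrable lborel (\<lambda>Z. complex_of_real (\<omega> Z) * cis (\<theta> \<bullet> Z))" for \<theta>
    proof (rule Bochner_Integration.integrable_bound[OF \<omega>])
      show "(\<lambda>Z. complex_of_real (\<omega> Z) * cis (\<theta> \<bullet> Z)) \<in> borel_measurable lborel"
        using borel_measurable_integrable[OF \<omega>] by measurable
    qed (simp add: norm_mult)
    have eq: "complex_of_real (\<omega> Z * (norm (f Z))\<^sup>2) =
       (\<Sum>i\<in>I. \<Sum>i'\<in>I. a' i * cnj (a' i') * (complex_of_real (\<omega> Z) * cis ((\<xi> i - \<xi> i') \<bullet> Z)))" for Z
    proof -
      have "complex_of_real ((norm (f Z))\<^sup>2) = (\<Sum>i\<in>I. \<Sum>i'\<in>I. (a' i * cis (\<xi> i \<bullet> Z)) * cnj (a' i' * cis (\<xi> i' \<bullet> Z)))"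
        unfolding complex_norm_square f_def cnj_sum sum_product by (rule refl)
      also have "\<dots> = (\<Sum>i\<in>I. \<Sum>i'\<in>I. a' i * cnj (a' i') * cis ((\<xi> i - \<xi> i') \<bullet> Z))"
      proof (intro sum.cong refl)
        fix i i'
        have "cis (\<xi> i \<bullet> Z) * cis (- (\<xi> i' \<bullet> Z)) = cis ((\<xi> i - \<xi> i') \<bullet> Z)"
          by (simp add: cis_mult inner_diff_left)
        thus "a' i * cis (\<xi> i \<bullet> Z) * cnj (a' i' * cis (\<xi> i' \<bullet> Z)) = a' i * cnj (a' i') * cis ((\<xi> i - \<xi> i') \<bullet> Z)"
          by (simp add: cis_cnj)
      qed
      finally show ?thesis by (simp add: sum_distrib_left mult_ac)
    qed
    have "complex_of_real (LINT Z|lborel. \<omega> Z * (norm (f Z))\<^sup>2) =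
       (\<Sum>i\<in>I. \<Sum>i'\<in>I. a' i * cnj (a' i') * W (\<xi> i - \<xi> i'))"
    proof -
      have "has_bochner_integral lborel (\<lambda>Z. \<Sum>i\<in>I. \<Sum>i'\<in>I. a' i * cnj (a' i') * (complex_of_real (\<omega> Z) * cis ((\<xi> i - \<xi> i') \<bullet> Z)))
          (\<Sum>i\<in>I. \<Sum>i'\<in>I. a' i * cnj (a' i') * W (\<xi> i - \<xi> i'))"
        using intW by (intro has_bochner_integral_sum has_bochner_integral_mult_right) (simp only: has_bochner_integral_iff W_def)
      thus ?thesis unfolding integral_complex_of_real[symmetric] eq by (simp only: has_bochner_integral_iff)
    qed
    hence "norm (complex_of_real (LINT Z|lborel. \<omega> Z * (norm (f Z))\<^sup>2)) \<le>
       (\<Sum>i\<in>I. \<Sum>i'\<in>I. norm (a' i) * norm (a' i') * norm (W (\<xi> i - \<xi> i')))"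
      by (simp only:) (intro sum_norm_le order.refl, simp add: norm_mult)
    hence "(LINT Z|lborel. \<omega> Z * (norm (f Z))\<^sup>2) \<le>
       (\<Sum>i\<in>I. \<Sum>i'\<in>I. norm (a' i) * norm (a' i') * norm (W (\<xi> i - \<xi> i')))"
      by simp
    from mult_left_mono[OF this D] show ?thesis by (simp add: mult.assoc)
  qed
  also have "\<dots> \<le> D * (\<Sum>i\<in>I. \<Sum>i'\<in>I. (2 ^ DIM('v) * norm (a i)) * (2 ^ DIM('v) * norm (a i')) * norm (W (\<xi> i - \<xi> i')))"
    using D a'(1) by (intro mult_left_mono sum_mono mult_right_mono mult_mono) auto
  also have "\<dots> = D * (2 * 2) ^ DIM('v) * (\<Sum>i\<in>I. \<Sum>i'\<in>I. norm (a i) * norm (a i') * norm (W (\<xi> i - \<xi> i')))"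
    unfolding power_mult_distrib by (simp add: sum_distrib_left mult_ac)
  finally have "(\<Sum>j\<in>J. b j * (norm (\<Sum>i\<in>I. a i * cis (\<xi> i \<bullet> Y j)))\<^sup>2) \<le>
     (D * (2 * 2) ^ DIM('v) * (\<Sum>i\<in>I. \<Sum>i'\<in>I. norm (a i) * norm (a i') * norm (W (\<xi> i - \<xi> i')))) / (2 * h) ^ DIM('v)"
    using h by (simp add: field_simps)
  also have "\<dots> = D * ((2 * 2) / (2 * h)) ^ DIM('v) * (\<Sum>i\<in>I. \<Sum>i'\<in>I. norm (a i) * norm (a i') * norm (W (\<xi> i - \<xi> i')))"
    unfolding power_divide by simp
  finally show ?thesis unfolding W_def by simp
qed

subsection \<open>Nets and decay estimates\<close>

text \<open>The restriction to \<open>Basis\<close> makes indices extensional: equality of cells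
  compares exactly the coordinates, and the indices of a bounded set lie in a finite
  product.\<close>

definition cell :: "real \<Rightarrow> 'v::euclidean_space \<Rightarrow> 'v \<Rightarrow> int" where
  "cell \<rho> x = (\<lambda>b\<in>Basis. \<lfloor>(x \<bullet> b) / \<rho>\<rfloor>)"

lemma norm_le_of_cell_eq:
  fixes x y :: "'v::euclidean_space" and \<rho> :: real
  assumes "0 < \<rho>" "cell \<rho> x = cell \<rho> y"
  shows "norm (x - y) \<le> DIM('v) * \<rho>"
proof -
  have "\<bar>(x - y) \<bullet> b\<bar> \<le> \<rho>" if b: "b \<in> Basis" for b
  proof -
    have "\<lfloor>(x \<bullet> b) / \<rho>\<rfloor> = \<lfloor>(y \<bullet> b) / \<rho>\<rfloor>"
      using fun_cong[OF assms(2), of b] b by (simp add: cell_def)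
    hence "\<bar>(x \<bullet> b) / \<rho> - (y \<bullet> b) / \<rho>\<bar> \<le> 1" by linarith
    thus ?thesis using assms(1) by (simp add: inner_diff_left divide_le_eq flip: diff_divide_distrib)
  qed
  hence "(\<Sum>b\<in>Basis. \<bar>(x - y) \<bullet> b\<bar>) \<le> (\<Sum>b\<in>(Basis::'v set). \<rho>)" by (intro sum_mono)
  thus ?thesis using norm_le_l1[of "x - y"] by simp
qed

lemma card_cell_image_le:
  fixes S :: "'v::euclidean_space set" and R \<rho> :: real
  assumes "0 < \<rho>" "\<And>x. x \<in> S \<Longrightarrow> norm (x - x0) \<le> R" "0 \<le> R"
  shows "finite (cell \<rho> ` S)" "real (card (cell \<rho> ` S)) \<le> (2 * R / \<rho> + 3) ^ DIM('v)"
proof -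
  define K where "K b = {\<lfloor>(x0 \<bullet> b - R) / \<rho>\<rfloor>..\<lfloor>(x0 \<bullet> b + R) / \<rho>\<rfloor>}" for b :: 'v
  have sub: "cell \<rho> ` S \<subseteq> PiE Basis K"
  proof (intro image_subsetI PiE_I)
    fix x b :: 'v assume x: "x \<in> S" and b: "b \<in> Basis"
    have "\<bar>(x - x0) \<bullet> b\<bar> \<le> R" using Basis_le_norm[OF b, of "x - x0"] assms(2)[OF x] by linarith
    thus "cell \<rho> x b \<in> K b" using b assms(1)
      by (auto simp: cell_def K_def inner_diff_left intro!: floor_mono divide_right_mono)
  qed (simp add: cell_def)
  have fin: "finite (PiE (Basis::'v set) K)" by (intro finite_PiE) (auto simp: K_def)
  show "finite (cell \<rho> ` S)" by (rule finite_subset[OF sub fin])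
  have "card (K b) \<le> 2 * R / \<rho> + 3" for b
  proof -
    have "real (card (K b)) = of_int \<lfloor>(x0 \<bullet> b + R) / \<rho>\<rfloor> - of_int \<lfloor>(x0 \<bullet> b - R) / \<rho>\<rfloor> + 1"
    proof -
      have "\<lfloor>(x0 \<bullet> b - R) / \<rho>\<rfloor> \<le> \<lfloor>(x0 \<bullet> b + R) / \<rho>\<rfloor>"
        using assms by (intro floor_mono divide_right_mono) auto
      thus ?thesis by (simp add: K_def)
    qed
    also have "\<dots> \<le> (x0 \<bullet> b + R) / \<rho> - (x0 \<bullet> b - R) / \<rho> + 2" by linarith
    also have "\<dots> = 2 * R / \<rho> + 2" by (simp add: add_divide_distrib diff_divide_distrib)
    finally show ?thesis by linarith
  qed
  hence "(\<Prod>b\<in>(Basis::'v set). real (card (K b))) \<le> (\<Prod>b\<in>(Basis::'v set). 2 * R / \<rho> + 3)"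
    by (intro prod_mono) auto
  hence "real (card (PiE (Basis::'v set) K)) \<le> (2 * R / \<rho> + 3) ^ DIM('v)"
    by (simp add: card_PiE)
  thus "real (card (cell \<rho> ` S)) \<le> (2 * R / \<rho> + 3) ^ DIM('v)"
    using card_mono[OF fin sub] by linarith
qed

text \<open>One representative for each occupied cell of side \<open>\<rho> / DIM('v)\<close>. The
  net is taken inside \<open>S\<close> because its members will serve as centres
  \<open>(y, z - y)\<close> with \<open>y\<close> and \<open>z\<close> from the point sets, where
  transversality is available.\<close>

lemma finite_net:
  fixes S :: "'v::euclidean_space set" and R \<rho> :: real
  assumes S: "\<And>x. x \<in> S \<Longrightarrow> norm x \<le> R" and R: "1 \<le> R" and \<rho>: "0 < \<rho>" "\<rho> \<le> 1"
  obtains G where "G \<subseteq> S" "finite G" "\<And>x. x \<in> S \<Longrightarrow> \<exists>g\<in>G. norm (x - g) \<le> \<rho>"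
    "real (card G) \<le> (5 * DIM('v) * R / \<rho>) ^ DIM('v)"
proof -
  define \<rho>' where "\<rho>' = \<rho> / DIM('v)"
  have \<rho>': "0 < \<rho>'" using \<rho> by (simp add: \<rho>'_def)
  obtain G where G: "G \<subseteq> S" "cell \<rho>' ` S = cell \<rho>' ` G" "inj_on (cell \<rho>') G"
    using subset_image_inj[of "cell \<rho>' ` S" "cell \<rho>'" S] by auto
  note c = card_cell_image_le[OF \<rho>', of S 0 R]
  show ?thesis
  proof (rule that[OF G(1)])
    show "finite G" using c(1) S R G finite_imageD[of "cell \<rho>'" G] by auto
    fix x assume "x \<in> S"
    then obtain g where "g \<in> G" "cell \<rho>' x = cell \<rho>' g" using G(2) by blast
    thus "\<exists>g\<in>G. norm (x - g) \<le> \<rho>" using norm_le_of_cell_eq[OF \<rho>', of x g] by (auto simp: \<rho>'_def)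
  next
    have "real (card G) = real (card (cell \<rho>' ` S))" using G by (simp add: card_image)
    also have "\<dots> \<le> (2 * R / \<rho>' + 3) ^ DIM('v)" using c(2) S R by auto
    also have "\<dots> \<le> (5 * DIM('v) * R / \<rho>) ^ DIM('v)"
    proof (rule power_mono)
      have "1 * 1 \<le> real DIM('v) * R" using R by (intro mult_mono) (auto simp: Suc_leI)
      hence "\<rho> \<le> real DIM('v) * R" using \<rho> by linarith
      hence "3 \<le> 3 * (real DIM('v) * R / \<rho>)" using \<rho> by (simp add: field_simps)
      moreover have "2 * R / \<rho>' = 2 * (real DIM('v) * R / \<rho>)" "5 * DIM('v) * R / \<rho> = 5 * (real DIM('v) * R / \<rho>)"
        by (simp_all add: \<rho>'_def)
      ultimately show "2 * R / \<rho>' + 3 \<le> 5 * DIM('v) * R / \<rho>" by linarith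
    qed (use R \<rho>' in auto)
    finally show "real (card G) \<le> (5 * DIM('v) * R / \<rho>) ^ DIM('v)" .
  qed
qed

lemma exp_neg_le_powr:
  fixes c \<mu> K :: real
  assumes "0 < c" "0 < \<mu>" "0 < K"
  obtains C where "0 < C" "\<And>l. 0 < l \<Longrightarrow> exp (- c * l powr (-\<mu>)) \<le> C * l powr K"
proof -
  define a where "a = K / \<mu>"
  have a: "0 < a" using assms by (simp add: a_def)
  show ?thesis
  proof
    \<comment> \<open>The maximum of \<open>v powr a * exp (- c * v)\<close>, attained at
      \<open>v = a / c\<close>; here \<open>v = l powr (-\<mu>)\<close>, so
      \<open>v powr (- a) = l powr K\<close>.\<close>
    show "0 < exp (- a - a * ln (c / a))" by simp
    fix l :: real assume l: "0 < l"
    define v where "v = l powr (-\<mu>)"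
    have v: "0 < v" using l by (simp add: v_def)
    have "ln (c / a * v) \<le> c / a * v - 1" using assms a v by (intro ln_le_minus_one) auto
    hence "ln (c / a) + ln v \<le> c / a * v - 1" using assms a v by (subst (asm) ln_mult_pos) auto
    hence "a * (ln (c / a) + ln v) \<le> a * (c / a * v - 1)" using a by (intro mult_left_mono) auto
    hence "- c * v \<le> (- a - a * ln (c / a)) + - a * ln v" using a by (simp add: algebra_simps)
    hence "exp (- c * v) \<le> exp (- a - a * ln (c / a)) * exp (- a * ln v)" by (simp flip: exp_add)
    also have "exp (- a * ln v) = l powr K"
      using l assms by (simp add: v_def a_def ln_powr powr_def)
    finally show "exp (- c * l powr (-\<mu>)) \<le> exp (- a - a * ln (c / a)) * l powr K" by (simp add: v_def)
  qed
qed

text \<open>Both Gaussians together force \<open>p\<close> near \<open>p'\<close>. Half of the first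
  exponent is kept, so that \<open>p\<close> stays localised near \<open>c\<close> in the sums to
  follow.\<close>

lemma exp_add_squares_le:
  fixes p p' c \<delta> :: real
  assumes "0 < \<delta>"
  shows "exp (- (p - c)\<^sup>2 / \<delta>\<^sup>2) * exp (- (p' - c)\<^sup>2 / \<delta>\<^sup>2) \<le> exp (- (p - c)\<^sup>2 / (2 * \<delta>\<^sup>2)) * exp (- (p - p')\<^sup>2 / (4 * \<delta>\<^sup>2))"
proof -
  have "(p - p')\<^sup>2 \<le> 2 * (p - c)\<^sup>2 + 2 * (p' - c)\<^sup>2"
    using zero_le_power2[of "(p - c) + (p' - c)"] by (simp add: power2_eq_square algebra_simps)
  hence "2 * (p - c)\<^sup>2 + (p - p')\<^sup>2 \<le> 4 * (p - c)\<^sup>2 + 4 * (p' - c)\<^sup>2"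
    using zero_le_power2[of "p' - c"] by linarith
  hence "(2 * (p - c)\<^sup>2 + (p - p')\<^sup>2) / (4 * \<delta>\<^sup>2) \<le> (4 * (p - c)\<^sup>2 + 4 * (p' - c)\<^sup>2) / (4 * \<delta>\<^sup>2)"
    by (intro divide_right_mono) auto
  thus ?thesis by (simp add: exp_add[symmetric] add_divide_distrib)
qed

text \<open>Pairing \<open>A *\<^sub>R p0 + B *\<^sub>R \<Delta>\<close> with \<open>U\<close>
  isolates \<open>A\<close>, since \<open>\<Delta>\<close> is almost orthogonal to \<open>U\<close>
  and \<open>p0\<close> is not; the norm of \<open>p0\<close> then bounds what
  \<open>A *\<^sub>R p0\<close> can cancel of \<open>B *\<^sub>R \<Delta>\<close>. The tolerance
  \<open>\<gamma> / (4 * R)\<close>, multiplied by \<open>2 * R\<close> from \<open>p0\<close>, is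
  half of \<open>\<gamma>\<close> and can be absorbed.\<close>

lemma transversality:
  fixes \<Delta> U p0 :: "'a::real_inner"
  assumes pos: "0 < R" "0 < \<gamma>" "0 < t1" "0 < \<kappa>"
    and p0: "norm p0 \<le> 2 * R" and U: "norm U \<le> 4 * R" and \<gamma>: "\<gamma> \<le> \<bar>p0 \<bullet> U\<bar>"
    and orth: "\<bar>\<Delta> \<bullet> U\<bar> \<le> \<gamma> / (4 * R) * norm \<Delta>"
    and B: "\<kappa> \<le> \<bar>B\<bar> * norm \<Delta>"
  shows "\<gamma> / (2 * \<gamma> + 16 * R\<^sup>2) * \<kappa> \<le> norm (A *\<^sub>R p0 + B *\<^sub>R \<Delta>)"
    "\<gamma> / (4 * R + (\<gamma> + 8 * R\<^sup>2) / (2 * R)) * \<bar>A\<bar> \<le> norm (A *\<^sub>R p0 + B *\<^sub>R \<Delta>)"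
proof -
  define V where "V = A *\<^sub>R p0 + B *\<^sub>R \<Delta>"
  have VU: "\<bar>V \<bullet> U\<bar> \<le> norm V * (4 * R)"
    using Cauchy_Schwarz_ineq2[of V U] U by (meson mult_left_mono norm_ge_zero order.trans)
  have "\<bar>A\<bar> * \<bar>p0 \<bullet> U\<bar> \<le> \<bar>V \<bullet> U\<bar> + \<bar>B\<bar> * \<bar>\<Delta> \<bullet> U\<bar>"
    unfolding V_def by (simp add: inner_add_left abs_mult[symmetric])
  moreover have "\<bar>A\<bar> * \<gamma> \<le> \<bar>A\<bar> * \<bar>p0 \<bullet> U\<bar>" using \<gamma> by (intro mult_left_mono) auto
  moreover have "\<bar>B\<bar> * \<bar>\<Delta> \<bullet> U\<bar> \<le> \<bar>B\<bar> * (\<gamma> / (4 * R) * norm \<Delta>)" using orth by (intro mult_left_mono) auto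
  ultimately have 1: "\<bar>A\<bar> * \<gamma> \<le> norm V * (4 * R) + \<gamma> / (4 * R) * (\<bar>B\<bar> * norm \<Delta>)"
    using VU by (simp add: mult_ac)
  have "\<bar>B\<bar> * norm \<Delta> = norm (V - A *\<^sub>R p0)" by (simp add: V_def)
  also have "\<dots> \<le> norm V + \<bar>A\<bar> * norm p0" using norm_triangle_ineq4[of V "A *\<^sub>R p0"] by simp
  also have "\<dots> \<le> norm V + \<bar>A\<bar> * (2 * R)" using p0 by (intro add_left_mono mult_left_mono) auto
  finally have "\<gamma> * (\<bar>B\<bar> * norm \<Delta>) \<le> \<gamma> * (norm V + \<bar>A\<bar> * (2 * R))" using pos by (intro mult_left_mono) auto
  also have "\<dots> = \<gamma> * norm V + 2 * R * (\<bar>A\<bar> * \<gamma>)" by (simp add: algebra_simps)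
  also have "\<dots> \<le> \<gamma> * norm V + 2 * R * (norm V * (4 * R) + \<gamma> / (4 * R) * (\<bar>B\<bar> * norm \<Delta>))"
    using 1 pos by (intro add_left_mono mult_left_mono) auto
  also have "\<dots> = (\<gamma> + 8 * R\<^sup>2) * norm V + \<gamma> / 2 * (\<bar>B\<bar> * norm \<Delta>)"
    using pos by (simp add: field_simps power2_eq_square)
  finally have 2: "\<gamma> / 2 * (\<bar>B\<bar> * norm \<Delta>) \<le> (\<gamma> + 8 * R\<^sup>2) * norm V" by simp
  have "\<gamma> / 2 * \<kappa> \<le> \<gamma> / 2 * (\<bar>B\<bar> * norm \<Delta>)" using B pos by (intro mult_left_mono) auto
  with 2 have "\<gamma> / 2 * \<kappa> \<le> (\<gamma> + 8 * R\<^sup>2) * norm V" by linarith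
  moreover have "0 < \<gamma> + 8 * R\<^sup>2" using pos by (simp add: add_pos_nonneg)
  ultimately show "\<gamma> / (2 * \<gamma> + 16 * R\<^sup>2) * \<kappa> \<le> norm (A *\<^sub>R p0 + B *\<^sub>R \<Delta>)"
    unfolding V_def[symmetric] by (simp add: field_simps)
  have "\<gamma> / (4 * R) * (\<bar>B\<bar> * norm \<Delta>) = (1 / (2 * R)) * (\<gamma> / 2 * (\<bar>B\<bar> * norm \<Delta>))" by simp
  also have "\<dots> \<le> (1 / (2 * R)) * ((\<gamma> + 8 * R\<^sup>2) * norm V)" using 2 pos by (intro mult_left_mono) auto
  also have "\<dots> = (\<gamma> + 8 * R\<^sup>2) / (2 * R) * norm V" by simp
  finally have 3: "\<gamma> / (4 * R) * (\<bar>B\<bar> * norm \<Delta>) \<le> (\<gamma> + 8 * R\<^sup>2) / (2 * R) * norm V" .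
  have "\<bar>A\<bar> * \<gamma> \<le> (4 * R + (\<gamma> + 8 * R\<^sup>2) / (2 * R)) * norm V"
    unfolding distrib_right using 1 3 mult.commute[of "norm V" "4 * R"] by linarith
  moreover have "0 < 4 * R + (\<gamma> + 8 * R\<^sup>2) / (2 * R)" using pos by (intro add_pos_nonneg divide_nonneg_nonneg) auto
  ultimately show "\<gamma> / (4 * R + (\<gamma> + 8 * R\<^sup>2) / (2 * R)) * \<bar>A\<bar> \<le> norm (A *\<^sub>R p0 + B *\<^sub>R \<Delta>)"
    unfolding V_def[symmetric] by (simp add: divide_le_eq mult.commute)
qed

subsection \<open>The kernel\<close>

lemma shell_ft_le_const_dim:
  fixes g \<theta> :: "'a::euclidean_space \<times> 'a"
  assumes "1 \<le> k" "0 < l" "2 \<le> DIM('a)"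
  shows "norm (shell_ft k t c l g \<theta>) \<le> pi ^ DIM('a)"
proof -
  have "pi ^ DIM('a) * exp (- (norm (fst \<theta>))\<^sup>2 / (4 * k)) \<le> pi ^ DIM('a) * 1"
    using assms by (intro mult_left_mono) auto
  thus ?thesis using shell_ft_le_fst[OF assms, of t c g \<theta>] by linarith
qed

text \<open>By \<open>P\<close> and \<open>\<xi>\<close> the vector \<open>w - w'\<close> is nearly orthogonal to \<open>(x - w) + (x' - w')\<close>, whereas \<open>z - y\<close>
  is not, so the two terms on the right cannot cancel.\<close>
lemma transversal_frequency:
  fixes x w x' w' y z :: "'a::euclidean_space"
  assumes pos: "1 \<le> R" "0 < \<gamma>" "0 < \<sigma>" "0 < t1"
    and k: "1 \<le> k" "12 * R\<^sup>2 / (\<sigma> * \<gamma>) \<le> k" and l: "0 < l" and \<tau>: "1 / l \<le> \<bar>\<tau>\<bar>"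
    and s: "t1 \<le> s" "\<sigma> \<le> \<bar>s\<^sup>2 - 1\<bar>" and t: "t1 \<le> t"
    and norms: "norm x \<le> R" "norm x' \<le> R" "norm w \<le> R" "norm w' \<le> R" "norm y \<le> R" "norm z \<le> R"
    and \<gamma>: "\<gamma> \<le> \<bar>(z - y) \<bullet> ((x - w) + (x' - w'))\<bar>"
    and P: "\<bar>(norm (x - w))\<^sup>2 - (norm (x' - w'))\<^sup>2\<bar> \<le> l * k"
    and \<xi>: "norm ((x - x') - s\<^sup>2 *\<^sub>R (w - w')) \<le> l * k / 2"
    and \<Delta>: "l * k\<^sup>2 < norm (w - w')"
  defines "q \<equiv> (min (\<gamma> / (2 * \<gamma> + 16 * R\<^sup>2) * (2 * t1\<^sup>2)) (\<gamma> / (4 * R + (\<gamma> + 8 * R\<^sup>2) / (2 * R)) * (2 * t1\<^sup>2)))\<^sup>2 / 2"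
  shows "q * (k\<^sup>2 + r\<^sup>2) \<le> (norm ((2 * (r * t\<^sup>2)) *\<^sub>R (z - y) + (2 * \<tau> * s\<^sup>2) *\<^sub>R (w - w')))\<^sup>2"
proof -
  define \<Delta> where "\<Delta> = w - w'"
  define U where "U = (x - w) + (x' - w')"
  define e where "e = (x - x') - s\<^sup>2 *\<^sub>R \<Delta>"
  define V where "V = (2 * (r * t\<^sup>2)) *\<^sub>R (z - y) + (2 * \<tau> * s\<^sup>2) *\<^sub>R \<Delta>"
  define m where "m = min (\<gamma> / (2 * \<gamma> + 16 * R\<^sup>2) * (2 * t1\<^sup>2)) (\<gamma> / (4 * R + (\<gamma> + 8 * R\<^sup>2) / (2 * R)) * (2 * t1\<^sup>2))"
  have U: "norm U \<le> 4 * R"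
  proof -
    have "norm U \<le> norm (x - w) + norm (x' - w')" unfolding U_def by (rule norm_triangle_ineq)
    also have "\<dots> \<le> (norm x + norm w) + (norm x' + norm w')" by (intro add_mono norm_triangle_ineq4)
    finally show ?thesis using norms by linarith
  qed
  have p0: "norm (z - y) \<le> 2 * R" using norm_triangle_ineq4[of z y] norms by linarith
  have t1t: "t1\<^sup>2 \<le> t\<^sup>2" "t1\<^sup>2 \<le> s\<^sup>2" using pos s t by (auto intro!: power_mono)
  \<comment> \<open>The difference of squares factors through \<open>U\<close>, and
    \<open>(x - w) - (x' - w')\<close> is \<open>(s\<^sup>2 - 1) *\<^sub>R \<Delta>\<close> up to
    the small error \<open>e\<close>. This is where \<open>s\<close> must differ from
    \<open>1\<close>.\<close>
  have "(norm (x - w))\<^sup>2 - (norm (x' - w'))\<^sup>2 = ((x - w) - (x' - w')) \<bullet> U"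
    unfolding U_def power2_norm_eq_inner by (simp add: inner_add_right inner_diff_left inner_diff_right inner_commute)
  also have "(x - w) - (x' - w') = (s\<^sup>2 - 1) *\<^sub>R \<Delta> + e"
    by (simp add: e_def \<Delta>_def algebra_simps)
  finally have "(s\<^sup>2 - 1) * (\<Delta> \<bullet> U) = ((norm (x - w))\<^sup>2 - (norm (x' - w'))\<^sup>2) - e \<bullet> U"
    by (simp add: inner_add_left)
  hence "\<bar>s\<^sup>2 - 1\<bar> * \<bar>\<Delta> \<bullet> U\<bar> \<le> \<bar>(norm (x - w))\<^sup>2 - (norm (x' - w'))\<^sup>2\<bar> + \<bar>e \<bullet> U\<bar>"
    by (simp add: abs_mult[symmetric])
  also have "\<bar>e \<bullet> U\<bar> \<le> l * k / 2 * (4 * R)"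
  proof (rule order.trans[OF Cauchy_Schwarz_ineq2 mult_mono[OF _ U]])
    show "norm e \<le> l * k / 2" using \<xi> by (simp add: e_def \<Delta>_def)
  qed (use l k in auto)
  also have "\<bar>(norm (x - w))\<^sup>2 - (norm (x' - w'))\<^sup>2\<bar> + l * k / 2 * (4 * R) \<le> l * k * R + l * k / 2 * (4 * R)"
    using P pos l k by (intro add_mono) (auto intro: order.trans[OF P] simp: mult_le_cancel_left1)
  also have "\<dots> = 3 * R * (l * k)" by simp
  finally have "\<bar>s\<^sup>2 - 1\<bar> * \<bar>\<Delta> \<bullet> U\<bar> \<le> 3 * R * (l * k)" by simp
  moreover have "\<sigma> * \<bar>\<Delta> \<bullet> U\<bar> \<le> \<bar>s\<^sup>2 - 1\<bar> * \<bar>\<Delta> \<bullet> U\<bar>" using s by (intro mult_right_mono) auto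
  ultimately have "\<sigma> * \<bar>\<Delta> \<bullet> U\<bar> \<le> 3 * R * (l * k)" by linarith
  hence "k * (\<sigma> * \<bar>\<Delta> \<bullet> U\<bar>) \<le> k * (3 * R * (l * k))" using k by (intro mult_left_mono) auto
  also have "\<dots> = 3 * R * (l * k\<^sup>2)" by (simp add: power2_eq_square)
  also have "\<dots> \<le> 3 * R * norm \<Delta>" using pos \<Delta> by (intro mult_left_mono) (auto simp: \<Delta>_def)
  finally have a1: "k * (\<sigma> * \<bar>\<Delta> \<bullet> U\<bar>) \<le> 3 * R * norm \<Delta>" .
  \<comment> \<open>\<open>12 * R\<^sup>2\<close> is \<open>3 * R\<close>, the constant just
    obtained, times \<open>4 * R\<close> from the tolerance in \<open>transversality\<close>;
    largeness of \<open>k\<close> makes up for \<open>\<sigma> * \<gamma>\<close>.\<close>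
  have "12 * R\<^sup>2 \<le> \<sigma> * \<gamma> * k" using k pos by (simp add: field_simps)
  hence "12 * R\<^sup>2 * \<bar>\<Delta> \<bullet> U\<bar> \<le> \<sigma> * \<gamma> * k * \<bar>\<Delta> \<bullet> U\<bar>" by (intro mult_right_mono) auto
  also have "\<dots> = \<gamma> * (k * (\<sigma> * \<bar>\<Delta> \<bullet> U\<bar>))" by simp
  also have "\<dots> \<le> \<gamma> * (3 * R * norm \<Delta>)" using a1 pos by (intro mult_left_mono) auto
  finally have "3 * R * (4 * R * \<bar>\<Delta> \<bullet> U\<bar>) \<le> 3 * R * (\<gamma> * norm \<Delta>)" by (simp add: power2_eq_square mult_ac)
  hence "4 * R * \<bar>\<Delta> \<bullet> U\<bar> \<le> \<gamma> * norm \<Delta>" using pos by simp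
  hence orth: "\<bar>\<Delta> \<bullet> U\<bar> \<le> \<gamma> / (4 * R) * norm \<Delta>" using pos by (simp add: field_simps)
  have B: "2 * t1\<^sup>2 * k \<le> \<bar>2 * \<tau> * s\<^sup>2\<bar> * norm \<Delta>"
  proof -
    have "k * 1 \<le> k * k" using k by (intro mult_left_mono) auto
    hence "k \<le> 1 / l * (l * k\<^sup>2)" using l by (simp add: power2_eq_square)
    also have "\<dots> \<le> \<bar>\<tau>\<bar> * norm \<Delta>" using \<tau> \<Delta> l by (intro mult_mono) (auto simp: \<Delta>_def)
    finally have "2 * t1\<^sup>2 * k \<le> 2 * s\<^sup>2 * (\<bar>\<tau>\<bar> * norm \<Delta>)" using t1t k by (intro mult_mono) auto
    thus ?thesis by (simp add: abs_mult mult_ac)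
  qed
  note tr = transversality[of R \<gamma> t1 "2 * t1\<^sup>2 * k" "z - y" U \<Delta> "2 * \<tau> * s\<^sup>2" "2 * (r * t\<^sup>2)"]
  have posk: "0 < 2 * t1\<^sup>2 * k" using pos k by simp
  have mpos: "0 < m" using pos by (auto simp: m_def intro!: divide_pos_pos mult_pos_pos add_pos_nonneg add_pos_pos)
  have "m * k \<le> norm V"
  proof -
    have "m * k \<le> \<gamma> / (2 * \<gamma> + 16 * R\<^sup>2) * (2 * t1\<^sup>2) * k" unfolding m_def using k by (intro mult_right_mono) auto
    thus ?thesis using tr(1) pos posk p0 U \<gamma> orth B unfolding V_def U_def by (simp add: mult.assoc)
  qed
  hence k2: "m\<^sup>2 * k\<^sup>2 \<le> (norm V)\<^sup>2" unfolding power_mult_distrib[symmetric] using mpos k by (intro power_mono) auto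
  have "m * \<bar>r\<bar> \<le> norm V"
  proof -
    define c2 where "c2 = \<gamma> / (4 * R + (\<gamma> + 8 * R\<^sup>2) / (2 * R))"
    have c2: "0 < c2" using pos by (auto simp: c2_def intro!: divide_pos_pos mult_pos_pos add_pos_nonneg add_pos_pos)
    have "m * \<bar>r\<bar> \<le> c2 * (2 * t1\<^sup>2) * \<bar>r\<bar>" unfolding m_def c2_def by (intro mult_right_mono) auto
    also have "\<dots> \<le> c2 * (2 * t\<^sup>2) * \<bar>r\<bar>" using t1t c2 by (intro mult_right_mono mult_left_mono) auto
    also have "\<dots> = c2 * \<bar>2 * (r * t\<^sup>2)\<bar>" by (simp add: abs_mult)
    also have "\<dots> \<le> norm V" unfolding c2_def V_def using tr(2) pos posk p0 U \<gamma> orth B unfolding U_def by simp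
    finally show ?thesis .
  qed
  hence "m\<^sup>2 * r\<^sup>2 \<le> (norm V)\<^sup>2"
    using power_mono[of "m * \<bar>r\<bar>" "norm V" 2] mpos by (simp add: power_mult_distrib)
  with k2 have "m\<^sup>2 / 2 * (k\<^sup>2 + r\<^sup>2) \<le> (norm V)\<^sup>2" by (simp add: field_simps)
  thus ?thesis unfolding V_def \<Delta>_def q_def m_def .
qed

text \<open>With \<open>k = l powr (-\<mu>)\<close>, every separation of \<open>(x, w)\<close> from
  \<open>(x', w')\<close> yields a factor \<open>exp (- c0 * k)\<close>: the two Gaussians disagree
  once \<open>|p - p'| > l * k\<close>; or the first frequency exceeds \<open>k\<close>; or, these
  being small, \<open>norm (w - w') > l * k\<^sup>2\<close> and transversality applies. Otherwise
  both differences are \<open>O(l * k\<^sup>2)\<close> and only the thickness of the shell is used.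
  Taking \<open>l * k\<^sup>2\<close> instead of \<open>l * k\<close> provides the factor
  \<open>k\<close> by which near-orthogonality beats its error.\<close>

lemma kernel_estimate:
  assumes d: "2 \<le> DIM('a::euclidean_space)"
    and pos: "1 \<le> R" "0 < \<gamma>" "0 < \<sigma>" "0 < t1" "1 \<le> T" and \<mu>: "0 < \<mu>"
  obtains C c0 C1 where "0 < C" "0 < c0" "1 \<le> C1"
    "\<And>l \<delta> \<tau> s t c (x::'a) w x' w' y z. 0 < \<delta> \<Longrightarrow> \<delta> \<le> l \<Longrightarrow> l \<le> 1 \<Longrightarrow> 1 / l \<le> \<bar>\<tau>\<bar> \<Longrightarrow>
      t1 \<le> s \<Longrightarrow> s \<le> T \<Longrightarrow> \<sigma> \<le> \<bar>s\<^sup>2 - 1\<bar> \<Longrightarrow> t1 \<le> t \<Longrightarrow> t \<le> T \<Longrightarrow>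
      norm x \<le> R \<Longrightarrow> norm x' \<le> R \<Longrightarrow> norm w \<le> R \<Longrightarrow> norm w' \<le> R \<Longrightarrow> norm y \<le> R \<Longrightarrow> norm z \<le> R \<Longrightarrow>
      \<gamma> \<le> \<bar>(z - y) \<bullet> ((x - w) + (x' - w'))\<bar> \<Longrightarrow>
      exp (- ((norm (x - w))\<^sup>2 - c)\<^sup>2 / \<delta>\<^sup>2) * exp (- ((norm (x' - w'))\<^sup>2 - c)\<^sup>2 / \<delta>\<^sup>2) *
        norm (shell_ft (l powr (-\<mu>)) t c l (y, z - y) ((-2 * \<tau>) *\<^sub>R ((x - x') - s\<^sup>2 *\<^sub>R (w - w')), (2 * \<tau> * s\<^sup>2) *\<^sub>R (w - w')))
      \<le> exp (- ((norm (x - w))\<^sup>2 - c)\<^sup>2 / (2 * \<delta>\<^sup>2)) * (C * exp (- c0 * l powr (-\<mu>)) +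
          (if norm (x - x') \<le> C1 * l powr (1 - 2 * \<mu>) \<and> norm (w - w') \<le> C1 * l powr (1 - 2 * \<mu>) then C * l powr (1 - \<mu>) else 0))"
proof -
  define q where "q = (min (\<gamma> / (2 * \<gamma> + 16 * R\<^sup>2) * (2 * t1\<^sup>2)) (\<gamma> / (4 * R + (\<gamma> + 8 * R\<^sup>2) / (2 * R)) * (2 * t1\<^sup>2)))\<^sup>2 / 2"
  have "0 < \<gamma> / (2 * \<gamma> + 16 * R\<^sup>2) * (2 * t1\<^sup>2)"
    using pos by (intro mult_pos_pos divide_pos_pos add_pos_nonneg) auto
  moreover have "0 < \<gamma> / (4 * R + (\<gamma> + 8 * R\<^sup>2) / (2 * R)) * (2 * t1\<^sup>2)"
    using pos by (intro mult_pos_pos divide_pos_pos add_pos_nonneg) auto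
  ultimately have q: "0 < q" unfolding q_def by (intro divide_pos_pos zero_less_power) (simp_all only: min_less_iff_conj simp_thms zero_less_numeral)
  obtain Cw where Cw: "0 \<le> Cw" "\<And>k t c l (g::'a\<times>'a) \<theta>. 1 \<le> k \<Longrightarrow> t1 \<le> t \<Longrightarrow> 0 < l \<Longrightarrow> l \<le> 1 \<Longrightarrow>
     norm (shell_ft k t c l g \<theta>) \<le> Cw * l powr (1 - \<mu>)"
    using shell_ft_le_thickness[OF d \<open>0 < t1\<close> \<mu>] by metis
  define k0 where "k0 = 12 * R\<^sup>2 / (\<sigma> * \<gamma>)"
  have k0: "0 \<le> k0" using pos by (simp add: k0_def)
  define c0 where "c0 = min (1/4) (q / (4 * T ^ 4))"
  have c0: "0 < c0" "c0 \<le> 1/4" "c0 \<le> q / (4 * T ^ 4)" using q pos by (auto simp: c0_def)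
  \<comment> \<open>\<open>exp (c0 * k0)\<close> makes the first summand trivially sufficient as
    long as \<open>k < k0\<close>, where near-orthogonality is still too weak for
    transversality.\<close>
  define C where "C = Cw + pi ^ DIM('a) * exp (c0 * k0)"
  have C: "0 < C" using Cw by (simp add: C_def add_nonneg_pos)
  have C': "Cw \<le> C" "pi ^ DIM('a) * exp (c0 * k0) \<le> C" using Cw by (auto simp: C_def)
  have "pi ^ DIM('a) * 1 \<le> pi ^ DIM('a) * exp (c0 * k0)" using c0 k0 by (intro mult_left_mono) auto
  hence C'': "pi ^ DIM('a) \<le> C" using C' by linarith
  \<comment> \<open>From \<open>x - x' = e + s\<^sup>2 *\<^sub>R (w - w')\<close> with
    \<open>norm e \<le> l * k\<^sup>2\<close> and \<open>s \<le> T\<close>.\<close>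
  define C1 where "C1 = T\<^sup>2 + 1"
  have C1: "1 \<le> C1" by (simp add: C1_def)
  show ?thesis
  proof (rule that[OF C c0(1) C1])
    fix l \<delta> \<tau> s t c :: real and x w x' w' y z :: 'a
    assume l: "0 < \<delta>" "\<delta> \<le> l" "l \<le> 1" and \<tau>: "1 / l \<le> \<bar>\<tau>\<bar>" and s: "t1 \<le> s" "s \<le> T" "\<sigma> \<le> \<bar>s\<^sup>2 - 1\<bar>"
      and t: "t1 \<le> t" "t \<le> T" and norms: "norm x \<le> R" "norm x' \<le> R" "norm w \<le> R" "norm w' \<le> R" "norm y \<le> R" "norm z \<le> R"
      and \<gamma>: "\<gamma> \<le> \<bar>(z - y) \<bullet> ((x - w) + (x' - w'))\<bar>"
    have l0: "0 < l" using l by simp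
    define k where "k = l powr (-\<mu>)"
    have k: "1 \<le> k" using l l0 \<mu> by (simp add: k_def powr_minus_divide powr_le1)
    have lk: "l * k\<^sup>2 = l powr (1 - 2 * \<mu>)" "l * k = l powr (1 - \<mu>)"
      using l0 by (simp_all add: k_def power2_eq_square powr_diff powr_minus_divide powr_mult_base flip: powr_add)
    define p where "p = (norm (x - w))\<^sup>2"
    define p' where "p' = (norm (x' - w'))\<^sup>2"
    define \<theta> where "\<theta> = ((-2 * \<tau>) *\<^sub>R ((x - x') - s\<^sup>2 *\<^sub>R (w - w')), (2 * \<tau> * s\<^sup>2) *\<^sub>R (w - w'))"
    define S where "S = norm (shell_ft k t c l (y, z - y) \<theta>)"
    define near where "near \<longleftrightarrow> norm (x - x') \<le> C1 * l powr (1 - 2 * \<mu>) \<and> norm (w - w') \<le> C1 * l powr (1 - 2 * \<mu>)"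
    define N where "N = (if near then C * l powr (1 - \<mu>) else 0)"
    have N0: "0 \<le> N" using C by (simp add: N_def)
    have S0: "0 \<le> S" by (simp add: S_def)
    have Spi: "S \<le> pi ^ DIM('a)" unfolding S_def by (rule shell_ft_le_const_dim[OF k l0 d])
    have E: "exp (- (p - c)\<^sup>2 / \<delta>\<^sup>2) * exp (- (p' - c)\<^sup>2 / \<delta>\<^sup>2) \<le> exp (- (p - c)\<^sup>2 / (2 * \<delta>\<^sup>2)) * exp (- (p - p')\<^sup>2 / (4 * \<delta>\<^sup>2))"
      using l by (intro exp_add_squares_le) auto
    have "exp (- (p - p')\<^sup>2 / (4 * \<delta>\<^sup>2)) * S \<le> C * exp (- c0 * k) + N"
    proof (cases "\<bar>p - p'\<bar> \<le> l * k")
      case False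
      have "(l * k)\<^sup>2 \<le> \<bar>p - p'\<bar>\<^sup>2" using False l0 k by (intro power_mono) auto
      moreover have "\<delta>\<^sup>2 \<le> l\<^sup>2" using l by (intro power_mono) auto
      hence "k * \<delta>\<^sup>2 \<le> k\<^sup>2 * l\<^sup>2" using k by (intro mult_mono) (auto simp: power2_eq_square mult_le_cancel_left1)
      ultimately have "k * \<delta>\<^sup>2 \<le> (p - p')\<^sup>2" by (simp add: power_mult_distrib mult.commute)
      hence "1/4 * k \<le> (p - p')\<^sup>2 / (4 * \<delta>\<^sup>2)" using l by (simp add: field_simps)
      moreover have "c0 * k \<le> 1/4 * k" using c0 k by (intro mult_right_mono) auto
      ultimately have "exp (- (p - p')\<^sup>2 / (4 * \<delta>\<^sup>2)) \<le> exp (- c0 * k)" by simp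
      hence "exp (- (p - p')\<^sup>2 / (4 * \<delta>\<^sup>2)) * S \<le> exp (- c0 * k) * C" using Spi C'' S0 by (intro mult_mono) auto
      thus ?thesis using N0 by (simp add: mult.commute)
    next
      case P: True
      have "exp (- (p - p')\<^sup>2 / (4 * \<delta>\<^sup>2)) \<le> 1" by simp
      hence *: "exp (- (p - p')\<^sup>2 / (4 * \<delta>\<^sup>2)) * S \<le> S" using S0 by (simp add: mult_left_le_one_le)
      have "S \<le> C * exp (- c0 * k) + N"
      proof (cases "norm (fst \<theta>) \<le> k")
        case False
        have "k\<^sup>2 \<le> (norm (fst \<theta>))\<^sup>2" using False k by (intro power_mono) auto
        hence "1/4 * k \<le> (norm (fst \<theta>))\<^sup>2 / (4 * k)" using k by (simp add: field_simps power2_eq_square)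
        moreover have "c0 * k \<le> 1/4 * k" using c0 k by (intro mult_right_mono) auto
        ultimately have "exp (- (norm (fst \<theta>))\<^sup>2 / (4 * k)) \<le> exp (- c0 * k)" by simp
        hence "pi ^ DIM('a) * exp (- (norm (fst \<theta>))\<^sup>2 / (4 * k)) \<le> C * exp (- c0 * k)"
          using C'' C by (intro mult_mono) auto
        thus ?thesis using shell_ft_le_fst[OF k l0 d, of t c "(y, z - y)" \<theta>] N0 unfolding S_def by linarith
      next
        case True
        have \<xi>: "norm ((x - x') - s\<^sup>2 *\<^sub>R (w - w')) \<le> l * k / 2"
        proof -
          have "2 * (1 / l * norm ((x - x') - s\<^sup>2 *\<^sub>R (w - w'))) \<le> 2 * (\<bar>\<tau>\<bar> * norm ((x - x') - s\<^sup>2 *\<^sub>R (w - w')))"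
            using \<tau> by (intro mult_left_mono mult_right_mono) auto
          also have "\<dots> = norm (fst \<theta>)" by (simp add: \<theta>_def abs_mult)
          also note True
          finally show ?thesis using l0 by (simp add: field_simps)
        qed
        show ?thesis
        proof (cases "norm (w - w') \<le> l * k\<^sup>2")
          case True
          have "norm (x - x') \<le> norm ((x - x') - s\<^sup>2 *\<^sub>R (w - w')) + norm (s\<^sup>2 *\<^sub>R (w - w'))"
            by (metis diff_add_cancel norm_triangle_ineq)
          also have "norm (s\<^sup>2 *\<^sub>R (w - w')) \<le> T\<^sup>2 * (l * k\<^sup>2)"
            using True s pos power_mono[of s T 2] by (auto intro!: mult_mono)
          also have "norm ((x - x') - s\<^sup>2 *\<^sub>R (w - w')) \<le> 1 * (l * k\<^sup>2)"
          proof -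
            have "l * k * 1 \<le> l * k * k" using l0 k by (intro mult_left_mono) auto
            moreover have "l * k / 2 \<le> l * k" using l0 k by simp
            ultimately have "norm ((x - x') - s\<^sup>2 *\<^sub>R (w - w')) \<le> l * k * k" using \<xi> by linarith
            thus ?thesis by (simp add: power2_eq_square mult.assoc)
          qed
          finally have "norm (x - x') \<le> C1 * (l * k\<^sup>2)" by (simp add: C1_def algebra_simps)
          moreover have "1 * (l * k\<^sup>2) \<le> C1 * (l * k\<^sup>2)" using C1 l0 by (intro mult_right_mono) auto
          ultimately have near using True by (simp add: near_def lk)
          hence "N = C * l powr (1 - \<mu>)" by (simp add: N_def)
          moreover have "S \<le> Cw * l powr (1 - \<mu>)" unfolding S_def using k t l0 l by (intro Cw(2)) auto
          moreover have "Cw * l powr (1 - \<mu>) \<le> C * l powr (1 - \<mu>)" using C' by (intro mult_right_mono) auto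
          ultimately show ?thesis using C by (simp add: add_increasing)
        next
          case False
          show ?thesis
          proof (cases "k0 \<le> k")
            case True
            have "S \<le> pi ^ DIM('a) * exp (- k * q / (4 * T ^ 4))"
              unfolding S_def
            proof (rule shell_ft_le_snd[OF k l0 d \<open>1 \<le> T\<close> _ q])
              show "\<bar>t\<bar> \<le> T" using t pos by simp
              show "q * (k\<^sup>2 + r\<^sup>2) \<le> (norm ((2 * (r * t\<^sup>2)) *\<^sub>R snd (y, z - y) + snd \<theta>))\<^sup>2" for r
                using transversal_frequency[of R \<gamma> \<sigma> t1 k l \<tau> s t x x' w w' y z r] pos k True l0 \<tau> s t norms \<gamma> P \<xi> False
                by (simp add: \<theta>_def q_def k0_def p_def p'_def)
            qed
            also have "\<dots> \<le> C * exp (- c0 * k)"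
            proof (rule mult_mono)
              have "c0 * k \<le> q / (4 * T ^ 4) * k" using c0 k by (intro mult_right_mono) auto
              thus "exp (- k * q / (4 * T ^ 4)) \<le> exp (- c0 * k)" by (simp add: mult.commute)
            qed (use C C'' in auto)
            finally show ?thesis using N0 by linarith
          next
            case False
            have "pi ^ DIM('a) * 1 \<le> pi ^ DIM('a) * (exp (c0 * k0) * exp (- c0 * k))"
            proof -
              have "c0 * k \<le> c0 * k0" using False c0 by (intro mult_left_mono) auto
              thus ?thesis by (intro mult_left_mono) (auto simp flip: exp_add)
            qed
            also have "\<dots> \<le> C * exp (- c0 * k)" using C'(2) unfolding mult.assoc[symmetric] by (intro mult_right_mono) auto
            finally show ?thesis using Spi N0 by linarith
          qed
        qed
      qed
      thus ?thesis using * by linarith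
    qed
    hence "exp (- (p - c)\<^sup>2 / (2 * \<delta>\<^sup>2)) * (exp (- (p - p')\<^sup>2 / (4 * \<delta>\<^sup>2)) * S) \<le> exp (- (p - c)\<^sup>2 / (2 * \<delta>\<^sup>2)) * (C * exp (- c0 * k) + N)"
      by (intro mult_left_mono) auto
    moreover have "exp (- (p - c)\<^sup>2 / \<delta>\<^sup>2) * exp (- (p' - c)\<^sup>2 / \<delta>\<^sup>2) * S \<le> exp (- (p - c)\<^sup>2 / (2 * \<delta>\<^sup>2)) * (exp (- (p - p')\<^sup>2 / (4 * \<delta>\<^sup>2)) * S)"
      unfolding mult.assoc[symmetric] using E S0 by (intro mult_right_mono) auto
    ultimately have "exp (- (p - c)\<^sup>2 / \<delta>\<^sup>2) * exp (- (p' - c)\<^sup>2 / \<delta>\<^sup>2) * S \<le> exp (- (p - c)\<^sup>2 / (2 * \<delta>\<^sup>2)) * (C * exp (- c0 * k) + N)"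
      by linarith
    thus "exp (- ((norm (x - w))\<^sup>2 - c)\<^sup>2 / \<delta>\<^sup>2) * exp (- ((norm (x' - w'))\<^sup>2 - c)\<^sup>2 / \<delta>\<^sup>2) *
        norm (shell_ft (l powr (-\<mu>)) t c l (y, z - y) ((-2 * \<tau>) *\<^sub>R ((x - x') - s\<^sup>2 *\<^sub>R (w - w')), (2 * \<tau> * s\<^sup>2) *\<^sub>R (w - w')))
      \<le> exp (- ((norm (x - w))\<^sup>2 - c)\<^sup>2 / (2 * \<delta>\<^sup>2)) * (C * exp (- c0 * l powr (-\<mu>)) +
          (if norm (x - x') \<le> C1 * l powr (1 - 2 * \<mu>) \<and> norm (w - w') \<le> C1 * l powr (1 - 2 * \<mu>) then C * l powr (1 - \<mu>) else 0))"
      unfolding p_def p'_def S_def k_def \<theta>_def N_def near_def .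
  qed
qed

subsection \<open>The bilinear estimate\<close>

text \<open>Radii below \<open>r0\<close> are exempt because the point set is finite.\<close>
definition frostman :: "real \<Rightarrow> real \<Rightarrow> real \<Rightarrow> 'a::metric_space set \<Rightarrow> ('a \<Rightarrow> real) \<Rightarrow> bool" where
  "frostman \<alpha> K r0 P m \<longleftrightarrow> finite P \<and> (\<forall>x\<in>P. 0 \<le> m x) \<and>
     (\<forall>x. \<forall>r\<ge>r0. (\<Sum>y | y \<in> P \<and> dist x y \<le> r. m y) \<le> K * r powr \<alpha>)"

lemma frostman_total_le:
  assumes "frostman \<alpha> K r0 P m" "P \<subseteq> cball x R" "r0 \<le> R"
  shows "sum m P \<le> K * R powr \<alpha>"
proof -
  have "{y. y \<in> P \<and> dist x y \<le> R} = P" using assms(2) by auto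
  thus ?thesis using assms(1,3) unfolding frostman_def by metis
qed

lemma frostman_product_le:
  assumes P: "frostman \<alpha> K r0 P m" and Q: "frostman \<alpha> K r0 Q n"
    and r: "r0 \<le> r" "r0 \<le> r'" and K: "0 \<le> K"
    and N: "\<And>x y. x \<in> P \<Longrightarrow> y \<in> Q \<Longrightarrow> N (x, y) \<Longrightarrow> dist x1 x \<le> r \<and> dist y1 y \<le> r'"
  shows "(\<Sum>i | i \<in> P \<times> Q \<and> N i. m (fst i) * n (snd i)) \<le> (K * r powr \<alpha>) * (K * r' powr \<alpha>)"
proof -
  have fin: "finite P" "finite Q" and nn: "\<And>x. x \<in> P \<Longrightarrow> 0 \<le> m x" "\<And>y. y \<in> Q \<Longrightarrow> 0 \<le> n y"
    using P Q by (auto simp: frostman_def)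
  have "(\<Sum>i | i \<in> P \<times> Q \<and> N i. m (fst i) * n (snd i)) \<le>
     (\<Sum>i\<in>{x. x \<in> P \<and> dist x1 x \<le> r} \<times> {y. y \<in> Q \<and> dist y1 y \<le> r'}. m (fst i) * n (snd i))"
    using fin nn N by (intro sum_mono2) auto
  also have "\<dots> = (\<Sum>x | x \<in> P \<and> dist x1 x \<le> r. m x) * (\<Sum>y | y \<in> Q \<and> dist y1 y \<le> r'. n y)"
    by (simp add: sum_product sum.cartesian_product split_beta)
  also have "\<dots> \<le> (K * r powr \<alpha>) * (K * r' powr \<alpha>)"
    using P Q r nn K by (intro mult_mono) (auto simp: frostman_def intro: sum_nonneg)
  finally show ?thesis .
qed

lemma norm_le_of_mem_cbox:
  fixes Y Z :: "'v::euclidean_space" and h :: real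
  assumes "Y \<in> cbox (Z - h *\<^sub>R One) (Z + h *\<^sub>R One)"
  shows "norm (Y - Z) \<le> DIM('v) * h"
proof -
  have "\<bar>(Y - Z) \<bullet> b\<bar> \<le> h" if "b \<in> Basis" for b
    using assms that by (auto simp: mem_box inner_diff_left inner_add_left abs_le_iff algebra_simps)
  hence "(\<Sum>b\<in>Basis. \<bar>(Y - Z) \<bullet> b\<bar>) \<le> (\<Sum>b\<in>(Basis::'v set). h)" by (intro sum_mono)
  thus ?thesis using norm_le_l1[of "Y - Z"] by simp
qed

lemma integrable_shell:
  fixes g :: "'a::euclidean_space \<times> 'a"
  assumes "0 < k"
  shows "integrable lborel (shell k t c l g)"
proof (rule Bochner_Integration.integrable_bound)
  show "integrable lborel (\<lambda>Y. norm (pchirp k g 0 0 Y))"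
    by (intro integrable_norm integrable_pchirp assms)
  show "shell k t c l g \<in> borel_measurable lborel"
  proof -
    have "continuous_on UNIV (shell k t c l g)"
      unfolding shell_def[abs_def] divide_inverse by (intro continuous_intros)
    thus ?thesis using borel_measurable_continuous_onI by simp
  qed
  have "exp (- (t\<^sup>2 * (norm (snd Y))\<^sup>2 - c)\<^sup>2 / (2 * l\<^sup>2)) \<le> 1" for Y :: "'a \<times> 'a" by simp
  thus "AE Y in lborel. norm (shell k t c l g Y) \<le> norm (norm (pchirp k g 0 0 Y))"
    by (intro AE_I2) (simp add: shell_def pchirp_def norm_mult abs_mult mult_left_le)
qed

text \<open>Widening the Gaussian from \<open>\<delta>\<close> to \<open>l\<close> allows its
  argument to move by \<open>O(l)\<close> at the cost of a constant.\<close>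

lemma thin_gaussian_shift:
  fixes q q' c \<delta> l L :: real
  assumes "0 < \<delta>" "\<delta> \<le> l" "\<bar>q - q'\<bar> \<le> L * l"
  shows "exp (- (q - c)\<^sup>2 / \<delta>\<^sup>2) \<le> exp (L\<^sup>2) * exp (- (q' - c)\<^sup>2 / (2 * l\<^sup>2))"
proof -
  have l: "0 < l" using assms by simp
  have "\<delta>\<^sup>2 \<le> l\<^sup>2" using assms by (intro power_mono) auto
  hence "(q - c)\<^sup>2 / l\<^sup>2 \<le> (q - c)\<^sup>2 / \<delta>\<^sup>2" using assms l by (intro divide_left_mono) auto
  moreover have "(q' - c)\<^sup>2 / (2 * l\<^sup>2) \<le> L\<^sup>2 + (q - c)\<^sup>2 / l\<^sup>2"
  proof -
    have q1: "\<bar>q - q'\<bar>\<^sup>2 \<le> (L * l)\<^sup>2" using assms(3) by (intro power_mono) auto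
    have q2: "(q' - c)\<^sup>2 \<le> 2 * (q - c)\<^sup>2 + 2 * (q - q')\<^sup>2"
      using zero_le_power2[of "(q - c) + (q - q')"] by (simp add: power2_eq_square algebra_simps)
    have "(q' - c)\<^sup>2 \<le> 2 * l\<^sup>2 * (L\<^sup>2 + (q - c)\<^sup>2 / l\<^sup>2)"
    proof -
      have "2 * l\<^sup>2 * (L\<^sup>2 + (q - c)\<^sup>2 / l\<^sup>2) = 2 * (L\<^sup>2 * l\<^sup>2) + 2 * (q - c)\<^sup>2"
        using l by (simp add: distrib_left)
      thus ?thesis using q1 q2 by (simp add: power_mult_distrib)
    qed
    thus ?thesis using l by (simp add: pos_divide_le_eq mult.commute)
  qed
  ultimately show ?thesis by (simp flip: exp_add)
qed

text \<open>Allows the Frostman weights in the large sieve to be replaced by a smooth function whose Fourier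
  transform is explicit.\<close>
lemma shell_majorant:
  assumes pos: "1 \<le> R" "1 \<le> T" "0 < K" "0 < \<alpha>"
  obtains C where "0 < C"
    "\<And>l \<delta> k h r0 t c Py my Pz mz (G :: ('a::euclidean_space \<times> 'a) set) Z.
      0 < \<delta> \<Longrightarrow> \<delta> \<le> l \<Longrightarrow> l \<le> 1 \<Longrightarrow> r0 \<le> \<delta> \<Longrightarrow> 0 < t \<Longrightarrow> t \<le> T \<Longrightarrow> 1 \<le> k \<Longrightarrow>
      0 < h \<Longrightarrow> h \<le> l \<Longrightarrow> k * h\<^sup>2 \<le> 1 \<Longrightarrow>
      frostman \<alpha> K r0 Py my \<Longrightarrow> frostman \<alpha> K r0 Pz mz \<Longrightarrow> Py \<subseteq> cball 0 R \<Longrightarrow> Pz \<subseteq> cball 0 R \<Longrightarrow> finite G \<Longrightarrow>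
      (\<And>y z. y \<in> Py \<Longrightarrow> z \<in> Pz \<Longrightarrow> \<exists>g\<in>G. k * (norm ((y, z - y) - g))\<^sup>2 \<le> 1) \<Longrightarrow>
      (\<Sum>j | j \<in> Py \<times> Pz \<and> (fst j, snd j - fst j) \<in> cbox (Z - h *\<^sub>R One) (Z + h *\<^sub>R One).
         my (fst j) * mz (snd j) * exp (- (t\<^sup>2 * (norm (snd j - fst j))\<^sup>2 - c)\<^sup>2 / \<delta>\<^sup>2))
      \<le> C * l powr (2 * \<alpha>) * (\<Sum>g\<in>G. shell k t c l g Z)"
proof -
  define d where "d = real DIM('a)"
  have d: "1 \<le> d" by (simp add: d_def Suc_leI)
  \<comment> \<open>\<open>L * l\<close> bounds the variation of
    \<open>t\<^sup>2 * |p|\<^sup>2\<close> on a box of half-side \<open>h \<le> l\<close>: pairs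
    have dimension \<open>2 * d\<close>, so points move by at most \<open>2 * d * l\<close>, and
    \<open>4 * R + 2 * d\<close> bounds the sum of the two norms.\<close>
  define L where "L = T\<^sup>2 * (2 * d) * (4 * R + 2 * d)"
  define E where "E = exp (L\<^sup>2) * exp ((1 + 2 * d)\<^sup>2 * 2)"
  define C where "C = E * (K * (2 * d) powr \<alpha>) * (K * (4 * d) powr \<alpha>)"
  have C: "0 < C" using pos d by (simp add: C_def E_def)
  show ?thesis
  proof (rule that[OF C])
    fix l \<delta> k h r0 t c :: real and Py Pz :: "'a set" and my mz and G :: "('a \<times> 'a) set" and Z :: "'a \<times> 'a"
    assume l: "0 < \<delta>" "\<delta> \<le> l" "l \<le> 1" and r0: "r0 \<le> \<delta>" and t: "0 < t" "t \<le> T" and k: "1 \<le> k"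
      and h: "0 < h" "h \<le> l" "k * h\<^sup>2 \<le> 1"
      and F: "frostman \<alpha> K r0 Py my" "frostman \<alpha> K r0 Pz mz" and sub: "Py \<subseteq> cball 0 R" "Pz \<subseteq> cball 0 R"
      and G: "finite G" "\<And>y z. y \<in> Py \<Longrightarrow> z \<in> Pz \<Longrightarrow> \<exists>g\<in>G. k * (norm ((y, z - y) - g))\<^sup>2 \<le> 1"
    let ?B = "cbox (Z - h *\<^sub>R One) (Z + h *\<^sub>R One)"
    define N where "N j \<longleftrightarrow> (fst j, snd j - fst j) \<in> ?B" for j :: "'a \<times> 'a"
    define Q where "Q = (\<Sum>g\<in>G. shell k t c l g Z)"
    have Q0: "0 \<le> Q" by (auto simp: Q_def shell_def intro: sum_nonneg)
    have my: "\<And>y. y \<in> Py \<Longrightarrow> 0 \<le> my y" "\<And>z. z \<in> Pz \<Longrightarrow> 0 \<le> mz z" using F by (auto simp: frostman_def)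
    have near: "norm ((y, z - y) - Z) \<le> 2 * d * h" if "N (y, z)" for y z
      using norm_le_of_mem_cbox[of "(y, z - y)" Z h] that by (simp add: N_def d_def)
    have near1: "norm (y - fst Z) \<le> 2 * d * h" "norm (z - y - snd Z) \<le> 2 * d * h" if "N (y, z)" for y z
    proof -
      have "(y, z - y) - Z = (y - fst Z, z - y - snd Z)" by (cases Z) simp
      thus "norm (y - fst Z) \<le> 2 * d * h" "norm (z - y - snd Z) \<le> 2 * d * h"
        using near[OF that] norm_fst_le[of "y - fst Z" "z - y - snd Z"] norm_snd_le[of "z - y - snd Z" "y - fst Z"]
        by auto
    qed
    have bound: "exp (- (t\<^sup>2 * (norm (z - y))\<^sup>2 - c)\<^sup>2 / \<delta>\<^sup>2) \<le> E * Q" if y: "y \<in> Py" and z: "z \<in> Pz" and n: "N (y, z)" for y z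
    proof -
      obtain g where g: "g \<in> G" "k * (norm ((y, z - y) - g))\<^sup>2 \<le> 1" using G(2)[OF y z] by blast
      have "(norm (Z - g))\<^sup>2 \<le> (norm ((y, z - y) - Z) + norm ((y, z - y) - g))\<^sup>2"
        by (intro power_mono) (auto intro: norm_triangle_ineq4[of "(y, z - y) - g" "(y, z - y) - Z", simplified, THEN order.trans])
      also have "\<dots> \<le> 2 * (norm ((y, z - y) - Z))\<^sup>2 + 2 * (norm ((y, z - y) - g))\<^sup>2"
        using sum_squares_bound[of "norm ((y, z - y) - Z)" "norm ((y, z - y) - g)"] by (simp add: power2_sum)
      finally have "k * (norm (Z - g))\<^sup>2 \<le> k * (2 * (norm ((y, z - y) - Z))\<^sup>2 + 2 * (norm ((y, z - y) - g))\<^sup>2)"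
        using k by (intro mult_left_mono) auto
      moreover have "k * (norm ((y, z - y) - Z))\<^sup>2 \<le> (2 * d)\<^sup>2"
      proof -
        have "(norm ((y, z - y) - Z))\<^sup>2 \<le> (2 * d * h)\<^sup>2" using near[OF n] by (intro power_mono) auto
        hence "k * (norm ((y, z - y) - Z))\<^sup>2 \<le> (2 * d)\<^sup>2 * (k * h\<^sup>2)"
          using mult_left_mono[of _ _ k] k by (fastforce simp: power_mult_distrib mult_ac)
        also have "\<dots> \<le> (2 * d)\<^sup>2 * 1" using h by (intro mult_left_mono) auto
        finally show ?thesis by simp
      qed
      ultimately have "k * (norm (Z - g))\<^sup>2 \<le> 2 * (2 * d)\<^sup>2 + 2" using g(2) by (simp add: algebra_simps)
      also have "\<dots> \<le> (1 + 2 * d)\<^sup>2 * 2" using d by (simp add: power2_eq_square algebra_simps)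
      finally have 1: "1 \<le> exp ((1 + 2 * d)\<^sup>2 * 2) * exp (- k * (norm (Z - g))\<^sup>2)" by (simp flip: exp_add)
      define p where "p = z - y"
      have p: "norm p \<le> 2 * R" using norm_triangle_ineq4[of z y] y z sub by (force simp: p_def)
      have pZ: "norm (p - snd Z) \<le> 2 * d * h" using near1[OF n] by (simp add: p_def)
      have dh: "2 * d * h \<le> 2 * d * l" "2 * d * h \<le> 2 * d" using h l d by auto
      have nZ: "norm (snd Z) \<le> 2 * R + 2 * d"
        using norm_triangle_ineq4[of p "p - snd Z"] p pZ dh by simp
      have "\<bar>(norm p)\<^sup>2 - (norm (snd Z))\<^sup>2\<bar> = \<bar>norm p - norm (snd Z)\<bar> * (norm p + norm (snd Z))"
      proof -
        have "(norm p)\<^sup>2 - (norm (snd Z))\<^sup>2 = (norm p - norm (snd Z)) * (norm p + norm (snd Z))"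
          by (simp add: power2_eq_square algebra_simps)
        thus ?thesis by (simp add: abs_mult)
      qed
      also have "\<dots> \<le> (2 * d * l) * (4 * R + 2 * d)"
        using norm_triangle_ineq3[of p "snd Z"] p pZ dh nZ by (intro mult_mono) auto
      finally have tp: "t\<^sup>2 * \<bar>(norm p)\<^sup>2 - (norm (snd Z))\<^sup>2\<bar> \<le> T\<^sup>2 * ((2 * d * l) * (4 * R + 2 * d))"
        using t by (intro mult_mono power_mono) auto
      hence "\<bar>t\<^sup>2 * (norm p)\<^sup>2 - t\<^sup>2 * (norm (snd Z))\<^sup>2\<bar> \<le> L * l"
      proof -
        have "\<bar>t\<^sup>2 * (norm p)\<^sup>2 - t\<^sup>2 * (norm (snd Z))\<^sup>2\<bar> = t\<^sup>2 * \<bar>(norm p)\<^sup>2 - (norm (snd Z))\<^sup>2\<bar>"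
          by (simp add: abs_mult flip: right_diff_distrib)
        moreover have "T\<^sup>2 * ((2 * d * l) * (4 * R + 2 * d)) = L * l" by (simp add: L_def)
        ultimately show ?thesis using tp by linarith
      qed
      hence "exp (- (t\<^sup>2 * (norm p)\<^sup>2 - c)\<^sup>2 / \<delta>\<^sup>2) \<le> exp (L\<^sup>2) * exp (- (t\<^sup>2 * (norm (snd Z))\<^sup>2 - c)\<^sup>2 / (2 * l\<^sup>2))"
        by (intro thin_gaussian_shift[OF l(1,2)])
      also have "\<dots> = (exp (L\<^sup>2) * exp (- (t\<^sup>2 * (norm (snd Z))\<^sup>2 - c)\<^sup>2 / (2 * l\<^sup>2))) * 1" by simp
      also have "\<dots> \<le> (exp (L\<^sup>2) * exp (- (t\<^sup>2 * (norm (snd Z))\<^sup>2 - c)\<^sup>2 / (2 * l\<^sup>2))) * (exp ((1 + 2 * d)\<^sup>2 * 2) * exp (- k * (norm (Z - g))\<^sup>2))"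
        using 1 by (intro mult_left_mono) auto
      also have "\<dots> = E * shell k t c l g Z" by (simp add: E_def shell_def)
      also have "\<dots> \<le> E * Q" unfolding Q_def E_def
        using G(1) g(1) by (intro mult_left_mono member_le_sum) (auto simp: shell_def)
      finally show ?thesis by (simp add: p_def)
    qed
    have "(\<Sum>j | j \<in> Py \<times> Pz \<and> N j. my (fst j) * mz (snd j) * exp (- (t\<^sup>2 * (norm (snd j - fst j))\<^sup>2 - c)\<^sup>2 / \<delta>\<^sup>2))
      \<le> (\<Sum>j | j \<in> Py \<times> Pz \<and> N j. my (fst j) * mz (snd j) * (E * Q))"
      using my bound by (intro sum_mono mult_left_mono) auto
    also have "\<dots> = (\<Sum>j | j \<in> Py \<times> Pz \<and> N j. my (fst j) * mz (snd j)) * (E * Q)" by (simp add: sum_distrib_right)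
    \<comment> \<open>The box determines \<open>y\<close>, and it determines \<open>z\<close> as the
      sum of \<open>y\<close> and \<open>z - y\<close>, hence with twice the error.\<close>
    also have "\<dots> \<le> ((K * (2 * d * l) powr \<alpha>) * (K * (4 * d * l) powr \<alpha>)) * (E * Q)"
    proof (intro mult_right_mono frostman_product_le[OF F])
      have "1 * l \<le> 2 * d * l" "1 * l \<le> 4 * d * l" using d l by (intro mult_right_mono; simp)+
      thus "r0 \<le> 2 * d * l" "r0 \<le> 4 * d * l" using r0 l by linarith+
      fix y z assume "N (y, z)"
      note n = near1[OF this]
      have dh: "2 * d * h \<le> 2 * d * l" using h d by auto
      have "norm (z - (fst Z + snd Z)) \<le> norm (z - y - snd Z) + norm (y - fst Z)"
        using norm_triangle_ineq[of "z - y - snd Z" "y - fst Z"] by (simp add: algebra_simps)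
      thus "dist (fst Z) y \<le> 2 * d * l \<and> dist (fst Z + snd Z) z \<le> 4 * d * l"
        using n dh by (auto simp: dist_norm norm_minus_commute)
    qed (use pos Q0 in \<open>auto simp: E_def\<close>)
    also have "\<dots> = C * l powr (2 * \<alpha>) * Q"
    proof -
      have "l powr (2 * \<alpha>) = l powr \<alpha> * l powr \<alpha>" by (simp flip: powr_add)
      thus ?thesis using l d by (simp add: C_def powr_mult mult_ac)
    qed
    finally show "(\<Sum>j | j \<in> Py \<times> Pz \<and> (fst j, snd j - fst j) \<in> ?B.
         my (fst j) * mz (snd j) * exp (- (t\<^sup>2 * (norm (snd j - fst j))\<^sup>2 - c)\<^sup>2 / \<delta>\<^sup>2))
      \<le> C * l powr (2 * \<alpha>) * (\<Sum>g\<in>G. shell k t c l g Z)"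
      by (simp add: N_def Q_def)
  qed
qed

text \<open>The standing hypotheses of the bilinear estimate. The four point sets carry Frostman weights,
  \<open>\<gamma>\<close> measures transversality of \<open>z - y\<close> and \<open>x - w\<close>, and \<open>\<sigma>\<close> the distance of \<open>s\<close> to \<open>1\<close>.\<close>
definition admissible :: "real \<Rightarrow> real \<Rightarrow> real \<Rightarrow> real \<Rightarrow> real \<Rightarrow> real \<Rightarrow> real \<Rightarrow> real \<Rightarrow> real \<Rightarrow> real \<Rightarrow>
    'a::euclidean_space set \<Rightarrow> ('a \<Rightarrow> real) \<Rightarrow> 'a set \<Rightarrow> ('a \<Rightarrow> real) \<Rightarrow> 'a set \<Rightarrow> ('a \<Rightarrow> real) \<Rightarrow> 'a set \<Rightarrow> ('a \<Rightarrow> real) \<Rightarrow> bool" where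
  "admissible R \<gamma> \<sigma> t1 T \<alpha> K r0 s t Px mx Py my Pz mz Pw mw \<longleftrightarrow>
     frostman \<alpha> K r0 Px mx \<and> frostman \<alpha> K r0 Py my \<and> frostman \<alpha> K r0 Pz mz \<and> frostman \<alpha> K r0 Pw mw \<and>
     Px \<subseteq> cball 0 R \<and> Py \<subseteq> cball 0 R \<and> Pz \<subseteq> cball 0 R \<and> Pw \<subseteq> cball 0 R \<and>
     t1 \<le> s \<and> s \<le> T \<and> t1 \<le> t \<and> t \<le> T \<and> \<sigma> \<le> \<bar>s\<^sup>2 - 1\<bar> \<and>
     (\<forall>x\<in>Px. \<forall>x'\<in>Px. \<forall>w\<in>Pw. \<forall>w'\<in>Pw. \<forall>y\<in>Py. \<forall>z\<in>Pz. \<gamma> \<le> \<bar>(z - y) \<bullet> ((x - w) + (x' - w'))\<bar>)"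

lemma norm_vec_Pair_le:
  "\<bar>(u, v) \<bullet> b\<bar> \<le> norm u + norm v" if "b \<in> Basis" for u :: "'a::euclidean_space" and v :: "'b::euclidean_space"
  using Basis_le_norm[OF that, of "(u, v)"] norm_Pair_le[of u v] by linarith

text \<open>The \<open>(x, w)\<close>-dependent frequency of the phase \<open>\<tau> (|x-y|\<^sup>2 - s\<^sup>2 |z-w|\<^sup>2)\<close> in the variable \<open>(y, z - y)\<close>.\<close>
definition freq :: "real \<Rightarrow> real \<Rightarrow> 'a::euclidean_space \<times> 'a \<Rightarrow> 'a \<times> 'a" where
  "freq \<tau> s i = ((-2 * \<tau>) *\<^sub>R (fst i - s\<^sup>2 *\<^sub>R snd i), (2 * \<tau> * s\<^sup>2) *\<^sub>R snd i)"

lemma freq_diff: "freq \<tau> s i - freq \<tau> s i' =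
  ((-2 * \<tau>) *\<^sub>R ((fst i - fst i') - s\<^sup>2 *\<^sub>R (snd i - snd i')), (2 * \<tau> * s\<^sup>2) *\<^sub>R (snd i - snd i'))"
  by (simp add: freq_def algebra_simps)

lemma freq_inner: "freq \<tau> s (x, w) \<bullet> (y, z - y) = -2 * \<tau> * (x \<bullet> y - s\<^sup>2 * (w \<bullet> z))"
  by (simp add: freq_def inner_diff_left inner_diff_right algebra_simps)

text \<open>Serves both pairs: \<open>(x, w)\<close> with \<open>t = 1\<close>, and
  \<open>(y, z)\<close> with the parameter \<open>t\<close>. The denominator \<open>e\<close> is a
  parameter because \<open>\<delta>\<^sup>2\<close> and \<open>2 * \<delta>\<^sup>2\<close> both
  occur.\<close>

definition agauss :: "('a::euclidean_space \<Rightarrow> real) \<Rightarrow> ('a \<Rightarrow> real) \<Rightarrow> real \<Rightarrow> real \<Rightarrow> real \<Rightarrow> 'a \<times> 'a \<Rightarrow> real" where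
  "agauss m n t c e j = m (fst j) * n (snd j) * exp (- (t\<^sup>2 * (norm (snd j - fst j))\<^sup>2 - c)\<^sup>2 / e)"

text \<open>Far pairs are negligible against any power of \<open>l\<close>; near pairs have Frostman
  mass \<open>l powr (2 * \<alpha> * (1 - 2 * \<mu>))\<close> and carry the thickness
  \<open>l powr (1 - \<mu>)\<close>. The sum over \<open>(x, w)\<close> on the right keeps its
  Gaussian about \<open>c\<close>, since integrating it over \<open>c\<close> must later produce a
  factor \<open>\<delta>\<close>.\<close>

lemma kernel_sum:
  assumes d: "2 \<le> DIM('a::euclidean_space)"
    and pos: "1 \<le> R" "0 < \<gamma>" "0 < \<sigma>" "0 < t1" "1 \<le> T" "0 < \<alpha>" "0 < K" and \<mu>: "0 < \<mu>"
  obtains C where "0 < C"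
    "\<And>l \<delta> \<tau> s t c r0 (Px :: 'a set) mx Py my Pz mz Pw mw G.
      admissible R \<gamma> \<sigma> t1 T \<alpha> K r0 s t Px mx Py my Pz mz Pw mw \<Longrightarrow>
      r0 \<le> \<delta> \<Longrightarrow> 0 < \<delta> \<Longrightarrow> \<delta> \<le> l \<Longrightarrow> l \<le> 1 \<Longrightarrow> 1 / l \<le> \<bar>\<tau>\<bar> \<Longrightarrow> finite G \<Longrightarrow>
      G \<subseteq> (\<lambda>j. (fst j, snd j - fst j)) ` (Py \<times> Pz) \<Longrightarrow>
      (\<Sum>i\<in>Px \<times> Pw. \<Sum>i'\<in>Px \<times> Pw. agauss mx mw 1 c (\<delta>\<^sup>2) i * agauss mx mw 1 c (\<delta>\<^sup>2) i' *
          (\<Sum>g\<in>G. norm (shell_ft (l powr (-\<mu>)) t c l g (freq \<tau> s i - freq \<tau> s i'))))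
      \<le> C * real (card G) * l powr (1 - \<mu> + 2 * \<alpha> * (1 - 2 * \<mu>)) * (\<Sum>i\<in>Px \<times> Pw. agauss mx mw 1 c (2 * \<delta>\<^sup>2) i)"
proof -
  obtain C0 c0 C1 where C0: "0 < C0" "0 < c0" "1 \<le> C1" and ker:
    "\<And>l \<delta> \<tau> s t c (x::'a) w x' w' y z. 0 < \<delta> \<Longrightarrow> \<delta> \<le> l \<Longrightarrow> l \<le> 1 \<Longrightarrow> 1 / l \<le> \<bar>\<tau>\<bar> \<Longrightarrow>
      t1 \<le> s \<Longrightarrow> s \<le> T \<Longrightarrow> \<sigma> \<le> \<bar>s\<^sup>2 - 1\<bar> \<Longrightarrow> t1 \<le> t \<Longrightarrow> t \<le> T \<Longrightarrow>
      norm x \<le> R \<Longrightarrow> norm x' \<le> R \<Longrightarrow> norm w \<le> R \<Longrightarrow> norm w' \<le> R \<Longrightarrow> norm y \<le> R \<Longrightarrow> norm z \<le> R \<Longrightarrow>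
      \<gamma> \<le> \<bar>(z - y) \<bullet> ((x - w) + (x' - w'))\<bar> \<Longrightarrow>
      exp (- ((norm (x - w))\<^sup>2 - c)\<^sup>2 / \<delta>\<^sup>2) * exp (- ((norm (x' - w'))\<^sup>2 - c)\<^sup>2 / \<delta>\<^sup>2) *
        norm (shell_ft (l powr (-\<mu>)) t c l (y, z - y) ((-2 * \<tau>) *\<^sub>R ((x - x') - s\<^sup>2 *\<^sub>R (w - w')), (2 * \<tau> * s\<^sup>2) *\<^sub>R (w - w')))
      \<le> exp (- ((norm (x - w))\<^sup>2 - c)\<^sup>2 / (2 * \<delta>\<^sup>2)) * (C0 * exp (- c0 * l powr (-\<mu>)) +
          (if norm (x - x') \<le> C1 * l powr (1 - 2 * \<mu>) \<and> norm (w - w') \<le> C1 * l powr (1 - 2 * \<mu>) then C0 * l powr (1 - \<mu>) else 0))"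
  proof (rule kernel_estimate[OF d pos(1-5) \<mu>], goal_cases)
    case (1 C c0 C1)
    show ?case by (rule that[OF 1(2-4)]) (rule 1(5); assumption)
  qed
  obtain C2 where C2: "0 < C2" "\<And>l. 0 < l \<Longrightarrow> exp (- c0 * l powr (-\<mu>)) \<le> C2 * l powr (1 + 2 * \<alpha>)"
  proof (rule exp_neg_le_powr[OF C0(2) \<mu>, of "1 + 2 * \<alpha>"], goal_cases)
    case (2 C)
    show ?case by (rule 2(1)[OF 2(2)]) (rule 2(3))
  qed (use pos in simp)
  define M where "M = K * R powr \<alpha>"
  have M: "0 < M" using pos by (simp add: M_def)
  define C where "C = C0 * C2 * M\<^sup>2 + C0 * (K * C1 powr \<alpha>)\<^sup>2"
  have C: "0 < C" unfolding C_def using C0(1) C2(1) M by (intro add_pos_nonneg mult_pos_pos mult_nonneg_nonneg) auto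
  show ?thesis
  proof (rule that[OF C])
    fix l \<delta> \<tau> s t c r0 :: real and Px Py Pz Pw :: "'a set" and mx my mz mw and G :: "('a \<times> 'a) set"
    assume adm: "admissible R \<gamma> \<sigma> t1 T \<alpha> K r0 s t Px mx Py my Pz mz Pw mw"
      and r0: "r0 \<le> \<delta>" and l: "0 < \<delta>" "\<delta> \<le> l" "l \<le> 1" and \<tau>: "1 / l \<le> \<bar>\<tau>\<bar>" and G: "finite G"
      "G \<subseteq> (\<lambda>j. (fst j, snd j - fst j)) ` (Py \<times> Pz)"
    have l0: "0 < l" using l by simp
    define I where "I = Px \<times> Pw"
    have F: "frostman \<alpha> K r0 Px mx" "frostman \<alpha> K r0 Pw mw" and sub: "Px \<subseteq> cball 0 R" "Pw \<subseteq> cball 0 R"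
      using adm by (auto simp: admissible_def)
    have fin: "finite Px" "finite Pw" "finite I" using F by (auto simp: frostman_def I_def)
    have nn: "\<And>x. x \<in> Px \<Longrightarrow> 0 \<le> mx x" "\<And>w. w \<in> Pw \<Longrightarrow> 0 \<le> mw w" using F by (auto simp: frostman_def)
    define near where "near i i' \<longleftrightarrow> norm (fst i - fst i') \<le> C1 * l powr (1 - 2 * \<mu>) \<and> norm (snd i - snd i') \<le> C1 * l powr (1 - 2 * \<mu>)" for i i' :: "'a \<times> 'a"
    define X where "X i i' = C0 * exp (- c0 * l powr (-\<mu>)) + (if near i i' then C0 * l powr (1 - \<mu>) else 0)" for i i'
    define e where "e = 1 - \<mu> + 2 * \<alpha> * (1 - 2 * \<mu>)"
    have bound: "agauss mx mw 1 c (\<delta>\<^sup>2) i * agauss mx mw 1 c (\<delta>\<^sup>2) i' *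
          (\<Sum>g\<in>G. norm (shell_ft (l powr (-\<mu>)) t c l g (freq \<tau> s i - freq \<tau> s i')))
        \<le> real (card G) * (agauss mx mw 1 c (2 * \<delta>\<^sup>2) i * (mx (fst i') * mw (snd i') * X i i'))" (is "?lhs \<le> _") if i: "i \<in> I" "i' \<in> I" for i i'
    proof -
      obtain x w x' w' where ii: "i = (x, w)" "i' = (x', w')" by (metis surj_pair)
      have P: "x \<in> Px" "w \<in> Pw" "x' \<in> Px" "w' \<in> Pw" using i by (auto simp: ii I_def)
      let ?m = "mx x * mw w * (mx x' * mw w')"
      let ?E = "exp (- ((norm (x - w))\<^sup>2 - c)\<^sup>2 / \<delta>\<^sup>2) * exp (- ((norm (x' - w'))\<^sup>2 - c)\<^sup>2 / \<delta>\<^sup>2)"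
      have "?E * norm (shell_ft (l powr (-\<mu>)) t c l g (freq \<tau> s i - freq \<tau> s i')) \<le> exp (- ((norm (x - w))\<^sup>2 - c)\<^sup>2 / (2 * \<delta>\<^sup>2)) * X i i'"
        if gG: "g \<in> G" for g
      proof -
        obtain y z where g: "g = (y, z - y)" "y \<in> Py" "z \<in> Pz" using G(2) gG by auto
        show ?thesis
          unfolding g(1) freq_diff X_def near_def ii fst_conv snd_conv
          by (rule ker[OF l \<tau>]) (use adm P g(2,3) in \<open>auto simp: admissible_def subset_iff\<close>)
      qed
      hence "(\<Sum>g\<in>G. ?E * norm (shell_ft (l powr (-\<mu>)) t c l g (freq \<tau> s i - freq \<tau> s i'))) \<le> (\<Sum>g\<in>G. exp (- ((norm (x - w))\<^sup>2 - c)\<^sup>2 / (2 * \<delta>\<^sup>2)) * X i i')"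
        by (rule sum_mono)
      hence "?E * (\<Sum>g\<in>G. norm (shell_ft (l powr (-\<mu>)) t c l g (freq \<tau> s i - freq \<tau> s i'))) \<le> real (card G) * (exp (- ((norm (x - w))\<^sup>2 - c)\<^sup>2 / (2 * \<delta>\<^sup>2)) * X i i')"
        unfolding sum_distrib_left[symmetric] by (simp add: mult.left_commute)
      hence "?m * (?E * (\<Sum>g\<in>G. norm (shell_ft (l powr (-\<mu>)) t c l g (freq \<tau> s i - freq \<tau> s i')))) \<le> ?m * (real (card G) * (exp (- ((norm (x - w))\<^sup>2 - c)\<^sup>2 / (2 * \<delta>\<^sup>2)) * X i i'))"
        using P nn by (intro mult_left_mono) auto
      moreover have "?lhs = ?m * (?E * (\<Sum>g\<in>G. norm (shell_ft (l powr (-\<mu>)) t c l g (freq \<tau> s i - freq \<tau> s i'))))"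
        by (simp add: agauss_def ii norm_minus_commute[of w x] norm_minus_commute[of w' x'])
      moreover have "?m * (real (card G) * (exp (- ((norm (x - w))\<^sup>2 - c)\<^sup>2 / (2 * \<delta>\<^sup>2)) * X i i')) =
          real (card G) * (agauss mx mw 1 c (2 * \<delta>\<^sup>2) i * (mx (fst i') * mw (snd i') * X i i'))"
        by (simp add: agauss_def ii norm_minus_commute[of w x])
      ultimately show ?thesis by linarith
    qed
    have inner: "(\<Sum>i'\<in>I. mx (fst i') * mw (snd i') * X i i') \<le> C * l powr e" if i: "i \<in> I" for i
    proof -
      have "(\<Sum>i'\<in>I. mx (fst i') * mw (snd i') * X i i') =
         (\<Sum>i'\<in>I. mx (fst i') * mw (snd i')) * (C0 * exp (- c0 * l powr (-\<mu>))) +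
         (\<Sum>i' | i' \<in> Px \<times> Pw \<and> near i i'. mx (fst i') * mw (snd i')) * (C0 * l powr (1 - \<mu>))"
      proof -
        have "mx (fst i') * mw (snd i') * X i i' = mx (fst i') * mw (snd i') * (C0 * exp (- c0 * l powr (-\<mu>))) +
           (if near i i' then mx (fst i') * mw (snd i') * (C0 * l powr (1 - \<mu>)) else 0)" for i'
          by (simp add: X_def distrib_left)
        thus ?thesis
          by (simp only: sum.distrib sum.inter_filter[OF fin(3), symmetric] sum_distrib_right I_def[symmetric])
      qed
      also have "(\<Sum>i'\<in>I. mx (fst i') * mw (snd i')) = sum mx Px * sum mw Pw"
        by (simp add: I_def sum_product sum.cartesian_product split_beta)
      also have "sum mx Px * sum mw Pw * (C0 * exp (- c0 * l powr (-\<mu>))) \<le> (M * M) * (C0 * (C2 * l powr e))"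
      proof (intro mult_mono)
        have "r0 \<le> R" using r0 l pos by linarith
        thus "sum mx Px \<le> M" "sum mw Pw \<le> M" unfolding M_def using F sub by (intro frostman_total_le; simp)+
        have "l powr (1 + 2 * \<alpha>) \<le> l powr e"
          using l l0 \<mu> pos by (intro powr_mono') (auto simp: e_def algebra_simps)
        hence "C2 * l powr (1 + 2 * \<alpha>) \<le> C2 * l powr e" using C2(1) by (intro mult_left_mono) auto
        thus "exp (- c0 * l powr (-\<mu>)) \<le> C2 * l powr e" using C2(2)[OF l0] by linarith
      qed (use M nn C0 in \<open>auto intro: sum_nonneg\<close>)
      also have "(\<Sum>i' | i' \<in> Px \<times> Pw \<and> near i i'. mx (fst i') * mw (snd i')) * (C0 * l powr (1 - \<mu>)) \<le>
          ((K * (C1 * l powr (1 - 2 * \<mu>)) powr \<alpha>) * (K * (C1 * l powr (1 - 2 * \<mu>)) powr \<alpha>)) * (C0 * l powr (1 - \<mu>))"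
      proof (intro mult_right_mono frostman_product_le[OF F])
        have "l powr 1 \<le> l powr (1 - 2 * \<mu>)" using l l0 \<mu> by (intro powr_mono') auto
        hence "l \<le> l powr (1 - 2 * \<mu>)" using l0 by simp
        moreover have "1 * l powr (1 - 2 * \<mu>) \<le> C1 * l powr (1 - 2 * \<mu>)" using C0 by (intro mult_right_mono) auto
        ultimately show "r0 \<le> C1 * l powr (1 - 2 * \<mu>)" "r0 \<le> C1 * l powr (1 - 2 * \<mu>)" using l r0 by linarith+
      qed (use pos C0 in \<open>auto simp: near_def dist_norm\<close>)
      also have "((K * (C1 * l powr (1 - 2 * \<mu>)) powr \<alpha>) * (K * (C1 * l powr (1 - 2 * \<mu>)) powr \<alpha>)) * (C0 * l powr (1 - \<mu>))
         = C0 * (K * C1 powr \<alpha>)\<^sup>2 * l powr e"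
      proof -
        have "l powr e = l powr (1 - \<mu>) * (l powr ((1 - 2 * \<mu>) * \<alpha>) * l powr ((1 - 2 * \<mu>) * \<alpha>))"
          unfolding powr_add[symmetric] by (rule arg_cong[of _ _ "(powr) l"]) (simp add: e_def algebra_simps)
        thus ?thesis using C0 l0 by (simp add: powr_mult powr_powr power2_eq_square mult_ac)
      qed
      finally show ?thesis by (simp add: C_def power2_eq_square algebra_simps)
    qed
    have "(\<Sum>i\<in>I. \<Sum>i'\<in>I. agauss mx mw 1 c (\<delta>\<^sup>2) i * agauss mx mw 1 c (\<delta>\<^sup>2) i' *
          (\<Sum>g\<in>G. norm (shell_ft (l powr (-\<mu>)) t c l g (freq \<tau> s i - freq \<tau> s i'))))
       \<le> (\<Sum>i\<in>I. \<Sum>i'\<in>I. real (card G) * (agauss mx mw 1 c (2 * \<delta>\<^sup>2) i * (mx (fst i') * mw (snd i') * X i i')))"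
      by (intro sum_mono bound)
    also have "\<dots> = (\<Sum>i\<in>I. real (card G) * (agauss mx mw 1 c (2 * \<delta>\<^sup>2) i * (\<Sum>i'\<in>I. mx (fst i') * mw (snd i') * X i i')))"
      by (simp add: sum_distrib_left)
    also have "\<dots> \<le> (\<Sum>i\<in>I. real (card G) * (agauss mx mw 1 c (2 * \<delta>\<^sup>2) i * (C * l powr e)))"
      using inner nn by (intro sum_mono mult_left_mono) (auto simp: agauss_def I_def)
    also have "\<dots> = C * real (card G) * l powr e * (\<Sum>i\<in>I. agauss mx mw 1 c (2 * \<delta>\<^sup>2) i)"
      by (simp add: sum_distrib_left mult_ac)
    finally show "(\<Sum>i\<in>Px \<times> Pw. \<Sum>i'\<in>Px \<times> Pw. agauss mx mw 1 c (\<delta>\<^sup>2) i * agauss mx mw 1 c (\<delta>\<^sup>2) i' *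
          (\<Sum>g\<in>G. norm (shell_ft (l powr (-\<mu>)) t c l g (freq \<tau> s i - freq \<tau> s i'))))
      \<le> C * real (card G) * l powr (1 - \<mu> + 2 * \<alpha> * (1 - 2 * \<mu>)) * (\<Sum>i\<in>Px \<times> Pw. agauss mx mw 1 c (2 * \<delta>\<^sup>2) i)"
      by (simp add: I_def e_def)
  qed
qed

lemma weighted_Cauchy_Schwarz_sum:
  fixes b f :: "'j \<Rightarrow> real"
  assumes "\<And>j. j \<in> J \<Longrightarrow> 0 \<le> b j"
  shows "(\<Sum>j\<in>J. b j * f j)\<^sup>2 \<le> (\<Sum>j\<in>J. b j) * (\<Sum>j\<in>J. b j * (f j)\<^sup>2)"
proof -
  have "(\<Sum>j\<in>J. sqrt (b j) * (sqrt (b j) * f j))\<^sup>2 \<le> (\<Sum>j\<in>J. (sqrt (b j))\<^sup>2) * (\<Sum>j\<in>J. (sqrt (b j) * f j)\<^sup>2)"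
    by (rule Cauchy_Schwarz_ineq_sum)
  also have "(\<Sum>j\<in>J. sqrt (b j) * (sqrt (b j) * f j)) = (\<Sum>j\<in>J. b j * f j)"
    using assms by (intro sum.cong refl) (simp add: mult.assoc[symmetric])
  finally show ?thesis using assms by (simp add: power_mult_distrib)
qed

lemma agauss_mono:
  assumes "0 \<le> m (fst j)" "0 \<le> n (snd j)" "0 < e" "e \<le> e'"
  shows "agauss m n t c e j \<le> agauss m n t c e' j"
  using assms unfolding agauss_def
  by (intro mult_left_mono) (auto intro!: divide_left_mono)

text \<open>Cauchy-Schwarz in \<open>(y, z)\<close>, then the large sieve with samples
  \<open>(y, z - y)\<close>, frequencies \<open>freq \<tau> s (x, w)\<close> and a sum of shells as
  majorant. In the condition on \<open>\<mu>\<close>, the losses in powers of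
  \<open>l powr \<mu>\<close> are \<open>2 * d\<close> from the box size \<open>h\<close>,
  \<open>d\<close> from the number of shells, \<open>1\<close> from the thickness and
  \<open>4 * \<alpha>\<close> from the enlarged diagonal, with \<open>d = DIM('a)\<close>; they may
  use up half of the surplus \<open>4 * \<epsilon>\<close>.\<close>

lemma bilinear_bound:
  fixes R \<gamma> \<sigma> t1 T \<alpha> K \<mu> \<epsilon> :: real
  assumes d: "2 \<le> DIM('a::euclidean_space)"
    and pos: "1 \<le> R" "0 < \<gamma>" "0 < \<sigma>" "0 < t1" "1 \<le> T" "0 < \<alpha>" "0 < K" and \<mu>: "0 < \<mu>"
    and \<epsilon>: "0 < \<epsilon>" "\<alpha> = DIM('a) / 2 + 3 / 4 + \<epsilon>" "\<mu> * (3 * DIM('a) + 1 + 4 * \<alpha>) \<le> 2 * \<epsilon>"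
  obtains C where "0 < C"
    "\<And>l \<delta> \<tau> s t c r0 (Px :: 'a set) mx Py my Pz mz Pw mw \<phi> \<psi>.
      admissible R \<gamma> \<sigma> t1 T \<alpha> K r0 s t Px mx Py my Pz mz Pw mw \<Longrightarrow>
      r0 \<le> \<delta> \<Longrightarrow> 0 < \<delta> \<Longrightarrow> \<delta> \<le> l \<Longrightarrow> l \<le> 1 \<Longrightarrow> 1 / l \<le> \<bar>\<tau>\<bar> \<Longrightarrow> \<bar>\<tau>\<bar> \<le> l powr (- 1 - \<mu>) \<Longrightarrow>
      norm (\<Sum>i\<in>Px \<times> Pw. \<Sum>j\<in>Py \<times> Pz. (agauss mx mw 1 c (\<delta>\<^sup>2) i * cis (\<phi> i)) * (agauss my mz t c (\<delta>\<^sup>2) j * cis (\<psi> j)) *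
         cis (freq \<tau> s i \<bullet> (fst j, snd j - fst j)))
      \<le> C * l powr (2 + \<epsilon>) * ((\<Sum>i\<in>Px \<times> Pw. agauss mx mw 1 c (2 * \<delta>\<^sup>2) i) + (\<Sum>j\<in>Py \<times> Pz. agauss my mz t c (2 * \<delta>\<^sup>2) j))"
proof -
  define d where "d = real DIM('a)"
  have d1: "1 \<le> d" by (simp add: d_def Suc_leI)
  obtain Ck where Ck: "0 < Ck" and kersum:
    "\<And>l \<delta> \<tau> s t c r0 (Px :: 'a set) mx Py my Pz mz Pw mw G.
      admissible R \<gamma> \<sigma> t1 T \<alpha> K r0 s t Px mx Py my Pz mz Pw mw \<Longrightarrow>
      r0 \<le> \<delta> \<Longrightarrow> 0 < \<delta> \<Longrightarrow> \<delta> \<le> l \<Longrightarrow> l \<le> 1 \<Longrightarrow> 1 / l \<le> \<bar>\<tau>\<bar> \<Longrightarrow> finite G \<Longrightarrow>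
      G \<subseteq> (\<lambda>j. (fst j, snd j - fst j)) ` (Py \<times> Pz) \<Longrightarrow>
      (\<Sum>i\<in>Px \<times> Pw. \<Sum>i'\<in>Px \<times> Pw. agauss mx mw 1 c (\<delta>\<^sup>2) i * agauss mx mw 1 c (\<delta>\<^sup>2) i' *
          (\<Sum>g\<in>G. norm (shell_ft (l powr (-\<mu>)) t c l g (freq \<tau> s i - freq \<tau> s i'))))
      \<le> Ck * real (card G) * l powr (1 - \<mu> + 2 * \<alpha> * (1 - 2 * \<mu>)) * (\<Sum>i\<in>Px \<times> Pw. agauss mx mw 1 c (2 * \<delta>\<^sup>2) i)"
  proof (rule kernel_sum[OF d pos \<mu>], goal_cases)
    case (1 C)
    show ?case by (rule 1(1)[OF 1(2)]) (rule 1(3); assumption)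
  qed
  obtain Cm where Cm: "0 < Cm" and majorant:
    "\<And>l \<delta> k h r0 t c Py my Pz mz (G :: ('a \<times> 'a) set) Z.
      0 < \<delta> \<Longrightarrow> \<delta> \<le> l \<Longrightarrow> l \<le> 1 \<Longrightarrow> r0 \<le> \<delta> \<Longrightarrow> 0 < t \<Longrightarrow> t \<le> T \<Longrightarrow> 1 \<le> k \<Longrightarrow>
      0 < h \<Longrightarrow> h \<le> l \<Longrightarrow> k * h\<^sup>2 \<le> 1 \<Longrightarrow>
      frostman \<alpha> K r0 Py my \<Longrightarrow> frostman \<alpha> K r0 Pz mz \<Longrightarrow> Py \<subseteq> cball 0 R \<Longrightarrow> Pz \<subseteq> cball 0 R \<Longrightarrow> finite G \<Longrightarrow>
      (\<And>y z. y \<in> Py \<Longrightarrow> z \<in> Pz \<Longrightarrow> \<exists>g\<in>G. k * (norm ((y, z - y) - g))\<^sup>2 \<le> 1) \<Longrightarrow>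
      (\<Sum>j | j \<in> Py \<times> Pz \<and> (fst j, snd j - fst j) \<in> cbox (Z - h *\<^sub>R One) (Z + h *\<^sub>R One).
         my (fst j) * mz (snd j) * exp (- (t\<^sup>2 * (norm (snd j - fst j))\<^sup>2 - c)\<^sup>2 / \<delta>\<^sup>2))
      \<le> Cm * l powr (2 * \<alpha>) * (\<Sum>g\<in>G. shell k t c l g Z)"
  proof (rule shell_majorant[where 'a='a, OF pos(1,5,7,6)], goal_cases)
    case (1 C)
    show ?case by (rule 1(1)[OF 1(2)]) (rule 1(3); assumption)
  qed
  \<comment> \<open>\<open>H * |\<tau>|\<close> bounds the coordinates of
    \<open>freq \<tau> s (x, w)\<close>; dividing by \<open>H\<close> in \<open>h\<close> below
    makes the large sieve applicable up to \<open>|\<tau>| = l powr (- 1 - \<mu>)\<close>.\<close>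
  define H where "H = 2 * R * (1 + 2 * T\<^sup>2)"
  have H: "1 \<le> H"
  proof -
    have "1 * 1 \<le> R * (1 + 2 * T\<^sup>2)" using pos by (intro mult_mono) auto
    thus ?thesis by (simp add: H_def)
  qed
  define C5 where "C5 = Cm * (2 * H) ^ (2 * DIM('a)) * Ck * (30 * d * R) ^ (2 * DIM('a))"
  have C5: "0 < C5" using Cm H Ck d1 pos by (simp add: C5_def)
  show ?thesis
  proof (rule that[of "sqrt C5"])
    show "0 < sqrt C5" using C5 by simp
    fix l \<delta> \<tau> s t c r0 :: real and Px Py Pz Pw :: "'a set" and mx my mz mw and \<phi> \<psi> :: "'a \<times> 'a \<Rightarrow> real"
    assume adm: "admissible R \<gamma> \<sigma> t1 T \<alpha> K r0 s t Px mx Py my Pz mz Pw mw"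
      and r0: "r0 \<le> \<delta>" and l: "0 < \<delta>" "\<delta> \<le> l" "l \<le> 1" and \<tau>: "1 / l \<le> \<bar>\<tau>\<bar>" "\<bar>\<tau>\<bar> \<le> l powr (- 1 - \<mu>)"
    have l0: "0 < l" using l by simp
    have F: "frostman \<alpha> K r0 Px mx" "frostman \<alpha> K r0 Py my" "frostman \<alpha> K r0 Pz mz" "frostman \<alpha> K r0 Pw mw"
      and sub: "Px \<subseteq> cball 0 R" "Py \<subseteq> cball 0 R" "Pz \<subseteq> cball 0 R" "Pw \<subseteq> cball 0 R"
      and st: "t1 \<le> s" "s \<le> T" "t1 \<le> t" "t \<le> T"
      using adm by (auto simp: admissible_def)
    define I where "I = Px \<times> Pw"
    define J where "J = Py \<times> Pz"
    have fin: "finite I" "finite J" using F by (auto simp: frostman_def I_def J_def)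
    have nn: "\<And>i. i \<in> I \<Longrightarrow> 0 \<le> mx (fst i) \<and> 0 \<le> mw (snd i)" "\<And>j. j \<in> J \<Longrightarrow> 0 \<le> my (fst j) \<and> 0 \<le> mz (snd j)"
      using F by (auto simp: frostman_def I_def J_def)
    define Y where "Y j = (fst j, snd j - fst j)" for j :: "'a \<times> 'a"
    define a where "a i = agauss mx mw 1 c (\<delta>\<^sup>2) i * cis (\<phi> i)" for i
    define b where "b j = agauss my mz t c (\<delta>\<^sup>2) j" for j
    have na: "norm (a i) = agauss mx mw 1 c (\<delta>\<^sup>2) i" if "i \<in> I" for i
      using nn(1)[OF that] by (simp add: a_def agauss_def norm_mult)
    have b0: "0 \<le> b j" if "j \<in> J" for j using nn(2)[OF that] by (simp add: b_def agauss_def)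
    define A where "A j = (\<Sum>i\<in>I. a i * cis (freq \<tau> s i \<bullet> Y j))" for j
    define asum where "asum = (\<Sum>i\<in>I. agauss mx mw 1 c (2 * \<delta>\<^sup>2) i)"
    define bsum where "bsum = (\<Sum>j\<in>J. agauss my mz t c (2 * \<delta>\<^sup>2) j)"
    have as0: "0 \<le> asum" and bs0: "0 \<le> bsum" using nn by (auto simp: asum_def bsum_def agauss_def intro!: sum_nonneg)
    have bbs: "(\<Sum>j\<in>J. b j) \<le> bsum" unfolding b_def bsum_def using nn(2) l by (intro sum_mono agauss_mono) auto

    \<comment> \<open>\<open>\<rho> = k powr (- 1/2)\<close> is the width of the Gaussian factor of
      a shell, so one net point near each sample suffices; \<open>h\<close> is reciprocal to the
      largest frequency.\<close>
    define k where "k = l powr (-\<mu>)"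
    define h where "h = l powr (1 + \<mu>) / H"
    define \<rho> where "\<rho> = l powr (\<mu> / 2)"
    have k: "1 \<le> k" using l l0 \<mu> by (simp add: k_def powr_minus_divide powr_le1)
    have h0: "0 < h" using l0 H by (simp add: h_def)
    have \<rho>: "0 < \<rho>" "\<rho> \<le> 1" using l l0 \<mu> by (auto simp: \<rho>_def intro: powr_le1)
    have k\<rho>: "k * \<rho>\<^sup>2 = 1" using l0 by (simp add: k_def \<rho>_def power2_eq_square flip: powr_add)
    have hle: "h \<le> l powr (1 + \<mu>)" using H l0 by (simp add: h_def divide_le_eq mult_le_cancel_left1)
    have "l powr (1 + \<mu>) \<le> l powr 1" using l l0 \<mu> by (intro powr_mono') auto
    hence hl: "h \<le> l" using hle l0 by simp
    have h\<rho>: "h \<le> \<rho>" using hle powr_mono'[of "\<mu>/2" "1 + \<mu>" l] l l0 \<mu> by (simp add: \<rho>_def)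
    have kh: "k * h\<^sup>2 \<le> 1"
    proof -
      have "k * h\<^sup>2 \<le> k * \<rho>\<^sup>2" using h\<rho> h0 k by (intro mult_left_mono power_mono) auto
      thus ?thesis by (simp add: k\<rho>)
    qed

    obtain G where G: "G \<subseteq> Y ` J" "finite G" "\<And>x. x \<in> Y ` J \<Longrightarrow> \<exists>g\<in>G. norm (x - g) \<le> \<rho>"
      "real (card G) \<le> (5 * DIM('a \<times> 'a) * (3 * R) / \<rho>) ^ DIM('a \<times> 'a)"
    proof (rule finite_net[of "Y ` J" "3 * R" \<rho>])
      fix x assume "x \<in> Y ` J"
      then obtain y z where x: "x = (y, z - y)" "y \<in> Py" "z \<in> Pz" by (auto simp: Y_def J_def)
      have "norm x \<le> norm y + norm (z - y)" unfolding x(1) by (rule norm_Pair_le)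
      also have "norm (z - y) \<le> norm z + norm y" by (rule norm_triangle_ineq4)
      finally show "norm x \<le> 3 * R" using x sub by fastforce
    qed (use pos \<rho> in auto)
    have cardG: "real (card G) \<le> (30 * d * R) ^ (2 * DIM('a)) * l powr (- (d * \<mu>))"
    proof -
      have base: "real (5 * DIM('a \<times> 'a)) * (3 * R) / \<rho> = (30 * d * R) / \<rho>" by (simp add: d_def)
      have dim: "DIM('a \<times> 'a) = 2 * DIM('a)" by simp
      have "real (card G) \<le> ((30 * d * R) / \<rho>) ^ (2 * DIM('a))" using G(4) unfolding base unfolding dim .
      also have "\<dots> = (30 * d * R) ^ (2 * DIM('a)) * (1 / \<rho> ^ (2 * DIM('a)))" by (simp add: power_divide)
      also have "1 / \<rho> ^ (2 * DIM('a)) = l powr (- (d * \<mu>))"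
        using l0 \<rho> by (simp add: \<rho>_def powr_minus_divide d_def powr_powr flip: powr_realpow) (simp add: mult_ac)
      finally show ?thesis .
    qed
    define \<omega> where "\<omega> Z = (\<Sum>g\<in>G. shell k t c l g Z)" for Z
    have \<omega>: "integrable lborel \<omega>"
      unfolding \<omega>_def using k by (intro Bochner_Integration.integrable_sum integrable_shell) auto
    have Wle: "norm (LINT Z|lborel. complex_of_real (\<omega> Z) * cis (\<theta> \<bullet> Z)) \<le> (\<Sum>g\<in>G. norm (shell_ft k t c l g \<theta>))" for \<theta>
    proof -
      have ints: "integrable lborel (\<lambda>Z. complex_of_real (shell k t c l g Z) * cis (\<theta> \<bullet> Z))" for g
      proof (rule Bochner_Integration.integrable_bound)
        show i: "integrable lborel (shell k t c l g)" using k by (intro integrable_shell) auto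
        show "(\<lambda>Z. complex_of_real (shell k t c l g Z) * cis (\<theta> \<bullet> Z)) \<in> borel_measurable lborel"
          using borel_measurable_integrable[OF i] by measurable
      qed (simp add: norm_mult)
      have "(LINT Z|lborel. complex_of_real (\<omega> Z) * cis (\<theta> \<bullet> Z)) = (\<Sum>g\<in>G. shell_ft k t c l g \<theta>)"
        unfolding \<omega>_def shell_ft_def of_real_sum sum_distrib_right using ints by (rule Bochner_Integration.integral_sum)
      thus ?thesis by (simp only: norm_sum)
    qed
    define D where "D = Cm * l powr (2 * \<alpha>)"
    have D0: "0 \<le> D" using Cm by (simp add: D_def)
    have LS: "(\<Sum>j\<in>J. b j * (norm (A j))\<^sup>2) \<le> D * (2 / h) ^ DIM('a \<times> 'a) * (\<Sum>i\<in>I. \<Sum>i'\<in>I. norm (a i) * norm (a i') *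
        norm (LINT Z|lborel. complex_of_real (\<omega> Z) * cis ((freq \<tau> s i - freq \<tau> s i') \<bullet> Z)))"
      unfolding A_def
    proof (rule large_sieve_majorant[OF h0 fin _ b0 \<omega> D0])
      fix i and e :: "'a \<times> 'a" assume i: "i \<in> I" and e: "e \<in> Basis"
      obtain x w where ii: "i = (x, w)" "norm x \<le> R" "norm w \<le> R" using i sub by (auto simp: I_def subset_iff)
      have s2: "s\<^sup>2 \<le> T\<^sup>2" using st pos by (intro power_mono) auto
      have s2w: "norm (s\<^sup>2 *\<^sub>R w) \<le> T\<^sup>2 * R" using s2 ii by (auto intro!: mult_mono)
      have "\<bar>freq \<tau> s i \<bullet> e\<bar> \<le> norm ((-2 * \<tau>) *\<^sub>R (x - s\<^sup>2 *\<^sub>R w)) + norm ((2 * \<tau> * s\<^sup>2) *\<^sub>R w)"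
        unfolding freq_def ii fst_conv snd_conv by (rule norm_vec_Pair_le[OF e])
      also have "\<dots> = 2 * \<bar>\<tau>\<bar> * (norm (x - s\<^sup>2 *\<^sub>R w) + norm (s\<^sup>2 *\<^sub>R w))"
        unfolding norm_scaleR abs_mult distrib_left by (simp del: norm_scaleR)
      also have "\<dots> \<le> 2 * \<bar>\<tau>\<bar> * (R + 2 * (T\<^sup>2 * R))"
        using norm_triangle_ineq4[of x "s\<^sup>2 *\<^sub>R w"] s2w ii by (intro mult_left_mono) auto
      also have "\<dots> = H * \<bar>\<tau>\<bar>" by (simp add: H_def algebra_simps)
      also have "\<dots> \<le> H * l powr (- 1 - \<mu>)" using \<tau> H by (intro mult_left_mono) auto
      finally have "\<bar>freq \<tau> s i \<bullet> e\<bar> * h \<le> (H * l powr (- 1 - \<mu>)) * h" using h0 by (intro mult_right_mono) auto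
      also have "\<dots> = 1" using H l0 by (simp add: h_def flip: powr_add)
      finally show "\<bar>freq \<tau> s i \<bullet> e\<bar> * h \<le> 1" .
    next
      fix Z :: "'a \<times> 'a"
      have "(\<Sum>j | j \<in> Py \<times> Pz \<and> (fst j, snd j - fst j) \<in> cbox (Z - h *\<^sub>R One) (Z + h *\<^sub>R One).
         my (fst j) * mz (snd j) * exp (- (t\<^sup>2 * (norm (snd j - fst j))\<^sup>2 - c)\<^sup>2 / \<delta>\<^sup>2))
         \<le> Cm * l powr (2 * \<alpha>) * (\<Sum>g\<in>G. shell k t c l g Z)"
      proof (rule majorant[OF l r0 _ st(4) k h0 hl kh F(2,3) sub(2,3) G(2)])
        show "0 < t" using st pos by simp
        fix y z assume "y \<in> Py" "z \<in> Pz"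
        hence "(y, z - y) \<in> Y ` J" by (auto simp: Y_def J_def image_iff intro!: bexI[of _ "(y, z)"])
        then obtain g where g: "g \<in> G" "norm ((y, z - y) - g) \<le> \<rho>" using G(3) by blast
        have "k * (norm ((y, z - y) - g))\<^sup>2 \<le> k * \<rho>\<^sup>2" using g k by (intro mult_left_mono power_mono) auto
        thus "\<exists>g\<in>G. k * (norm ((y, z - y) - g))\<^sup>2 \<le> 1" using g k\<rho> by auto
      qed
      thus "(\<Sum>j | j \<in> J \<and> Y j \<in> cbox (Z - h *\<^sub>R One) (Z + h *\<^sub>R One). b j) \<le> D * \<omega> Z"
        by (simp only: J_def Y_def b_def agauss_def D_def \<omega>_def)
    qed
    have "(\<Sum>i\<in>I. \<Sum>i'\<in>I. norm (a i) * norm (a i') * norm (LINT Z|lborel. complex_of_real (\<omega> Z) * cis ((freq \<tau> s i - freq \<tau> s i') \<bullet> Z)))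
        \<le> (\<Sum>i\<in>I. \<Sum>i'\<in>I. agauss mx mw 1 c (\<delta>\<^sup>2) i * agauss mx mw 1 c (\<delta>\<^sup>2) i' *
          (\<Sum>g\<in>G. norm (shell_ft k t c l g (freq \<tau> s i - freq \<tau> s i'))))"
    proof (intro sum_mono)
      fix i i' assume i: "i \<in> I" "i' \<in> I"
      show "norm (a i) * norm (a i') * norm (LINT Z|lborel. complex_of_real (\<omega> Z) * cis ((freq \<tau> s i - freq \<tau> s i') \<bullet> Z)) \<le>
         agauss mx mw 1 c (\<delta>\<^sup>2) i * agauss mx mw 1 c (\<delta>\<^sup>2) i' * (\<Sum>g\<in>G. norm (shell_ft k t c l g (freq \<tau> s i - freq \<tau> s i')))"
        unfolding na[OF i(1), symmetric] na[OF i(2), symmetric] using Wle by (intro mult_left_mono) auto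
    qed
    also have "\<dots> \<le> Ck * real (card G) * l powr (1 - \<mu> + 2 * \<alpha> * (1 - 2 * \<mu>)) * asum"
      unfolding I_def asum_def k_def by (rule kersum[OF adm r0 l \<tau>(1) G(2)]) (use G(1) in \<open>simp add: Y_def[abs_def] J_def\<close>)
    also have "\<dots> \<le> Ck * ((30 * d * R) ^ (2 * DIM('a)) * l powr (- (d * \<mu>))) * l powr (1 - \<mu> + 2 * \<alpha> * (1 - 2 * \<mu>)) * asum"
      using Ck as0 cardG by (intro mult_right_mono mult_left_mono) auto
    finally have "D * (2 / h) ^ DIM('a \<times> 'a) * (\<Sum>i\<in>I. \<Sum>i'\<in>I. norm (a i) * norm (a i') * norm (LINT Z|lborel. complex_of_real (\<omega> Z) * cis ((freq \<tau> s i - freq \<tau> s i') \<bullet> Z)))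
        \<le> D * (2 / h) ^ DIM('a \<times> 'a) * (Ck * ((30 * d * R) ^ (2 * DIM('a)) * l powr (- (d * \<mu>))) * l powr (1 - \<mu> + 2 * \<alpha> * (1 - 2 * \<mu>)) * asum)"
      using D0 h0 by (intro mult_left_mono) auto
    also have eq2h: "(2 / h) ^ DIM('a \<times> 'a) = (2 * H) ^ (2 * DIM('a)) * l powr (- (2 * d * (1 + \<mu>)))"
    proof -
      have "2 / h = 2 * H * (1 / l powr (1 + \<mu>))" by (simp add: h_def)
      moreover have "DIM('a \<times> 'a) = 2 * DIM('a)" by simp
      ultimately have "(2 / h) ^ DIM('a \<times> 'a) = (2 * H) ^ (2 * DIM('a)) * (1 / l powr (1 + \<mu>)) ^ (2 * DIM('a))"
        by (simp only: power_mult_distrib)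
      also have "(1 / l powr (1 + \<mu>)) ^ (2 * DIM('a)) = l powr (- (2 * d * (1 + \<mu>)))"
        using l0 by (simp add: power_divide powr_minus_divide d_def powr_powr flip: powr_realpow) (simp add: mult_ac)
      finally show ?thesis .
    qed
    also have "D * ((2 * H) ^ (2 * DIM('a)) * l powr (- (2 * d * (1 + \<mu>)))) * (Ck * ((30 * d * R) ^ (2 * DIM('a)) * l powr (- (d * \<mu>))) * l powr (1 - \<mu> + 2 * \<alpha> * (1 - 2 * \<mu>)) * asum)
       = C5 * l powr (4 + 4 * \<epsilon> - \<mu> * (3 * DIM('a) + 1 + 4 * \<alpha>)) * asum"
    proof -
      have "l powr (4 + 4 * \<epsilon> - \<mu> * (3 * DIM('a) + 1 + 4 * \<alpha>)) = l powr (2 * \<alpha>) * l powr (- (2 * d * (1 + \<mu>))) * l powr (- (d * \<mu>)) * l powr (1 - \<mu> + 2 * \<alpha> * (1 - 2 * \<mu>))"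
        unfolding powr_add[symmetric] by (rule arg_cong[of _ _ "(powr) l"]) (simp add: \<epsilon>(2) d_def field_simps)
      thus ?thesis by (simp add: D_def C5_def mult_ac)
    qed
    also have "\<dots> \<le> C5 * (l powr (2 + \<epsilon>))\<^sup>2 * asum"
    proof -
      have "l powr (4 + 4 * \<epsilon> - \<mu> * (3 * DIM('a) + 1 + 4 * \<alpha>)) \<le> l powr (4 + 2 * \<epsilon>)"
        using \<epsilon>(3) l l0 by (intro powr_mono') auto
      also have "\<dots> = (l powr (2 + \<epsilon>))\<^sup>2" by (simp add: power2_eq_square flip: powr_add)
      finally show ?thesis using C5 as0 by (intro mult_right_mono mult_left_mono) auto
    qed
    finally have LS2: "(\<Sum>j\<in>J. b j * (norm (A j))\<^sup>2) \<le> C5 * (l powr (2 + \<epsilon>))\<^sup>2 * asum" using LS[unfolded eq2h] by linarith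

    define S where "S = (\<Sum>i\<in>I. \<Sum>j\<in>J. (agauss mx mw 1 c (\<delta>\<^sup>2) i * cis (\<phi> i)) * (agauss my mz t c (\<delta>\<^sup>2) j * cis (\<psi> j)) * cis (freq \<tau> s i \<bullet> (fst j, snd j - fst j)))"
    have "S = (\<Sum>j\<in>J. b j * cis (\<psi> j) * A j)"
      unfolding S_def A_def sum_distrib_left by (subst sum.swap) (intro sum.cong refl, simp add: a_def b_def Y_def mult_ac)
    hence "norm S \<le> (\<Sum>j\<in>J. norm (b j * cis (\<psi> j) * A j))" by (simp only: norm_sum)
    also have "\<dots> = (\<Sum>j\<in>J. b j * norm (A j))" using b0 by (intro sum.cong refl) (simp add: norm_mult)
    finally have "(norm S)\<^sup>2 \<le> (\<Sum>j\<in>J. b j * norm (A j))\<^sup>2" by (intro power_mono) auto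
    also have "\<dots> \<le> (\<Sum>j\<in>J. b j) * (\<Sum>j\<in>J. b j * (norm (A j))\<^sup>2)" using b0 by (rule weighted_Cauchy_Schwarz_sum)
    also have "\<dots> \<le> bsum * (C5 * (l powr (2 + \<epsilon>))\<^sup>2 * asum)"
      using bbs bs0 LS2 b0 by (intro mult_mono) (auto intro!: sum_nonneg)
    also have "\<dots> = C5 * (l powr (2 + \<epsilon>))\<^sup>2 * (asum * bsum)" by simp
    \<comment> \<open>The geometric mean is replaced by a sum so that the bound is linear in
      quantities whose integrals over \<open>c\<close> are explicit.\<close>
    also have "\<dots> \<le> C5 * (l powr (2 + \<epsilon>))\<^sup>2 * (asum + bsum)\<^sup>2"
    proof (intro mult_left_mono)
      have "0 \<le> asum\<^sup>2 + asum * bsum + bsum\<^sup>2" using as0 bs0 by (intro add_nonneg_nonneg mult_nonneg_nonneg) simp_all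
      moreover have "(asum + bsum)\<^sup>2 - asum * bsum = asum\<^sup>2 + asum * bsum + bsum\<^sup>2" by (simp add: power2_eq_square algebra_simps)
      ultimately show "asum * bsum \<le> (asum + bsum)\<^sup>2" by linarith
    qed (use C5 in simp)
    also have "\<dots> = (sqrt C5 * l powr (2 + \<epsilon>) * (asum + bsum))\<^sup>2" using C5 by (simp add: power_mult_distrib)
    finally have "norm S \<le> sqrt C5 * l powr (2 + \<epsilon>) * (asum + bsum)"
      by (rule power2_le_imp_le) (use C5 as0 bs0 in \<open>intro mult_nonneg_nonneg add_nonneg_nonneg; simp\<close>)
    thus "norm (\<Sum>i\<in>Px \<times> Pw. \<Sum>j\<in>Py \<times> Pz. (agauss mx mw 1 c (\<delta>\<^sup>2) i * cis (\<phi> i)) * (agauss my mz t c (\<delta>\<^sup>2) j * cis (\<psi> j)) *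
         cis (freq \<tau> s i \<bullet> (fst j, snd j - fst j)))
      \<le> sqrt C5 * l powr (2 + \<epsilon>) * ((\<Sum>i\<in>Px \<times> Pw. agauss mx mw 1 c (2 * \<delta>\<^sup>2) i) + (\<Sum>j\<in>Py \<times> Pz. agauss my mz t c (2 * \<delta>\<^sup>2) j))"
      by (simp only: S_def asum_def bsum_def I_def J_def)
  qed
qed

subsection \<open>Smoothed counts of quadruples\<close>

text \<open>The values lie in a normed space so that real counts and complex oscillating sums share
  one notion.\<close>

definition qsum :: "'a set \<Rightarrow> ('a \<Rightarrow> real) \<Rightarrow> 'a set \<Rightarrow> ('a \<Rightarrow> real) \<Rightarrow> 'a set \<Rightarrow> ('a \<Rightarrow> real) \<Rightarrow> 'a set \<Rightarrow> ('a \<Rightarrow> real) \<Rightarrow>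
    ('a \<Rightarrow> 'a \<Rightarrow> 'a \<Rightarrow> 'a \<Rightarrow> 'b::real_normed_vector) \<Rightarrow> 'b" where
  "qsum Px mx Py my Pz mz Pw mw f = (\<Sum>x\<in>Px. \<Sum>y\<in>Py. \<Sum>z\<in>Pz. \<Sum>w\<in>Pw. (mx x * my y * mz z * mw w) *\<^sub>R f x y z w)"

lemma sum_rotate3: "(\<Sum>y\<in>A. \<Sum>z\<in>B. \<Sum>w\<in>C. g y z w) = (\<Sum>w\<in>C. \<Sum>y\<in>A. \<Sum>z\<in>B. g y z w)"
proof -
  have "(\<Sum>y\<in>A. \<Sum>z\<in>B. \<Sum>w\<in>C. g y z w) = (\<Sum>y\<in>A. \<Sum>w\<in>C. \<Sum>z\<in>B. g y z w)"
    by (intro sum.cong refl sum.swap)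
  also have "\<dots> = (\<Sum>w\<in>C. \<Sum>y\<in>A. \<Sum>z\<in>B. g y z w)" by (rule sum.swap)
  finally show ?thesis .
qed

lemma qsum_swap:
  "qsum Px mx Py my Pz mz Pw mw f = qsum Px mx Pw mw Pz mz Py my (\<lambda>x w z y. f x y z w)"
proof -
  have "(\<Sum>y\<in>Py. \<Sum>z\<in>Pz. \<Sum>w\<in>Pw. (mx x * my y * mz z * mw w) *\<^sub>R f x y z w) =
     (\<Sum>w\<in>Pw. \<Sum>z\<in>Pz. \<Sum>y\<in>Py. (mx x * mw w * mz z * my y) *\<^sub>R f x y z w)" for x
  proof -
    have "(\<Sum>y\<in>Py. \<Sum>z\<in>Pz. \<Sum>w\<in>Pw. (mx x * my y * mz z * mw w) *\<^sub>R f x y z w) =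
       (\<Sum>w\<in>Pw. \<Sum>z\<in>Pz. \<Sum>y\<in>Py. (mx x * my y * mz z * mw w) *\<^sub>R f x y z w)"
      by (subst sum_rotate3) (intro sum.cong refl sum.swap)
    also have "\<dots> = (\<Sum>w\<in>Pw. \<Sum>z\<in>Pz. \<Sum>y\<in>Py. (mx x * mw w * mz z * my y) *\<^sub>R f x y z w)"
      by (simp only: mult_ac)
    finally show ?thesis .
  qed
  thus ?thesis unfolding qsum_def by simp
qed

lemma qsum_pairs:
  "qsum Px mx Py my Pz mz Pw mw f =
    (\<Sum>i\<in>Px \<times> Pw. \<Sum>j\<in>Py \<times> Pz. (mx (fst i) * mw (snd i) * (my (fst j) * mz (snd j))) *\<^sub>R f (fst i) (fst j) (snd j) (snd i))"
proof -
  have "(\<Sum>y\<in>Py. \<Sum>z\<in>Pz. \<Sum>w\<in>Pw. (mx x * my y * mz z * mw w) *\<^sub>R f x y z w) =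
     (\<Sum>w\<in>Pw. \<Sum>y\<in>Py. \<Sum>z\<in>Pz. (mx x * mw w * (my y * mz z)) *\<^sub>R f x y z w)" for x
    by (subst sum_rotate3) (simp only: mult_ac)
  thus ?thesis unfolding qsum_def sum.cartesian_product' by simp
qed

lemma qsum_diff: "qsum Px mx Py my Pz mz Pw mw (\<lambda>x y z w. f x y z w - g x y z w) =
   qsum Px mx Py my Pz mz Pw mw f - qsum Px mx Py my Pz mz Pw mw g"
  by (simp add: qsum_def scaleR_diff_right sum_subtractf)

lemma qsum_scaleR: "qsum Px mx Py my Pz mz Pw mw (\<lambda>x y z w. c *\<^sub>R f x y z w) = c *\<^sub>R qsum Px mx Py my Pz mz Pw mw f"
  by (simp add: qsum_def scaleR_sum_right mult_ac)

lemma norm_qsum_le: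
  assumes "\<And>x. x \<in> Px \<Longrightarrow> 0 \<le> mx x" "\<And>x. x \<in> Py \<Longrightarrow> 0 \<le> my x" "\<And>x. x \<in> Pz \<Longrightarrow> 0 \<le> mz x" "\<And>x. x \<in> Pw \<Longrightarrow> 0 \<le> mw x"
    and "\<And>x y z w. x \<in> Px \<Longrightarrow> y \<in> Py \<Longrightarrow> z \<in> Pz \<Longrightarrow> w \<in> Pw \<Longrightarrow> norm (f x y z w) \<le> B"
  shows "norm (qsum Px mx Py my Pz mz Pw mw f) \<le> sum mx Px * sum my Py * sum mz Pz * sum mw Pw * B"
proof -
  have "norm (qsum Px mx Py my Pz mz Pw mw f) \<le> (\<Sum>x\<in>Px. \<Sum>y\<in>Py. \<Sum>z\<in>Pz. \<Sum>w\<in>Pw. mx x * my y * mz z * mw w * B)"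
    unfolding qsum_def using assms by (intro sum_norm_le) (auto intro!: mult_left_mono mult_nonneg_nonneg simp: abs_mult)
  also have "\<dots> = sum mx Px * sum my Py * sum mz Pz * sum mw Pw * B"
    by (simp add: sum_distrib_left[symmetric] sum_distrib_right[symmetric] mult.assoc)
  finally show ?thesis .
qed

lemma has_bochner_integral_qsum:
  fixes f :: "'c \<Rightarrow> 'a \<Rightarrow> 'a \<Rightarrow> 'a \<Rightarrow> 'a \<Rightarrow> 'b::{banach, second_countable_topology}"
  assumes "\<And>x y z w. has_bochner_integral M (\<lambda>c. f c x y z w) (g x y z w)"
  shows "has_bochner_integral M (\<lambda>c. qsum Px mx Py my Pz mz Pw mw (f c)) (qsum Px mx Py my Pz mz Pw mw g)"
  unfolding qsum_def by (intro has_bochner_integral_sum has_bochner_integral_scaleR_right assms)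

lemma has_integral_shifted_gaussian:
  assumes "0 < k"
  shows "has_bochner_integral lborel (\<lambda>x::real. exp (- k * (x - x0)\<^sup>2)) (sqrt (pi / k))"
proof -
  have "has_bochner_integral lborel (\<lambda>x. Re (complex_of_real (exp (- k * (x - x0)\<^sup>2)) * cis (0 * x))) (Re (complex_of_real (sqrt (pi / k) * exp (- 0\<^sup>2 / (4 * k))) * cis (0 * x0)))"
    by (rule has_bochner_integral_Re[OF has_integral_shifted_gaussian_cis[OF assms]])
  thus ?thesis by simp
qed

text \<open>Decouples \<open>p = |x-w|\<^sup>2\<close> from
  \<open>q = t\<^sup>2 |z-y|\<^sup>2\<close>: the Gaussian in \<open>p - q\<close> is a
  superposition over \<open>c\<close> of products, each factor seeing only one of the two
  pairs.\<close>

lemma has_integral_gaussian_product: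
  fixes p q \<delta> :: real
  assumes "0 < \<delta>"
  shows "has_bochner_integral lborel (\<lambda>c. exp (- (p - c)\<^sup>2 / \<delta>\<^sup>2) * exp (- (q - c)\<^sup>2 / \<delta>\<^sup>2)) (sqrt (pi / 2) * \<delta> * exp (- (p - q)\<^sup>2 / (2 * \<delta>\<^sup>2)))"
proof -
  have "has_bochner_integral lborel (\<lambda>c. exp (- (p - q)\<^sup>2 / (2 * \<delta>\<^sup>2)) * exp (- (2 / \<delta>\<^sup>2) * (c - (p + q) / 2)\<^sup>2)) (exp (- (p - q)\<^sup>2 / (2 * \<delta>\<^sup>2)) * sqrt (pi / (2 / \<delta>\<^sup>2)))"
    using assms by (intro has_bochner_integral_mult_right has_integral_shifted_gaussian) auto
  moreover have "exp (- (p - q)\<^sup>2 / (2 * \<delta>\<^sup>2)) * exp (- (2 / \<delta>\<^sup>2) * (c - (p + q) / 2)\<^sup>2) = exp (- (p - c)\<^sup>2 / \<delta>\<^sup>2) * exp (- (q - c)\<^sup>2 / \<delta>\<^sup>2)" for c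
  proof -
    have "(p - q)\<^sup>2 / 2 + 2 * (c - (p + q) / 2)\<^sup>2 = (p - c)\<^sup>2 + (q - c)\<^sup>2" by (simp add: power2_eq_square field_simps)
    hence "((p - q)\<^sup>2 / 2 + 2 * (c - (p + q) / 2)\<^sup>2) / \<delta>\<^sup>2 = ((p - c)\<^sup>2 + (q - c)\<^sup>2) / \<delta>\<^sup>2" by simp
    thus ?thesis by (simp add: add_divide_distrib flip: exp_add)
  qed
  moreover have "exp (- (p - q)\<^sup>2 / (2 * \<delta>\<^sup>2)) * sqrt (pi / (2 / \<delta>\<^sup>2)) = sqrt (pi / 2) * \<delta> * exp (- (p - q)\<^sup>2 / (2 * \<delta>\<^sup>2))"
  proof -
    have "pi / (2 / \<delta>\<^sup>2) = pi / 2 * \<delta>\<^sup>2" by simp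
    hence "sqrt (pi / (2 / \<delta>\<^sup>2)) = sqrt (pi / 2) * \<delta>" using assms by (simp only: real_sqrt_mult) simp
    thus ?thesis by simp
  qed
  ultimately show ?thesis by (simp only:)
qed

text \<open>With the arguments permuted, \<open>dist_defect t x w z y\<close> is the second defect
  \<open>v\<close>.\<close>

definition dist_defect :: "real \<Rightarrow> 'a::real_normed_vector \<Rightarrow> 'a \<Rightarrow> 'a \<Rightarrow> 'a \<Rightarrow> real" where
  "dist_defect s x y z w = (norm (x - y))\<^sup>2 - s\<^sup>2 * (norm (z - w))\<^sup>2"

text \<open>Expanding the squares, the terms in \<open>(x, w)\<close> alone and in
  \<open>(y, z)\<close> alone become unimodular coefficients; only the bilinear rest couples the two
  pairs, as \<open>bilinear_bound\<close> requires.\<close>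

lemma dist_defect_phase:
  fixes x y z w :: "'a::euclidean_space"
  shows "\<tau> * dist_defect s x y z w = \<tau> * ((norm x)\<^sup>2 - s\<^sup>2 * (norm w)\<^sup>2) + \<tau> * ((norm y)\<^sup>2 - s\<^sup>2 * (norm z)\<^sup>2) + freq \<tau> s (x, w) \<bullet> (y, z - y)"
  unfolding freq_inner dist_defect_def power2_norm_eq_inner
  by (simp add: inner_diff_left inner_diff_right inner_commute algebra_simps)

definition osc where
  "osc Px mx Py my Pz mz Pw mw s t \<delta> \<tau> = qsum Px mx Py my Pz mz Pw mw (\<lambda>x y z w.
     complex_of_real (exp (- (dist_defect t x w z y)\<^sup>2 / (2 * \<delta>\<^sup>2))) * cis (\<tau> * dist_defect s x y z w))"

text \<open>Integrating \<open>bilinear_bound\<close> over \<open>c\<close> loses nothing: the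
  Gaussian sums on its right integrate to \<open>O(\<delta>)\<close>, which cancels the factor
  \<open>\<delta>\<close> produced by the convolution on its left.\<close>

lemma fixed_frequency_bound:
  fixes R \<gamma> \<sigma> t1 T \<alpha> K \<mu> \<epsilon> :: real
  assumes d: "2 \<le> DIM('a::euclidean_space)"
    and pos: "1 \<le> R" "0 < \<gamma>" "0 < \<sigma>" "0 < t1" "1 \<le> T" "0 < \<alpha>" "0 < K" and \<mu>: "0 < \<mu>"
    and \<epsilon>: "0 < \<epsilon>" "\<alpha> = DIM('a) / 2 + 3 / 4 + \<epsilon>" "\<mu> * (3 * DIM('a) + 1 + 4 * \<alpha>) \<le> 2 * \<epsilon>"
  obtains C where "0 < C"
    "\<And>l \<delta> \<tau> s t r0 (Px :: 'a set) mx Py my Pz mz Pw mw.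
      admissible R \<gamma> \<sigma> t1 T \<alpha> K r0 s t Px mx Py my Pz mz Pw mw \<Longrightarrow>
      r0 \<le> \<delta> \<Longrightarrow> 0 < \<delta> \<Longrightarrow> \<delta> \<le> l \<Longrightarrow> l \<le> 1 \<Longrightarrow> 1 / l \<le> \<bar>\<tau>\<bar> \<Longrightarrow> \<bar>\<tau>\<bar> \<le> l powr (- 1 - \<mu>) \<Longrightarrow>
      norm (osc Px mx Py my Pz mz Pw mw s t \<delta> \<tau>) \<le> C * l powr (2 + \<epsilon>)"
proof -
  obtain C0 where C0: "0 < C0" and bil:
    "\<And>l \<delta> \<tau> s t c r0 (Px :: 'a set) mx Py my Pz mz Pw mw \<phi> \<psi>.
      admissible R \<gamma> \<sigma> t1 T \<alpha> K r0 s t Px mx Py my Pz mz Pw mw \<Longrightarrow>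
      r0 \<le> \<delta> \<Longrightarrow> 0 < \<delta> \<Longrightarrow> \<delta> \<le> l \<Longrightarrow> l \<le> 1 \<Longrightarrow> 1 / l \<le> \<bar>\<tau>\<bar> \<Longrightarrow> \<bar>\<tau>\<bar> \<le> l powr (- 1 - \<mu>) \<Longrightarrow>
      norm (\<Sum>i\<in>Px \<times> Pw. \<Sum>j\<in>Py \<times> Pz. (agauss mx mw 1 c (\<delta>\<^sup>2) i * cis (\<phi> i)) * (agauss my mz t c (\<delta>\<^sup>2) j * cis (\<psi> j)) *
         cis (freq \<tau> s i \<bullet> (fst j, snd j - fst j)))
      \<le> C0 * l powr (2 + \<epsilon>) * ((\<Sum>i\<in>Px \<times> Pw. agauss mx mw 1 c (2 * \<delta>\<^sup>2) i) + (\<Sum>j\<in>Py \<times> Pz. agauss my mz t c (2 * \<delta>\<^sup>2) j))"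
  proof (rule bilinear_bound[OF d pos \<mu> \<epsilon>], goal_cases)
    case (1 C)
    show ?case by (rule 1(1)[OF 1(2)]) (rule 1(3); assumption)
  qed
  define M where "M = K * R powr \<alpha>"
  have M: "0 < M" using pos by (simp add: M_def)
  show ?thesis
  proof (rule that[of "4 * C0 * (M * M)"])
    show "0 < 4 * C0 * (M * M)" using C0 M by simp
    fix l \<delta> \<tau> s t r0 :: real and Px Py Pz Pw :: "'a set" and mx my mz mw
    assume adm: "admissible R \<gamma> \<sigma> t1 T \<alpha> K r0 s t Px mx Py my Pz mz Pw mw"
      and r0: "r0 \<le> \<delta>" and l: "0 < \<delta>" "\<delta> \<le> l" "l \<le> 1" and \<tau>: "1 / l \<le> \<bar>\<tau>\<bar>" "\<bar>\<tau>\<bar> \<le> l powr (- 1 - \<mu>)"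
    have F: "frostman \<alpha> K r0 Px mx" "frostman \<alpha> K r0 Py my" "frostman \<alpha> K r0 Pz mz" "frostman \<alpha> K r0 Pw mw"
      and sub: "Px \<subseteq> cball 0 R" "Py \<subseteq> cball 0 R" "Pz \<subseteq> cball 0 R" "Pw \<subseteq> cball 0 R"
      using adm by (auto simp: admissible_def)
    have r0R: "r0 \<le> R" using r0 l pos by linarith
    have tot: "sum mx Px \<le> M" "sum my Py \<le> M" "sum mz Pz \<le> M" "sum mw Pw \<le> M"
      unfolding M_def using F sub r0R by (intro frostman_total_le; simp)+
    have nn: "\<And>x. x \<in> Px \<Longrightarrow> 0 \<le> mx x" "\<And>x. x \<in> Py \<Longrightarrow> 0 \<le> my x" "\<And>x. x \<in> Pz \<Longrightarrow> 0 \<le> mz x" "\<And>x. x \<in> Pw \<Longrightarrow> 0 \<le> mw x"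
      using F by (auto simp: frostman_def)
    define \<phi> where "\<phi> i = \<tau> * ((norm (fst i))\<^sup>2 - s\<^sup>2 * (norm (snd i))\<^sup>2)" for i :: "'a \<times> 'a"
    define S where "S c = (\<Sum>i\<in>Px \<times> Pw. \<Sum>j\<in>Py \<times> Pz. (agauss mx mw 1 c (\<delta>\<^sup>2) i * cis (\<phi> i)) * (agauss my mz t c (\<delta>\<^sup>2) j * cis (\<phi> j)) *
         cis (freq \<tau> s i \<bullet> (fst j, snd j - fst j)))" for c
    define B where "B c = (\<Sum>i\<in>Px \<times> Pw. agauss mx mw 1 c (2 * \<delta>\<^sup>2) i) + (\<Sum>j\<in>Py \<times> Pz. agauss my mz t c (2 * \<delta>\<^sup>2) j)" for c
    have hS: "has_bochner_integral lborel S (complex_of_real (sqrt (pi / 2) * \<delta>) * osc Px mx Py my Pz mz Pw mw s t \<delta> \<tau>)"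
    proof -
      have "has_bochner_integral lborel (\<lambda>c. qsum Px mx Py my Pz mz Pw mw (\<lambda>x y z w.
           complex_of_real (exp (- ((norm (x - w))\<^sup>2 - c)\<^sup>2 / \<delta>\<^sup>2) * exp (- (t\<^sup>2 * (norm (z - y))\<^sup>2 - c)\<^sup>2 / \<delta>\<^sup>2)) * cis (\<tau> * dist_defect s x y z w)))
         (qsum Px mx Py my Pz mz Pw mw (\<lambda>x y z w. complex_of_real (sqrt (pi / 2) * \<delta> * exp (- ((norm (x - w))\<^sup>2 - t\<^sup>2 * (norm (z - y))\<^sup>2)\<^sup>2 / (2 * \<delta>\<^sup>2))) * cis (\<tau> * dist_defect s x y z w)))"
        by (intro has_bochner_integral_qsum has_bochner_integral_mult_left has_bochner_integral_of_real has_integral_gaussian_product l)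
      moreover have "S = (\<lambda>c. qsum Px mx Py my Pz mz Pw mw (\<lambda>x y z w.
           complex_of_real (exp (- ((norm (x - w))\<^sup>2 - c)\<^sup>2 / \<delta>\<^sup>2) * exp (- (t\<^sup>2 * (norm (z - y))\<^sup>2 - c)\<^sup>2 / \<delta>\<^sup>2)) * cis (\<tau> * dist_defect s x y z w)))"
        unfolding qsum_pairs S_def[abs_def] dist_defect_phase
        by (intro ext sum.cong refl) (simp add: agauss_def \<phi>_def cis_mult[symmetric] scaleR_conv_of_real norm_minus_commute mult_ac)
      moreover have "qsum Px mx Py my Pz mz Pw mw (\<lambda>x y z w. complex_of_real (sqrt (pi / 2) * \<delta> * exp (- ((norm (x - w))\<^sup>2 - t\<^sup>2 * (norm (z - y))\<^sup>2)\<^sup>2 / (2 * \<delta>\<^sup>2))) * cis (\<tau> * dist_defect s x y z w))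
         = complex_of_real (sqrt (pi / 2) * \<delta>) * osc Px mx Py my Pz mz Pw mw s t \<delta> \<tau>"
        unfolding osc_def qsum_scaleR[symmetric] scaleR_conv_of_real[symmetric]
        by (simp add: dist_defect_def scaleR_conv_of_real mult_ac)
      ultimately show ?thesis by (simp only:)
    qed
    have hB: "has_bochner_integral lborel B (sqrt (2 * pi) * \<delta> * (sum mx Px * sum mw Pw) + sqrt (2 * pi) * \<delta> * (sum my Py * sum mz Pz))"
    proof -
      have g: "has_bochner_integral lborel (\<lambda>c. exp (- (p - c)\<^sup>2 / (2 * \<delta>\<^sup>2))) (sqrt (2 * pi) * \<delta>)" for p
        using has_integral_shifted_gaussian[of "1 / (2 * \<delta>\<^sup>2)" p] l by (simp add: power2_commute[of _ p] real_sqrt_mult mult_ac)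
      have h: "has_bochner_integral lborel (\<lambda>c. \<Sum>i\<in>P \<times> Q. agauss m n t c (2 * \<delta>\<^sup>2) i) (sqrt (2 * pi) * \<delta> * (sum m P * sum n Q))" for P Q m n and t :: real
      proof -
        have "has_bochner_integral lborel (\<lambda>c. \<Sum>i\<in>P \<times> Q. agauss m n t c (2 * \<delta>\<^sup>2) i) (\<Sum>i\<in>P \<times> Q. m (fst i) * n (snd i) * (sqrt (2 * pi) * \<delta>))"
          unfolding agauss_def by (intro has_bochner_integral_sum has_bochner_integral_mult_right g)
        moreover have "(\<Sum>i\<in>P \<times> Q. m (fst i) * n (snd i) * (sqrt (2 * pi) * \<delta>)) = sqrt (2 * pi) * \<delta> * (sum m P * sum n Q)"
          by (simp add: sum_product sum.cartesian_product split_beta mult.commute flip: sum_distrib_right)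
        ultimately show ?thesis by simp
      qed
      show ?thesis unfolding B_def by (intro has_bochner_integral_add h)
    qed
    have le: "norm (S c) \<le> C0 * l powr (2 + \<epsilon>) * B c" for c
      unfolding S_def B_def by (rule bil[OF adm r0 l \<tau>])
    have "norm (LINT c|lborel. S c) \<le> (LINT c|lborel. C0 * l powr (2 + \<epsilon>) * B c)"
      using hS hB le by (intro Bochner_Integration.integral_norm_bound_integral) (auto simp: has_bochner_integral_iff)
    also have "(LINT c|lborel. S c) = complex_of_real (sqrt (pi / 2) * \<delta>) * osc Px mx Py my Pz mz Pw mw s t \<delta> \<tau>"
      using hS by (rule has_bochner_integral_integral_eq)
    also have "(LINT c|lborel. C0 * l powr (2 + \<epsilon>) * B c) = C0 * l powr (2 + \<epsilon>) * (sqrt (2 * pi) * \<delta> * (sum mx Px * sum mw Pw) + sqrt (2 * pi) * \<delta> * (sum my Py * sum mz Pz))"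
      using hB by (simp add: has_bochner_integral_iff)
    also have "\<dots> \<le> C0 * l powr (2 + \<epsilon>) * (sqrt (2 * pi) * \<delta> * (M * M) + sqrt (2 * pi) * \<delta> * (M * M))"
      using C0 l tot nn M by (intro mult_left_mono add_mono mult_mono) (auto intro!: sum_nonneg)
    also have "\<dots> = sqrt (pi / 2) * \<delta> * (4 * C0 * (M * M) * l powr (2 + \<epsilon>))"
    proof -
      have "sqrt (2 * pi) = 2 * sqrt (pi / 2)"
        by (simp add: real_sqrt_mult real_sqrt_divide field_simps)
      thus ?thesis by (simp only:) (simp add: algebra_simps)
    qed
    also have "norm (complex_of_real (sqrt (pi / 2) * \<delta>) * osc Px mx Py my Pz mz Pw mw s t \<delta> \<tau>) = sqrt (pi / 2) * \<delta> * norm (osc Px mx Py my Pz mz Pw mw s t \<delta> \<tau>)"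
      using l by (simp add: norm_mult)
    finally show "norm (osc Px mx Py my Pz mz Pw mw s t \<delta> \<tau>) \<le> 4 * C0 * (M * M) * l powr (2 + \<epsilon>)"
      using l by (subst (asm) mult_le_cancel_left_pos) auto
  qed
qed

text \<open>The factors \<open>1 / \<delta>1\<close> and \<open>1 / \<delta>2\<close> normalise the
  count up to a constant, so that it approximates a density of \<open>(u, v)\<close> at the origin
  and can converge.\<close>

definition mix where
  "mix Px mx Py my Pz mz Pw mw s t \<delta>1 \<delta>2 = qsum Px mx Py my Pz mz Pw mw (\<lambda>x y z w.
     exp (- (dist_defect s x y z w)\<^sup>2 / (2 * \<delta>1\<^sup>2)) / \<delta>1 * (exp (- (dist_defect t x w z y)\<^sup>2 / (2 * \<delta>2\<^sup>2)) / \<delta>2))"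

text \<open>Exchanging \<open>y\<close> and \<open>w\<close> exchanges the two defects. A bound for
  halving the first width therefore also serves the second.\<close>

lemma mix_swap: "mix Px mx Py my Pz mz Pw mw s t \<delta>1 \<delta>2 = mix Px mx Pw mw Pz mz Py my t s \<delta>2 \<delta>1"
  unfolding mix_def by (subst qsum_swap) (simp add: mult_ac)

text \<open>For \<open>y = \<delta>\<^sup>2 * \<tau>\<^sup>2\<close> this is the multiplier of
  passing from width \<open>\<delta>\<close> to \<open>\<delta> / 2\<close>: quadratically small at
  low frequencies, Gaussian at high ones.\<close>

lemma exp_difference_bounds:
  fixes y :: real
  assumes "0 \<le> y"
  shows "\<bar>exp (- y / 2) - exp (- y / 8)\<bar> \<le> y" "\<bar>exp (- y / 2) - exp (- y / 8)\<bar> \<le> exp (- y / 8)"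
proof -
  have 1: "exp (- y / 2) = exp (- y / 8) * exp (- (3 / 8 * y))" by (simp flip: exp_add)
  have e: "0 \<le> 1 - exp (- (3 / 8 * y))" "1 - exp (- (3 / 8 * y)) \<le> 3 / 8 * y" "1 - exp (- (3 / 8 * y)) \<le> 1"
    using assms exp_ge_add_one_self[of "- (3 / 8 * y)"] by auto
  have "exp (- y / 2) - exp (- y / 8) = - (exp (- y / 8) * (1 - exp (- (3 / 8 * y))))" unfolding 1 by (simp add: algebra_simps)
  hence 2: "\<bar>exp (- y / 2) - exp (- y / 8)\<bar> = exp (- y / 8) * (1 - exp (- (3 / 8 * y)))" using e by (simp add: abs_mult)
  have "exp (- y / 8) * (1 - exp (- (3 / 8 * y))) \<le> 1 * (3 / 8 * y)" using e assms by (intro mult_mono) auto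
  thus "\<bar>exp (- y / 2) - exp (- y / 8)\<bar> \<le> y" unfolding 2 using assms by linarith
  show "\<bar>exp (- y / 2) - exp (- y / 8)\<bar> \<le> exp (- y / 8)" unfolding 2 using e by (intro mult_left_le) auto
qed

text \<open>Fourier inversion in the first defect only; the second stays a Gaussian inside
  \<open>osc\<close>, and the factor \<open>\<delta>2\<close> accounts for the normalisation that
  \<open>osc\<close> omits.\<close>

lemma osc_integral:
  assumes \<delta>: "0 < \<delta>" "0 < \<delta>2"
  shows "has_bochner_integral lborel (\<lambda>\<tau>. complex_of_real (exp (- (\<delta>\<^sup>2 * \<tau>\<^sup>2) / 2) - exp (- (\<delta>\<^sup>2 * \<tau>\<^sup>2) / 8)) * osc Px mx Py my Pz mz Pw mw s t \<delta>2 \<tau>)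
    (complex_of_real (sqrt (2 * pi) * \<delta>2 * (mix Px mx Py my Pz mz Pw mw s t \<delta> \<delta>2 - mix Px mx Py my Pz mz Pw mw s t (\<delta> / 2) \<delta>2)))"
proof -
  define e where "e u a = exp (- u\<^sup>2 / (2 * a\<^sup>2)) / a" for u a :: real
  have g: "has_bochner_integral lborel (\<lambda>\<tau>. complex_of_real (exp (- (a\<^sup>2 / 2) * \<tau>\<^sup>2)) * cis (u * \<tau>)) (complex_of_real (sqrt (2 * pi) * e u a))" if "0 < a" for a u :: real
  proof -
    have "sqrt (pi / (a\<^sup>2 / 2)) = sqrt (2 * pi) / a" using that by (simp add: real_sqrt_divide real_sqrt_mult)
    thus ?thesis using has_integral_gaussian_cis[of "a\<^sup>2 / 2" u] that by (simp add: e_def)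
  qed
  have d: "has_bochner_integral lborel (\<lambda>\<tau>. complex_of_real (exp (- (\<delta>\<^sup>2 * \<tau>\<^sup>2) / 2) - exp (- (\<delta>\<^sup>2 * \<tau>\<^sup>2) / 8)) * cis (\<tau> * u))
     (complex_of_real (sqrt (2 * pi) * (e u \<delta> - e u (\<delta> / 2))))" for u
  proof -
    have "has_bochner_integral lborel (\<lambda>\<tau>. complex_of_real (exp (- (\<delta>\<^sup>2 / 2) * \<tau>\<^sup>2)) * cis (u * \<tau>) - complex_of_real (exp (- ((\<delta> / 2)\<^sup>2 / 2) * \<tau>\<^sup>2)) * cis (u * \<tau>))
       (complex_of_real (sqrt (2 * pi) * e u \<delta>) - complex_of_real (sqrt (2 * pi) * e u (\<delta> / 2)))"
      using \<delta> by (intro has_bochner_integral_diff g) auto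
    thus ?thesis by (simp add: power_divide mult.commute[of u] ring_distribs)
  qed
  have "has_bochner_integral lborel (\<lambda>\<tau>. qsum Px mx Py my Pz mz Pw mw (\<lambda>x y z w. complex_of_real (exp (- (dist_defect t x w z y)\<^sup>2 / (2 * \<delta>2\<^sup>2))) *
        (complex_of_real (exp (- (\<delta>\<^sup>2 * \<tau>\<^sup>2) / 2) - exp (- (\<delta>\<^sup>2 * \<tau>\<^sup>2) / 8)) * cis (\<tau> * dist_defect s x y z w))))
     (qsum Px mx Py my Pz mz Pw mw (\<lambda>x y z w. complex_of_real (exp (- (dist_defect t x w z y)\<^sup>2 / (2 * \<delta>2\<^sup>2))) *
        complex_of_real (sqrt (2 * pi) * (e (dist_defect s x y z w) \<delta> - e (dist_defect s x y z w) (\<delta> / 2)))))"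
    by (intro has_bochner_integral_qsum has_bochner_integral_mult_right d)
  moreover have "qsum Px mx Py my Pz mz Pw mw (\<lambda>x y z w. complex_of_real (exp (- (dist_defect t x w z y)\<^sup>2 / (2 * \<delta>2\<^sup>2))) *
        (complex_of_real (exp (- (\<delta>\<^sup>2 * \<tau>\<^sup>2) / 2) - exp (- (\<delta>\<^sup>2 * \<tau>\<^sup>2) / 8)) * cis (\<tau> * dist_defect s x y z w)))
      = complex_of_real (exp (- (\<delta>\<^sup>2 * \<tau>\<^sup>2) / 2) - exp (- (\<delta>\<^sup>2 * \<tau>\<^sup>2) / 8)) * osc Px mx Py my Pz mz Pw mw s t \<delta>2 \<tau>" for \<tau>
    unfolding osc_def scaleR_conv_of_real[symmetric] qsum_scaleR[symmetric] by (simp add: mult_ac)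
  moreover have "qsum Px mx Py my Pz mz Pw mw (\<lambda>x y z w. complex_of_real (exp (- (dist_defect t x w z y)\<^sup>2 / (2 * \<delta>2\<^sup>2))) *
        complex_of_real (sqrt (2 * pi) * (e (dist_defect s x y z w) \<delta> - e (dist_defect s x y z w) (\<delta> / 2))))
     = complex_of_real (sqrt (2 * pi) * \<delta>2 * (mix Px mx Py my Pz mz Pw mw s t \<delta> \<delta>2 - mix Px mx Py my Pz mz Pw mw s t (\<delta> / 2) \<delta>2))"
  proof -
    have "mix Px mx Py my Pz mz Pw mw s t \<delta> \<delta>2 - mix Px mx Py my Pz mz Pw mw s t (\<delta> / 2) \<delta>2 =
       qsum Px mx Py my Pz mz Pw mw (\<lambda>x y z w. (e (dist_defect s x y z w) \<delta> - e (dist_defect s x y z w) (\<delta> / 2)) * (exp (- (dist_defect t x w z y)\<^sup>2 / (2 * \<delta>2\<^sup>2)) / \<delta>2))"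
      unfolding mix_def e_def qsum_diff[symmetric] by (simp add: algebra_simps)
    hence "complex_of_real (mix Px mx Py my Pz mz Pw mw s t \<delta> \<delta>2 - mix Px mx Py my Pz mz Pw mw s t (\<delta> / 2) \<delta>2) =
       qsum Px mx Py my Pz mz Pw mw (\<lambda>x y z w. complex_of_real ((e (dist_defect s x y z w) \<delta> - e (dist_defect s x y z w) (\<delta> / 2)) * (exp (- (dist_defect t x w z y)\<^sup>2 / (2 * \<delta>2\<^sup>2)) / \<delta>2)))"
      by (simp only:) (simp add: qsum_def scaleR_conv_of_real)
    hence "complex_of_real (sqrt (2 * pi) * \<delta>2 * (mix Px mx Py my Pz mz Pw mw s t \<delta> \<delta>2 - mix Px mx Py my Pz mz Pw mw s t (\<delta> / 2) \<delta>2)) =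
       (sqrt (2 * pi) * \<delta>2) *\<^sub>R qsum Px mx Py my Pz mz Pw mw (\<lambda>x y z w. complex_of_real ((e (dist_defect s x y z w) \<delta> - e (dist_defect s x y z w) (\<delta> / 2)) * (exp (- (dist_defect t x w z y)\<^sup>2 / (2 * \<delta>2\<^sup>2)) / \<delta>2)))"
      by (simp add: scaleR_conv_of_real)
    thus ?thesis unfolding qsum_scaleR[symmetric] using \<delta>
      by (simp add: scaleR_conv_of_real mult_ac)
  qed
  ultimately show ?thesis by (simp only:)
qed

text \<open>The two widths may differ by a factor \<open>2\<close> because a step from scale
  \<open>\<delta>\<close> to \<open>\<delta> / 2\<close> halves them one after the other. Since
  \<open>osc\<close> is \<open>O(l powr (2 + \<epsilon>))\<close> with \<open>l\<close> about
  \<open>1 / |\<tau>|\<close>, the integral against the multiplier is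
  \<open>O(\<delta> powr (1 + \<epsilon>/4))\<close>, and dividing by \<open>\<delta>2\<close>
  leaves a positive power.\<close>

lemma mix_scale_difference:
  fixes R \<gamma> \<sigma> t1 T \<alpha> K \<mu> \<epsilon> :: real
  assumes d: "2 \<le> DIM('a::euclidean_space)"
    and pos: "1 \<le> R" "0 < \<gamma>" "0 < \<sigma>" "0 < t1" "1 \<le> T" "0 < \<alpha>" "0 < K" and \<mu>: "0 < \<mu>" "\<mu> \<le> \<epsilon> / 2"
    and \<epsilon>: "0 < \<epsilon>" "\<alpha> = DIM('a) / 2 + 3 / 4 + \<epsilon>" "\<mu> * (3 * DIM('a) + 1 + 4 * \<alpha>) \<le> 2 * \<epsilon>" and \<epsilon>1: "\<epsilon> \<le> 1"
  obtains C where "0 < C"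
    "\<And>\<delta> \<delta>2 s t r0 (Px :: 'a set) mx Py my Pz mz Pw mw.
      admissible R \<gamma> \<sigma> t1 T \<alpha> K r0 s t Px mx Py my Pz mz Pw mw \<Longrightarrow>
      r0 \<le> \<delta>2 \<Longrightarrow> 0 < \<delta>2 \<Longrightarrow> \<delta>2 \<le> \<delta> \<Longrightarrow> \<delta> \<le> 2 * \<delta>2 \<Longrightarrow> \<delta> \<le> 1 \<Longrightarrow>
      \<bar>mix Px mx Py my Pz mz Pw mw s t \<delta> \<delta>2 - mix Px mx Py my Pz mz Pw mw s t (\<delta> / 2) \<delta>2\<bar> \<le> C * \<delta> powr (\<epsilon> / 4)"
proof -
  obtain C0 where C0: "0 < C0" and fixed:
    "\<And>l \<delta> \<tau> s t r0 (Px :: 'a set) mx Py my Pz mz Pw mw.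
      admissible R \<gamma> \<sigma> t1 T \<alpha> K r0 s t Px mx Py my Pz mz Pw mw \<Longrightarrow>
      r0 \<le> \<delta> \<Longrightarrow> 0 < \<delta> \<Longrightarrow> \<delta> \<le> l \<Longrightarrow> l \<le> 1 \<Longrightarrow> 1 / l \<le> \<bar>\<tau>\<bar> \<Longrightarrow> \<bar>\<tau>\<bar> \<le> l powr (- 1 - \<mu>) \<Longrightarrow>
      norm (osc Px mx Py my Pz mz Pw mw s t \<delta> \<tau>) \<le> C0 * l powr (2 + \<epsilon>)"
  proof (rule fixed_frequency_bound[OF d pos \<mu>(1) \<epsilon>], goal_cases)
    case (1 C)
    show ?case by (rule 1(1)[OF 1(2)]) (rule 1(3); assumption)
  qed
  obtain C2 where C2: "0 < C2" "\<And>l. 0 < l \<Longrightarrow> exp (- (1/16) * l powr (- (2 * \<mu>))) \<le> C2 * l powr 3"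
  proof (rule exp_neg_le_powr[of "1/16" "2 * \<mu>" 3], goal_cases)
    case (4 C)
    show ?case by (rule 4(1)[OF 4(2)]) (rule 4(3))
  qed (use \<mu> in auto)
  define M where "M = K * R powr \<alpha>"
  have M: "0 < M" using pos by (simp add: M_def)
  define A where "A = C0 + M * M * M * M + M * M * M * M * C2"
  have A: "0 < A" "C0 \<le> A" "M * M * M * M \<le> A" "M * M * M * M * C2 \<le> A"
    using C0 M C2(1) by (auto simp: A_def intro!: add_pos_pos mult_pos_pos)
  show ?thesis
  proof (rule that[of "20 * A"])
    show "0 < 20 * A" using A by simp
    fix \<delta> \<delta>2 s t r0 :: real and Px Py Pz Pw :: "'a set" and mx my mz mw
    assume adm: "admissible R \<gamma> \<sigma> t1 T \<alpha> K r0 s t Px mx Py my Pz mz Pw mw"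
      and r0: "r0 \<le> \<delta>2" and \<delta>2: "0 < \<delta>2" "\<delta>2 \<le> \<delta>" "\<delta> \<le> 2 * \<delta>2" and \<delta>1: "\<delta> \<le> 1"
    have \<delta>: "0 < \<delta>" using \<delta>2 by simp
    have F: "frostman \<alpha> K r0 Px mx" "frostman \<alpha> K r0 Py my" "frostman \<alpha> K r0 Pz mz" "frostman \<alpha> K r0 Pw mw"
      and sub: "Px \<subseteq> cball 0 R" "Py \<subseteq> cball 0 R" "Pz \<subseteq> cball 0 R" "Pw \<subseteq> cball 0 R"
      using adm by (auto simp: admissible_def)
    have r0R: "r0 \<le> R" using r0 \<delta>2 \<delta>1 pos by linarith
    have tot: "sum mx Px \<le> M" "sum my Py \<le> M" "sum mz Pz \<le> M" "sum mw Pw \<le> M"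
      unfolding M_def using F sub r0R by (intro frostman_total_le; simp)+
    have nn: "\<And>x. x \<in> Px \<Longrightarrow> 0 \<le> mx x" "\<And>x. x \<in> Py \<Longrightarrow> 0 \<le> my x" "\<And>x. x \<in> Pz \<Longrightarrow> 0 \<le> mz x" "\<And>x. x \<in> Pw \<Longrightarrow> 0 \<le> mw x"
      using F by (auto simp: frostman_def)
    define g where "g \<tau> = osc Px mx Py my Pz mz Pw mw s t \<delta>2 \<tau>" for \<tau>
    define W where "W \<tau> = exp (- (\<delta>\<^sup>2 * \<tau>\<^sup>2) / 2) - exp (- (\<delta>\<^sup>2 * \<tau>\<^sup>2) / 8)" for \<tau> :: real
    have g4: "norm (g \<tau>) \<le> M * M * M * M" for \<tau>
    proof -
      have "norm (g \<tau>) \<le> sum mx Px * sum my Py * sum mz Pz * sum mw Pw * 1"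
        unfolding g_def osc_def using nn by (intro norm_qsum_le) (auto simp: norm_mult)
      also have "\<dots> \<le> M * M * M * M * 1"
        using tot nn M by (intro mult_mono mult_nonneg_nonneg sum_nonneg) auto
      finally show ?thesis by simp
    qed
    \<comment> \<open>Break points in \<open>|\<tau>|\<close>. Below \<open>a1\<close> the
      multiplier bound \<open>\<delta>\<^sup>2 * \<tau>\<^sup>2\<close> suffices with the trivial
      bound for \<open>osc\<close>; up to \<open>a2\<close> the frequency bound is used with
      \<open>l = 1 / |\<tau>|\<close>, where \<open>|\<tau>| > a1\<close> turns
      \<open>l powr \<epsilon>\<close> into \<open>\<delta> powr (\<epsilon>/4)\<close>; up to
      \<open>a3\<close> it is used with \<open>l = \<delta>\<close>; beyond, the Gaussian decay of
      the multiplier beats any power of \<open>\<delta>\<close>.\<close>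
    define a1 where "a1 = \<delta> powr (-1/4)"
    define a2 where "a2 = \<delta> powr (-1)"
    define a3 where "a3 = \<delta> powr (-1 - \<mu>)"
    have a: "0 < a1" "0 < a2" "0 < a3" using \<delta> by (auto simp: a1_def a2_def a3_def)
    define B where "B \<tau> = A * (\<delta> powr (3/2) * indicator {-a1..a1} \<tau> + \<delta> powr (2 + \<epsilon>/4) * indicator {-a2..a2} \<tau> +
        \<delta> powr (2 + \<epsilon>) * indicator {-a3..a3} \<tau> + \<delta> powr 3 * exp (- (\<delta>\<^sup>2/16) * \<tau>\<^sup>2))" for \<tau>
    have W: "\<bar>W \<tau>\<bar> \<le> \<delta>\<^sup>2 * \<tau>\<^sup>2" "\<bar>W \<tau>\<bar> \<le> exp (- (\<delta>\<^sup>2 * \<tau>\<^sup>2) / 8)" "\<bar>W \<tau>\<bar> \<le> 1" for \<tau>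
      using exp_difference_bounds[of "\<delta>\<^sup>2 * \<tau>\<^sup>2"] order.trans[OF exp_difference_bounds(2)[of "\<delta>\<^sup>2 * \<tau>\<^sup>2"], of 1] by (auto simp: W_def)
    have \<delta>2p: "\<delta>\<^sup>2 = \<delta> powr 2" using \<delta> by simp
    have bound: "norm (complex_of_real (W \<tau>) * g \<tau>) \<le> B \<tau>" for \<tau>
    proof -
      have B1: "A * (\<delta> powr (3/2) * indicator {-a1..a1} \<tau>) \<le> B \<tau>" "A * (\<delta> powr (2 + \<epsilon>/4) * indicator {-a2..a2} \<tau>) \<le> B \<tau>"
        "A * (\<delta> powr (2 + \<epsilon>) * indicator {-a3..a3} \<tau>) \<le> B \<tau>" "A * (\<delta> powr 3 * exp (- (\<delta>\<^sup>2/16) * \<tau>\<^sup>2)) \<le> B \<tau>"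
        unfolding B_def using A by (intro mult_left_mono; simp add: indicator_def)+
      have n: "norm (complex_of_real (W \<tau>) * g \<tau>) = \<bar>W \<tau>\<bar> * norm (g \<tau>)" by (simp add: norm_mult)
      consider "\<bar>\<tau>\<bar> \<le> a1" | "a1 < \<bar>\<tau>\<bar>" "\<bar>\<tau>\<bar> \<le> a2" | "a2 < \<bar>\<tau>\<bar>" "\<bar>\<tau>\<bar> \<le> a3" | "a3 < \<bar>\<tau>\<bar>" by linarith
      thus ?thesis
      proof cases
        case 1
        have "\<bar>W \<tau>\<bar> * norm (g \<tau>) \<le> (\<delta> powr 2 * a1\<^sup>2) * A"
        proof (intro mult_mono)
          have "\<tau>\<^sup>2 \<le> a1\<^sup>2" using 1 by (simp add: abs_le_square_iff[symmetric] a(1) less_imp_le)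
          thus "\<bar>W \<tau>\<bar> \<le> \<delta> powr 2 * a1\<^sup>2" using W(1)[of \<tau>] mult_left_mono[of "\<tau>\<^sup>2" "a1\<^sup>2" "\<delta>\<^sup>2"] unfolding \<delta>2p by (simp del: powr_numeral)
        qed (use g4[of \<tau>] A in \<open>auto\<close>)
        also have "\<delta> powr 2 * a1\<^sup>2 = \<delta> powr (3/2)" unfolding a1_def power2_eq_square powr_add[symmetric] by simp
        finally have "\<bar>W \<tau>\<bar> * norm (g \<tau>) \<le> A * (\<delta> powr (3/2) * indicator {-a1..a1} \<tau>)" using 1 by (simp add: abs_le_iff mult.commute indicator_def)
        thus ?thesis unfolding n using B1(1) by linarith
      next
        case 2
        define l where "l = 1 / \<bar>\<tau>\<bar>"
        have "1 \<le> a1" using \<delta> \<delta>1 by (simp add: a1_def powr_minus_divide powr_le1)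
        hence \<tau>1: "1 \<le> \<bar>\<tau>\<bar>" using 2 by simp
        have l: "0 < l" "l \<le> 1" "\<delta>2 \<le> l"
        proof -
          have "\<delta> * \<bar>\<tau>\<bar> \<le> \<delta> * a2" using 2 \<delta> by (intro mult_left_mono) auto
          hence "\<delta> * \<bar>\<tau>\<bar> \<le> 1" using \<delta> by (simp add: a2_def powr_minus_divide)
          hence "\<delta> \<le> l" using \<tau>1 by (simp add: l_def field_simps)
          thus "\<delta>2 \<le> l" using \<delta>2 by simp
        qed (use \<tau>1 in \<open>auto simp: l_def\<close>)
        have \<tau>l: "\<bar>\<tau>\<bar> = l powr (-1)" using \<tau>1 by (simp add: l_def powr_minus_divide)
        have "norm (g \<tau>) \<le> C0 * l powr (2 + \<epsilon>)"
          unfolding g_def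
        proof (rule fixed[OF adm r0 \<delta>2(1) l(3,2)])
          show "1 / l \<le> \<bar>\<tau>\<bar>" by (simp add: l_def)
          show "\<bar>\<tau>\<bar> \<le> l powr (- 1 - \<mu>)" unfolding \<tau>l using l \<mu> by (intro powr_mono') auto
        qed
        also have "\<dots> \<le> A * l powr (2 + \<epsilon>)" using A by (intro mult_right_mono) auto
        finally have "\<bar>W \<tau>\<bar> * norm (g \<tau>) \<le> (\<delta> powr 2 * \<tau>\<^sup>2) * (A * l powr (2 + \<epsilon>))"
          using W(1)[of \<tau>] unfolding \<delta>2p by (intro mult_mono) auto
        also have "\<dots> = A * (\<delta> powr 2 * (l powr 2 * \<tau>\<^sup>2 * l powr \<epsilon>))" by (simp add: powr_add mult_ac)
        also have "l powr 2 * \<tau>\<^sup>2 = 1" using \<tau>1 by (simp add: l_def power_divide)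
        also have "A * (\<delta> powr 2 * (1 * l powr \<epsilon>)) \<le> A * (\<delta> powr 2 * (1 * \<delta> powr (\<epsilon>/4)))"
        proof -
          have "l \<le> 1 / a1" using 2 a \<tau>1 by (simp add: l_def frac_le)
          hence "l powr \<epsilon> \<le> (1 / a1) powr \<epsilon>" using l \<epsilon> by (intro powr_mono2) auto
          also have "\<dots> = \<delta> powr (\<epsilon>/4)" using \<delta> by (simp add: a1_def powr_minus_divide powr_powr)
          finally show ?thesis using A by (intro mult_left_mono) auto
        qed
        also have "\<dots> = A * (\<delta> powr (2 + \<epsilon>/4) * indicator {-a2..a2} \<tau>)" using 2 by (simp add: powr_add abs_le_iff indicator_def)
        finally show ?thesis unfolding n using B1(2) by linarith
      next
        case 3
        have "norm (g \<tau>) \<le> C0 * \<delta> powr (2 + \<epsilon>)"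
          unfolding g_def
        proof (rule fixed[OF adm r0 \<delta>2(1,2) \<delta>1])
          show "1 / \<delta> \<le> \<bar>\<tau>\<bar>" using 3 \<delta> by (simp add: a2_def powr_minus_divide)
          show "\<bar>\<tau>\<bar> \<le> \<delta> powr (- 1 - \<mu>)" using 3 by (simp add: a3_def)
        qed
        also have "\<dots> \<le> A * \<delta> powr (2 + \<epsilon>)" using A by (intro mult_right_mono) auto
        finally have "\<bar>W \<tau>\<bar> * norm (g \<tau>) \<le> 1 * (A * \<delta> powr (2 + \<epsilon>))" using W(3) by (intro mult_mono) auto
        also have "\<dots> = A * (\<delta> powr (2 + \<epsilon>) * indicator {-a3..a3} \<tau>)" using 3 by (simp add: abs_le_iff indicator_def)
        finally show ?thesis unfolding n using B1(3) by linarith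
      next
        case 4
        have "\<delta> powr (- (2 * \<mu>)) = \<delta> powr 2 * a3\<^sup>2" unfolding a3_def power2_eq_square powr_add[symmetric] by simp
        also have "\<dots> \<le> \<delta>\<^sup>2 * \<tau>\<^sup>2"
        proof -
          have "a3\<^sup>2 \<le> \<tau>\<^sup>2" using 4 a by (simp add: abs_le_square_iff[symmetric])
          thus ?thesis unfolding \<delta>2p by (intro mult_left_mono) auto
        qed
        finally have "exp (- (\<delta>\<^sup>2 * \<tau>\<^sup>2) / 8) \<le> exp (- (1/16) * \<delta> powr (- (2 * \<mu>))) * exp (- (\<delta>\<^sup>2/16) * \<tau>\<^sup>2)"
          by (simp flip: exp_add)
        also have "\<dots> \<le> (C2 * \<delta> powr 3) * exp (- (\<delta>\<^sup>2/16) * \<tau>\<^sup>2)" using C2(2)[OF \<delta>] by (intro mult_right_mono) auto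
        finally have "\<bar>W \<tau>\<bar> \<le> (C2 * \<delta> powr 3) * exp (- (\<delta>\<^sup>2/16) * \<tau>\<^sup>2)" using W(2)[of \<tau>] by linarith
        hence "\<bar>W \<tau>\<bar> * norm (g \<tau>) \<le> ((C2 * \<delta> powr 3) * exp (- (\<delta>\<^sup>2/16) * \<tau>\<^sup>2)) * (M * M * M * M)"
          using g4[of \<tau>] C2(1) by (intro mult_mono) auto
        also have "\<dots> = (M * M * M * M * C2) * (\<delta> powr 3 * exp (- (\<delta>\<^sup>2/16) * \<tau>\<^sup>2))" by simp
        also have "\<dots> \<le> A * (\<delta> powr 3 * exp (- (\<delta>\<^sup>2/16) * \<tau>\<^sup>2))" using A by (intro mult_right_mono) auto
        finally show ?thesis unfolding n using B1(4) by linarith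
      qed
    qed
    have hB: "has_bochner_integral lborel B (A * (\<delta> powr (3/2) * (2 * a1) + \<delta> powr (2 + \<epsilon>/4) * (2 * a2) + \<delta> powr (2 + \<epsilon>) * (2 * a3) + \<delta> powr 3 * sqrt (pi / (\<delta>\<^sup>2/16))))"
    proof -
      have i: "has_bochner_integral lborel (indicator {-c..c} :: real \<Rightarrow> real) (2 * c)" if "0 < c" for c :: real
        using has_bochner_integral_real_indicator[of "{-c..c}" lborel] that by simp
      have "has_bochner_integral lborel (\<lambda>\<tau>. exp (- (\<delta>\<^sup>2/16) * \<tau>\<^sup>2)) (sqrt (pi / (\<delta>\<^sup>2/16)))"
        using has_integral_shifted_gaussian[of "\<delta>\<^sup>2/16" 0] \<delta> by simp
      thus ?thesis unfolding B_def
        by (intro has_bochner_integral_mult_right has_bochner_integral_add i a)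
    qed
    have "has_bochner_integral lborel (\<lambda>\<tau>. complex_of_real (W \<tau>) * g \<tau>)
      (complex_of_real (sqrt (2 * pi) * \<delta>2 * (mix Px mx Py my Pz mz Pw mw s t \<delta> \<delta>2 - mix Px mx Py my Pz mz Pw mw s t (\<delta> / 2) \<delta>2)))" (is "has_bochner_integral _ _ (complex_of_real ?I)")
      unfolding W_def g_def by (rule osc_integral[OF \<delta> \<delta>2(1)])
    hence "norm (complex_of_real ?I) \<le> A * (\<delta> powr (3/2) * (2 * a1) + \<delta> powr (2 + \<epsilon>/4) * (2 * a2) + \<delta> powr (2 + \<epsilon>) * (2 * a3) + \<delta> powr 3 * sqrt (pi / (\<delta>\<^sup>2/16)))"
      using hB bound Bochner_Integration.integral_norm_bound_integral[of lborel "\<lambda>\<tau>. complex_of_real (W \<tau>) * g \<tau>" B]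
      by (simp only: has_bochner_integral_iff)
    also have "\<dots> \<le> A * (2 * \<delta> powr (1 + \<epsilon>/4) + 2 * \<delta> powr (1 + \<epsilon>/4) + 2 * \<delta> powr (1 + \<epsilon>/4) + 8 * \<delta> powr (1 + \<epsilon>/4))"
    proof (intro mult_left_mono add_mono)
      show "\<delta> powr (3/2) * (2 * a1) \<le> 2 * \<delta> powr (1 + \<epsilon>/4)"
        using \<delta> \<delta>1 \<epsilon>1 powr_mono'[of "1 + \<epsilon>/4" "5/4" \<delta>] by (simp add: a1_def flip: powr_add)
      show "\<delta> powr (2 + \<epsilon>/4) * (2 * a2) \<le> 2 * \<delta> powr (1 + \<epsilon>/4)"
        unfolding a2_def by (simp only: mult.left_commute[of _ 2] powr_add[symmetric]) simp
      have "\<delta> powr (2 + \<epsilon> + (-1 - \<mu>)) \<le> \<delta> powr (1 + \<epsilon>/4)"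
        using \<delta> \<delta>1 \<mu> \<epsilon> by (intro powr_mono') auto
      thus "\<delta> powr (2 + \<epsilon>) * (2 * a3) \<le> 2 * \<delta> powr (1 + \<epsilon>/4)" by (simp add: a3_def flip: powr_add)
      have "sqrt (pi / (\<delta>\<^sup>2/16)) = 4 * sqrt pi / \<delta>" using \<delta> by (simp add: real_sqrt_divide real_sqrt_mult)
      also have "\<dots> \<le> 4 * 2 / \<delta>" using \<delta> pi_less_4 by (intro divide_right_mono mult_left_mono real_le_lsqrt) auto
      finally have "\<delta> powr 3 * sqrt (pi / (\<delta>\<^sup>2/16)) \<le> \<delta> powr 3 * (8 / \<delta>)" by (intro mult_left_mono) auto
      also have "\<dots> = 8 * \<delta> powr 2" using \<delta> by (simp add: power3_eq_cube power2_eq_square)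
      also have "\<dots> \<le> 8 * \<delta> powr (1 + \<epsilon>/4)" using \<delta> \<delta>1 \<epsilon>1 by (intro mult_left_mono powr_mono') auto
      finally show "\<delta> powr 3 * sqrt (pi / (\<delta>\<^sup>2/16)) \<le> 8 * \<delta> powr (1 + \<epsilon>/4)" .
    qed (use A in auto)
    also have "\<dots> = 14 * A * \<delta> powr (\<epsilon>/4) * \<delta>" using \<delta> by (simp add: powr_add)
    also have "\<dots> \<le> 14 * A * \<delta> powr (\<epsilon>/4) * (2 * \<delta>2)" using \<delta>2 A by (intro mult_left_mono) auto
    also have "\<dots> = 28 * A * \<delta> powr (\<epsilon>/4) * \<delta>2" by simp
    finally have "\<bar>?I\<bar> \<le> 28 * A * \<delta> powr (\<epsilon>/4) * \<delta>2" by (simp only: norm_of_real)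
    moreover have "\<bar>?I\<bar> = sqrt (2 * pi) * \<delta>2 * \<bar>mix Px mx Py my Pz mz Pw mw s t \<delta> \<delta>2 - mix Px mx Py my Pz mz Pw mw s t (\<delta> / 2) \<delta>2\<bar>" (is "_ = _ * ?D")
      using \<delta>2 by (simp add: abs_mult)
    ultimately have "\<delta>2 * (sqrt (2 * pi) * ?D) \<le> \<delta>2 * (28 * A * \<delta> powr (\<epsilon>/4))" by (simp add: mult_ac)
    hence 1: "sqrt (2 * pi) * ?D \<le> 28 * A * \<delta> powr (\<epsilon>/4)" using \<delta>2 by simp
    have "2 \<le> sqrt (2 * pi)" using pi_gt3 by (intro real_le_rsqrt) auto
    hence "2 * ?D \<le> sqrt (2 * pi) * ?D" by (intro mult_right_mono) auto
    from order.trans[OF this 1] have "2 * ?D \<le> 2 * (14 * A * \<delta> powr (\<epsilon>/4))" by (simp only: mult.assoc)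
    hence "?D \<le> 14 * A * \<delta> powr (\<epsilon>/4)" by (subst (asm) mult_le_cancel_left_pos) simp_all
    also have "\<dots> \<le> 20 * A * \<delta> powr (\<epsilon>/4)" using A by (intro mult_right_mono) auto
    finally show "?D \<le> 20 * A * \<delta> powr (\<epsilon> / 4)" .
  qed
qed

subsection \<open>Frostman weights\<close>

text \<open>Covers by sets of arbitrary diameter suffice: for \<open>\<alpha> > 0\<close> a small sum forces small diameters.\<close>
definition null_content :: "real \<Rightarrow> 'a::metric_space set \<Rightarrow> bool" where
  "null_content \<alpha> E \<longleftrightarrow> (\<forall>\<epsilon>>0. \<exists>C :: nat \<Rightarrow> 'a set. E \<subseteq> (\<Union>i. C i) \<and> (\<forall>i. bounded (C i)) \<and> (\<Sum>i. diam_powr \<alpha> (C i)) < ennreal \<epsilon>)"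

lemma hausdorff_measure_eq_0:
  fixes E :: "'a::metric_space set"
  assumes \<alpha>: "0 < \<alpha>" and E: "null_content \<alpha> E"
  shows "hausdorff_measure \<alpha> E = 0"
proof -
  have "hausdorff_content \<alpha> \<delta> E \<le> ennreal \<epsilon>" if "0 < \<delta>" "0 < \<epsilon>" for \<delta> \<epsilon>
  proof -
    have m: "0 < min \<epsilon> (\<delta> powr \<alpha>)" using that by simp
    obtain C where C: "E \<subseteq> (\<Union>i. C i)" "\<And>i. bounded (C i)" "(\<Sum>i. diam_powr \<alpha> (C i)) < ennreal (min \<epsilon> (\<delta> powr \<alpha>))"
      using E m unfolding null_content_def by blast
    have "diameter (C i) \<le> \<delta>" for i
    proof (cases "C i = {}")
      case True thus ?thesis using that by simp
    next
      case False
      have "diam_powr \<alpha> (C i) \<le> (\<Sum>i. diam_powr \<alpha> (C i))" using sum_le_suminf[of "\<lambda>i. diam_powr \<alpha> (C i)" "{i}"] by simp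
      hence "ennreal (diameter (C i) powr \<alpha>) < ennreal (min \<epsilon> (\<delta> powr \<alpha>))"
        using C(3) False \<alpha> by (simp add: diam_powr_def)
      hence "diameter (C i) powr \<alpha> < \<delta> powr \<alpha>" using m by (simp add: ennreal_less_iff)
      thus ?thesis using powr_less_mono2[of \<alpha> \<delta> "diameter (C i)"] \<alpha> that
        by (meson less_imp_le not_le powr_mono2 order.strict_trans2 less_irrefl)
    qed
    hence "hausdorff_content \<alpha> \<delta> E \<le> (\<Sum>i. diam_powr \<alpha> (C i))"
      unfolding hausdorff_content_def using C by (intro INF_lower) auto
    also have "\<dots> \<le> ennreal (min \<epsilon> (\<delta> powr \<alpha>))" using C by simp
    also have "\<dots> \<le> ennreal \<epsilon>" by (intro ennreal_leI) simp
    finally show ?thesis .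
  qed
  note small = this
  have "hausdorff_content \<alpha> \<delta> E \<le> 0" if "0 < \<delta>" for \<delta>
    by (rule ennreal_le_epsilon) (simp only: add_0_left small that)
  hence "hausdorff_measure \<alpha> E \<le> 0"
    unfolding hausdorff_measure_def by (intro SUP_least) auto
  thus ?thesis by simp
qed

text \<open>A finite cover is padded with empty sets, which cost nothing by the convention for
  \<open>diam_powr\<close>; this yields a real-valued inequality without infinite sums.\<close>

lemma not_null_content_finite:
  fixes E :: "'a::metric_space set"
  assumes E: "\<not> null_content \<alpha> E" and \<alpha>: "0 < \<alpha>"
  obtains \<epsilon> where "0 < \<epsilon>" "\<And>I D r. finite I \<Longrightarrow> E \<subseteq> (\<Union>i\<in>I. D i) \<Longrightarrow> (\<And>i. i \<in> I \<Longrightarrow> bounded (D i) \<and> diameter (D i) \<le> r i) \<Longrightarrow>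
    \<epsilon> \<le> (\<Sum>i\<in>(I :: 'i set). r i powr \<alpha>)"
proof -
  obtain \<epsilon> where \<epsilon>: "0 < \<epsilon>" "\<And>C :: nat \<Rightarrow> 'a set. E \<subseteq> (\<Union>i. C i) \<Longrightarrow> (\<And>i. bounded (C i)) \<Longrightarrow> ennreal \<epsilon> \<le> (\<Sum>i. diam_powr \<alpha> (C i))"
    using E unfolding null_content_def by (meson linorder_not_less)
  show ?thesis
  proof (rule that[OF \<epsilon>(1)])
    fix I :: "'i set" and D :: "'i \<Rightarrow> 'a set" and r :: "'i \<Rightarrow> real"
    assume I: "finite I" and cov: "E \<subseteq> (\<Union>i\<in>I. D i)" and D: "\<And>i. i \<in> I \<Longrightarrow> bounded (D i) \<and> diameter (D i) \<le> r i"
    obtain f where f: "bij_betw f {..<card I} I" using ex_bij_betw_nat_finite[OF I] by (auto simp: atLeast0LessThan)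
    define C where "C n = (if n < card I then D (f n) else {})" for n
    have fI: "f n \<in> I" if "n < card I" for n using f that by (auto simp: bij_betw_def)
    have "E \<subseteq> (\<Union>n. C n)"
    proof
      fix x assume "x \<in> E"
      then obtain i where i: "i \<in> I" "x \<in> D i" using cov by auto
      then obtain n where "n < card I" "f n = i" using f by (metis bij_betw_def imageE lessThan_iff)
      thus "x \<in> (\<Union>n. C n)" using i by (auto simp: C_def)
    qed
    hence "ennreal \<epsilon> \<le> (\<Sum>n. diam_powr \<alpha> (C n))" using D fI by (intro \<epsilon>(2)) (auto simp: C_def)
    also have "\<dots> = (\<Sum>n<card I. diam_powr \<alpha> (C n))"
      by (rule suminf_finite) (auto simp: C_def diam_powr_def)
    also have "\<dots> \<le> (\<Sum>n<card I. ennreal (r (f n) powr \<alpha>))"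
    proof (rule sum_mono)
      fix n assume n: "n \<in> {..<card I}"
      have "diameter (C n) powr \<alpha> \<le> r (f n) powr \<alpha>"
        using D[OF fI, of n] n \<alpha> diameter_ge_0[of "C n"] by (intro powr_mono2) (auto simp: C_def)
      thus "diam_powr \<alpha> (C n) \<le> ennreal (r (f n) powr \<alpha>)" using \<alpha> by (auto simp: diam_powr_def intro: ennreal_leI)
    qed
    also have "\<dots> = ennreal (\<Sum>n<card I. r (f n) powr \<alpha>)" by (simp add: sum_ennreal)
    also have "(\<Sum>n<card I. r (f n) powr \<alpha>) = (\<Sum>i\<in>I. r i powr \<alpha>)"
      by (rule sum.reindex_bij_betw[OF f])
    finally show "\<epsilon> \<le> (\<Sum>i\<in>I. r i powr \<alpha>)" by (simp add: ennreal_le_iff sum_nonneg)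
  qed
qed

text \<open>Going from fine to coarse cells, the weights in an overfull cell are scaled down until the cell
  is exactly saturated; finally every point lies in a saturated cell.\<close>
lemma greedy_weights:
  fixes e :: "nat \<Rightarrow> 'p \<Rightarrow> 'c" and W :: "nat \<Rightarrow> real"
  assumes P: "finite P" and W: "\<And>j. 0 < W j" and nested: "\<And>j x y. e (Suc j) x = e (Suc j) y \<Longrightarrow> e j x = e j y"
  shows "\<exists>m. (\<forall>x\<in>P. 0 < m x) \<and> (\<forall>j\<le>N. \<forall>x\<in>P. (\<Sum>y | y \<in> P \<and> e j y = e j x. m y) \<le> W j) \<and>
     (\<forall>x\<in>P. \<exists>j\<le>N. (\<Sum>y | y \<in> P \<and> e j y = e j x. m y) = W j)"
proof -
  define cl where "cl j x = {y. y \<in> P \<and> e j y = e j x}" for j x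
  have fcl: "finite (cl j x)" for j x using P by (simp add: cl_def)
  have nest: "e j x = e j y" if "j \<le> k" "e k x = e k y" for j k x y
    using that by (induction k rule: dec_induct) (auto dest: nested)
  define Q where "Q i m \<longleftrightarrow> (\<forall>x\<in>P. 0 < m x) \<and> (\<forall>j. i \<le> j \<longrightarrow> j \<le> N \<longrightarrow> (\<forall>x\<in>P. sum m (cl j x) \<le> W j)) \<and>
     (\<forall>x\<in>P. \<exists>j. i \<le> j \<and> j \<le> N \<and> sum m (cl j x) = W j)" for i and m :: "'p \<Rightarrow> real"
  have "\<exists>m. Q i m" if "i \<le> N" for i
    using that
  proof (induction i rule: inc_induct)
    case base
    \<comment> \<open>At the finest level each occupied cell receives its full allowance
      \<open>W N\<close>, spread evenly.\<close>
    define m where "m x = W N / card (cl N x)" for x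
    have c: "0 < card (cl N x)" if "x \<in> P" for x using that fcl by (auto simp: card_gt_0_iff cl_def)
    have "sum m (cl N x) = W N" if "x \<in> P" for x
    proof -
      have "cl N y = cl N x" if "y \<in> cl N x" for y using that by (auto simp: cl_def)
      hence "sum m (cl N x) = (\<Sum>y\<in>cl N x. W N / card (cl N x))" unfolding m_def by (intro sum.cong) auto
      thus ?thesis using c[OF that] by simp
    qed
    hence "Q N m" using c W by (auto simp: Q_def m_def)
    thus ?case by blast
  next
    case (step i)
    then obtain m where m: "Q (Suc i) m" by blast
    have mp: "0 < m x" if "x \<in> P" for x using m that by (simp add: Q_def)
    define M where "M x = sum m (cl i x)" for x
    have M: "0 < M x" if "x \<in> P" for x
      unfolding M_def using that mp fcl by (intro sum_pos) (auto simp: cl_def)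
    \<comment> \<open>\<open>s\<close> depends on \<open>x\<close> only through its cell at level
      \<open>i\<close>, so rescaling acts uniformly on that cell and can only lower the masses of
      finer cells.\<close>
    define s where "s x = min 1 (W i / M x)" for x
    have s: "0 < s x" "s x \<le> 1" if "x \<in> P" for x using M[OF that] W by (auto simp: s_def)
    define m' where "m' x = m x * s x" for x
    have same: "s y = s x" if "y \<in> cl i x" for x y
    proof -
      have "cl i y = cl i x" using that by (auto simp: cl_def)
      thus ?thesis by (simp add: s_def M_def)
    qed
    have sum_i: "sum m' (cl i x) = M x * s x" for x
      unfolding m'_def M_def sum_distrib_right using same by (intro sum.cong refl) auto
    have "Q i m'"
      unfolding Q_def
    proof (intro conjI ballI allI impI)
      show "0 < m' x" if "x \<in> P" for x using mp[OF that] s[OF that] by (simp add: m'_def)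
      show "sum m' (cl j x) \<le> W j" if "i \<le> j" "j \<le> N" "x \<in> P" for j x
      proof (cases "j = i")
        case True
        have "M x * s x \<le> M x * (W i / M x)" using M[OF that(3)] by (intro mult_left_mono) (auto simp: s_def)
        thus ?thesis using True M[OF that(3)] by (simp add: sum_i)
      next
        case False
        have "sum m' (cl j x) \<le> sum m (cl j x)"
          using mp s unfolding m'_def by (intro sum_mono) (auto simp: cl_def mult_left_le less_imp_le)
        also have "\<dots> \<le> W j" using m that False by (simp add: Q_def)
        finally show ?thesis .
      qed
      show "\<exists>j. i \<le> j \<and> j \<le> N \<and> sum m' (cl j x) = W j" if x: "x \<in> P" for x
      proof (cases "W i \<le> M x")
        case True
        hence "s x = W i / M x" using M[OF x] by (simp add: s_def)
        hence "sum m' (cl i x) = W i" using M[OF x] by (simp add: sum_i)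
        thus ?thesis using step by auto
      next
        case False
        obtain j where j: "Suc i \<le> j" "j \<le> N" "sum m (cl j x) = W j" using m x by (auto simp: Q_def)
        \<comment> \<open>A cell that is not overfull is left unchanged, and so is the saturated
          finer cell inside it.\<close>
        have "s x = 1" using False M[OF x] by (simp add: s_def)
        moreover have "y \<in> cl i x" if "y \<in> cl j x" for y using that nest[of i j y x] j by (auto simp: cl_def)
        ultimately have "s y = 1" if "y \<in> cl j x" for y using same that by metis
        hence "sum m' (cl j x) = sum m (cl j x)" unfolding m'_def by (intro sum.cong) auto
        thus ?thesis using j by (intro exI[of _ j]) auto
      qed
    qed
    thus ?case by blast
  qed
  from this[of 0] show ?thesis unfolding Q_def cl_def by auto
qed

text \<open>Each point is assigned its coarsest saturated cell. By nesting, two such cells agree or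
  are disjoint, so the total mass is exactly the sum of their allowances, which ties the mass to a
  cover.\<close>

lemma saturated_total:
  fixes e :: "nat \<Rightarrow> 'p \<Rightarrow> 'c" and W :: "nat \<Rightarrow> real"
  assumes P: "finite P" and nested: "\<And>j x y. e (Suc j) x = e (Suc j) y \<Longrightarrow> e j x = e j y"
    and sat: "\<And>x. x \<in> P \<Longrightarrow> \<exists>j\<le>N. (\<Sum>y | y \<in> P \<and> e j y = e j x. m y) = W j"
  obtains I where "finite I" "\<forall>x\<in>P. \<exists>j\<le>N. (j, e j x) \<in> I"
    "sum m P = (\<Sum>i\<in>I. W (fst i))"
proof -
  define S where "S x j \<longleftrightarrow> (\<Sum>y | y \<in> P \<and> e j y = e j x. m y) = W j" for x j
  define J where "J x = (LEAST j. S x j)" for x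
  have J: "S x (J x)" "J x \<le> N" if x: "x \<in> P" for x
  proof -
    obtain j where j: "j \<le> N" "S x j" using sat[OF x] by (auto simp: S_def)
    show "S x (J x)" unfolding J_def using j(2) by (rule LeastI)
    have "J x \<le> j" unfolding J_def using j(2) by (rule Least_le)
    thus "J x \<le> N" using j by simp
  qed
  have nest: "e j x = e j y" if "j \<le> k" "e k x = e k y" for j k x y
    using that by (induction k rule: dec_induct) (auto dest: nested)
  have S_cong: "S x j = S y j" if "e j x = e j y" for x y j using that by (simp add: S_def)
  have J_eq: "J y = J x" if x: "x \<in> P" and y: "y \<in> P" and e: "e (J x) y = e (J x) x" for x y
  proof -
    have "S y (J x)" using J(1)[OF x] S_cong[OF e] by simp
    hence le: "J y \<le> J x" unfolding J_def[of y] by (rule Least_le)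
    hence "e (J y) y = e (J y) x" using nest e by blast
    hence "S x (J y)" using J(1)[OF y] S_cong by blast
    hence "J x \<le> J y" unfolding J_def[of x] by (rule Least_le)
    thus ?thesis using le by simp
  qed
  define key where "key x = (J x, e (J x) x)" for x
  have "sum m P = (\<Sum>i\<in>key ` P. \<Sum>y | y \<in> P \<and> key y = i. m y)"
    using sum.group[OF P finite_imageI[OF P] order.refl, where g = key and h = m] by simp
  also have "\<dots> = (\<Sum>i\<in>key ` P. W (fst i))"
  proof (rule sum.cong[OF refl])
    fix i assume "i \<in> key ` P"
    then obtain x where x: "x \<in> P" "i = key x" by auto
    have "{y. y \<in> P \<and> key y = i} = {y. y \<in> P \<and> e (J x) y = e (J x) x}"
      using J_eq[OF x(1)] unfolding x(2) key_def by auto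
    thus "(\<Sum>y | y \<in> P \<and> key y = i. m y) = W (fst i)" using J(1)[OF x(1)] by (simp add: S_def x(2) key_def)
  qed
  finally show ?thesis
    using P J by (intro that[of "key ` P"]) (auto simp: key_def)
qed

definition dyadic_cell :: "nat \<Rightarrow> 'v::euclidean_space \<Rightarrow> 'v \<Rightarrow> int" where
  "dyadic_cell j = cell ((1/2) ^ j)"

lemma dyadic_cell_nested:
  assumes "dyadic_cell (Suc j) x = dyadic_cell (Suc j) y"
  shows "dyadic_cell j x = dyadic_cell j y"
proof -
  have fl: "\<lfloor>a\<rfloor> = \<lfloor>2 * a\<rfloor> div 2" for a :: real
    using floor_divide_real_eq_div[of 2 "2 * a"] by simp
  have "\<lfloor>(x \<bullet> b) / (1/2) ^ j\<rfloor> = \<lfloor>(y \<bullet> b) / (1/2) ^ j\<rfloor>" if "b \<in> Basis" for b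
  proof -
    have "\<lfloor>(x \<bullet> b) / (1/2) ^ Suc j\<rfloor> = \<lfloor>(y \<bullet> b) / (1/2) ^ Suc j\<rfloor>"
      using fun_cong[OF assms, of b] that by (simp add: dyadic_cell_def cell_def)
    moreover have "u / (1/2) ^ Suc j = 2 * (u / (1/2) ^ j)" for u :: real by simp
    ultimately show ?thesis unfolding fl[of "(x \<bullet> b) / (1/2) ^ j"] fl[of "(y \<bullet> b) / (1/2) ^ j"] by (simp only:)
  qed
  thus ?thesis by (auto simp: dyadic_cell_def cell_def restrict_def)
qed

text \<open>Frostman's lemma in discrete form, with \<open>c\<close> and \<open>K\<close>
  independent of the scale. The coarsest saturated cells cover \<open>E\<close>, so non-null content
  bounds their total allowance, hence the mass, from below. A ball of radius
  \<open>r \<le> 1\<close> meets at most \<open>7 ^ DIM('a)\<close> cells of comparable dyadic size,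
  each within its allowance; larger radii are handled by the total mass.\<close>

lemma frostman_weights_exist:
  fixes E :: "'a::euclidean_space set"
  assumes E: "bounded E" and \<alpha>: "0 < \<alpha>" and nn: "\<not> null_content \<alpha> E"
  obtains c K where "0 < c" "0 < K" "\<And>N. \<exists>P m. P \<subseteq> E \<and> c \<le> sum m P \<and> frostman \<alpha> K ((1/2) ^ N) P m"
proof -
  let ?d = "DIM('a)"
  obtain \<epsilon> where \<epsilon>: "0 < \<epsilon>" "\<And>I D r. finite I \<Longrightarrow> E \<subseteq> (\<Union>i\<in>I. D i) \<Longrightarrow> (\<And>i. i \<in> I \<Longrightarrow> bounded (D i) \<and> diameter (D i) \<le> r i) \<Longrightarrow>
    \<epsilon> \<le> (\<Sum>i\<in>(I :: (nat \<times> ('a \<Rightarrow> int)) set). r i powr \<alpha>)"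
    using not_null_content_finite[OF nn \<alpha>] by metis
  obtain R where R: "\<And>x. x \<in> E \<Longrightarrow> norm x \<le> R" "0 < R" using E by (auto simp: bounded_pos)
  define W where "W j = ((1/2) ^ j) powr \<alpha>" for j :: nat
  have W: "0 < W j" for j by (simp add: W_def)
  define c where "c = \<epsilon> / real ?d powr \<alpha>"
  define K where "K = 7 ^ ?d + (2 * R + 3) ^ ?d"
  have c: "0 < c" using \<epsilon> by (simp add: c_def)
  have K: "0 < K" using R by (simp add: K_def add_pos_nonneg)
  show ?thesis
  proof (rule that[OF c K])
    fix N :: nat
    let ?e = "dyadic_cell :: nat \<Rightarrow> 'a \<Rightarrow> 'a \<Rightarrow> int"
    have h: "0 < (1/2 :: real) ^ j" for j by simp
    \<comment> \<open>One point of \<open>E\<close> for each occupied cell of the finest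
      level.\<close>
    obtain P where P: "P \<subseteq> E" "?e N ` E = ?e N ` P" "inj_on (?e N) P"
      using subset_image_inj[of "?e N ` E" "?e N" E] by auto
    have "finite (?e N ` P)" using card_cell_image_le(1)[OF h, of P 0 R] P R unfolding dyadic_cell_def by (force simp: less_imp_le)
    hence fP: "finite P" using P(3) finite_imageD by blast
    obtain m where m_all: "(\<forall>x\<in>P. 0 < m x) \<and> (\<forall>j\<le>N. \<forall>x\<in>P. (\<Sum>y | y \<in> P \<and> ?e j y = ?e j x. m y) \<le> W j) \<and>
     (\<forall>x\<in>P. \<exists>j\<le>N. (\<Sum>y | y \<in> P \<and> ?e j y = ?e j x. m y) = W j)"
      using greedy_weights[where e = ?e and N = N, OF fP W dyadic_cell_nested] by (rule exE)
    have m: "\<And>x. x \<in> P \<Longrightarrow> 0 < m x" "\<And>j x. j \<le> N \<Longrightarrow> x \<in> P \<Longrightarrow> (\<Sum>y | y \<in> P \<and> ?e j y = ?e j x. m y) \<le> W j"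
      "\<And>x. x \<in> P \<Longrightarrow> \<exists>j\<le>N. (\<Sum>y | y \<in> P \<and> ?e j y = ?e j x. m y) = W j"
      using m_all by simp_all
    obtain I where I: "finite I" "\<forall>x\<in>P. \<exists>j\<le>N. (j, ?e j x) \<in> I"
      "sum m P = (\<Sum>i\<in>I. W (fst i))"
      by (rule saturated_total[where e = ?e and N = N and m = m and W = W, OF fP dyadic_cell_nested m(3)])
    have nest: "?e j x = ?e j y" if "j \<le> k" "?e k x = ?e k y" for j k x y
      using that by (induction k rule: dec_induct) (auto dest: dyadic_cell_nested)
    have "\<epsilon> \<le> (\<Sum>i\<in>I. (real ?d * (1/2) ^ fst i) powr \<alpha>)"
    proof (rule \<epsilon>(2)[OF I(1), where D = "\<lambda>i. {x \<in> E. ?e (fst i) x = snd i}"])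
      show "E \<subseteq> (\<Union>i\<in>I. {x \<in> E. ?e (fst i) x = snd i})"
      proof
        fix x assume x: "x \<in> E"
        then obtain p where p: "p \<in> P" "?e N x = ?e N p" using P by blast
        then obtain j where j: "j \<le> N" "(j, ?e j p) \<in> I" using I(2) by blast
        hence "?e j x = ?e j p" using nest p by blast
        thus "x \<in> (\<Union>i\<in>I. {x \<in> E. ?e (fst i) x = snd i})" using j x by force
      qed
      fix i assume "i \<in> I"
      show "bounded {x \<in> E. ?e (fst i) x = snd i} \<and> diameter {x \<in> E. ?e (fst i) x = snd i} \<le> real ?d * (1/2) ^ fst i"
      proof
        show "bounded {x \<in> E. ?e (fst i) x = snd i}" by (rule bounded_subset[OF E]) auto
        show "diameter {x \<in> E. ?e (fst i) x = snd i} \<le> real ?d * (1/2) ^ fst i"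
        proof (rule diameter_le)
          show "norm (x - y) \<le> real ?d * (1/2) ^ fst i" if "x \<in> {x \<in> E. ?e (fst i) x = snd i}" "y \<in> {x \<in> E. ?e (fst i) x = snd i}" for x y
            using that by (intro norm_le_of_cell_eq) (auto simp: dyadic_cell_def)
        qed auto
      qed
    qed
    also have "\<dots> = real ?d powr \<alpha> * sum m P"
      unfolding I(3) sum_distrib_left W_def by (intro sum.cong refl) (simp add: powr_mult)
    finally have tot: "c \<le> sum m P" by (simp add: c_def divide_le_eq mult.commute)
    have group: "sum m S \<le> real (card (?e j ` S)) * W j" if "S \<subseteq> P" "j \<le> N" for S j
    proof -
      have fS: "finite S" using that fP finite_subset by blast
      have "sum m S = (\<Sum>c\<in>?e j ` S. \<Sum>y | y \<in> S \<and> ?e j y = c. m y)"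
        using sum.group[OF fS finite_imageI[OF fS] order.refl, where g = "?e j" and h = m] by simp
      also have "\<dots> \<le> (\<Sum>c\<in>?e j ` S. W j)"
      proof (rule sum_mono)
        fix c assume "c \<in> ?e j ` S"
        then obtain x where x: "x \<in> S" "c = ?e j x" by auto
        have "(\<Sum>y | y \<in> S \<and> ?e j y = c. m y) \<le> (\<Sum>y | y \<in> P \<and> ?e j y = ?e j x. m y)"
          using fP that(1) m(1) x by (intro sum_mono2) (auto intro: less_imp_le)
        also have "\<dots> \<le> W j" using m(2)[OF that(2)] x that by auto
        finally show "(\<Sum>y | y \<in> S \<and> ?e j y = c. m y) \<le> W j" .
      qed
      finally show ?thesis by simp
    qed
    have "(\<Sum>y | y \<in> P \<and> dist x y \<le> r. m y) \<le> K * r powr \<alpha>" if r: "(1/2) ^ N \<le> r" for x r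
    proof (cases "r \<le> 1")
      case True
      have r0: "0 < r" using r h[of N] by linarith
      \<comment> \<open>The coarsest dyadic scale not exceeding \<open>r\<close>: by minimality
        \<open>r\<close> is at most twice it, and \<open>j \<le> N\<close> because \<open>r\<close>
        is at least the finest scale.\<close>
      define j where "j = (LEAST j. (1/2) ^ j \<le> r)"
      have j: "(1/2) ^ j \<le> r" "j \<le> N" unfolding j_def using r by (auto intro: LeastI Least_le)
      have j2: "r \<le> 2 * (1/2) ^ j"
      proof (cases j)
        case 0 thus ?thesis using True by simp
      next
        case (Suc i)
        have "\<not> (1/2) ^ i \<le> r" using not_less_Least[of i "\<lambda>j. (1/2) ^ j \<le> r"] Suc by (simp add: j_def)
        thus ?thesis using Suc by simp
      qed
      let ?S = "{y. y \<in> P \<and> dist x y \<le> r}"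
      have "sum m ?S \<le> real (card (?e j ` ?S)) * W j" using j by (intro group) auto
      also have "\<dots> \<le> 7 ^ ?d * r powr \<alpha>"
      proof (intro mult_mono)
        have "real (card (?e j ` ?S)) \<le> (2 * r / (1/2) ^ j + 3) ^ ?d"
          unfolding dyadic_cell_def using r0 by (intro card_cell_image_le(2)[OF h, of _ x]) (auto simp: dist_norm norm_minus_commute)
        also have "\<dots> \<le> 7 ^ ?d"
        proof (rule power_mono)
          have "2 * r / (1/2) ^ j \<le> 4" using j2 h[of j] by (subst pos_divide_le_eq) auto
          thus "2 * r / (1/2) ^ j + 3 \<le> 7" by simp
        qed (use r0 in simp)
        finally show "real (card (?e j ` ?S)) \<le> 7 ^ ?d" .
        show "W j \<le> r powr \<alpha>" unfolding W_def using j \<alpha> by (intro powr_mono2) auto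
      qed (auto simp: W_def)
      also have "\<dots> \<le> K * r powr \<alpha>" unfolding K_def using R by (intro mult_right_mono) auto
      finally show ?thesis .
    next
      case False
      have "(\<Sum>y | y \<in> P \<and> dist x y \<le> r. m y) \<le> sum m P" using fP m(1) by (intro sum_mono2) (auto intro: less_imp_le)
      also have "\<dots> \<le> real (card (?e 0 ` P)) * W 0" by (intro group) auto
      also have "\<dots> \<le> (2 * R / (1/2) ^ 0 + 3) ^ ?d * 1"
      proof (intro mult_mono)
        show "real (card (?e 0 ` P)) \<le> (2 * R / (1/2) ^ 0 + 3) ^ ?d"
          unfolding dyadic_cell_def using R P by (intro card_cell_image_le(2)[OF h, of _ 0]) auto
      qed (use R in \<open>auto simp: W_def\<close>)
      also have "\<dots> \<le> K * 1" by (simp add: K_def)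
      also have "\<dots> \<le> K * r powr \<alpha>" using False K \<alpha> by (intro mult_left_mono) (auto simp: ge_one_powr_ge_zero)
      finally show ?thesis .
    qed
    thus "\<exists>P m. P \<subseteq> E \<and> c \<le> sum m P \<and> frostman \<alpha> K ((1/2) ^ N) P m"
      using P(1) tot fP m(1) unfolding frostman_def by (intro exI[of _ P] exI[of _ m]) (auto intro: less_imp_le)
  qed
qed

section \<open>Countable stability of null content, and the support of the content\<close>

lemma null_content_subset: "null_content \<alpha> B \<Longrightarrow> A \<subseteq> B \<Longrightarrow> null_content \<alpha> A"
  unfolding null_content_def by (meson order.trans)

lemma null_content_singleton:
  assumes "0 < \<alpha>"
  shows "null_content \<alpha> {x}"
  unfolding null_content_def
proof (intro allI impI)
  fix \<epsilon> :: real assume "0 < \<epsilon>"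
  have "diam_powr \<alpha> {x} = 0" using assms by (simp add: diam_powr_def)
  thus "\<exists>C. {x} \<subseteq> (\<Union>i. C i) \<and> (\<forall>i. bounded (C i)) \<and> (\<Sum>i. diam_powr \<alpha> (C i)) < ennreal \<epsilon>"
    using \<open>0 < \<epsilon>\<close> by (intro exI[of _ "\<lambda>_. {x}"]) auto
qed

lemma null_content_empty: "null_content \<alpha> {}"
  unfolding null_content_def by (intro allI impI exI[of _ "\<lambda>_. {}"]) (auto simp: diam_powr_def)

lemma null_content_UN_nat:
  fixes A :: "nat \<Rightarrow> 'a::metric_space set"
  assumes "\<And>n. null_content \<alpha> (A n)"
  shows "null_content \<alpha> (\<Union>n. A n)"
  unfolding null_content_def
proof (intro allI impI)
  fix \<epsilon> :: real assume \<epsilon>: "0 < \<epsilon>"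
  have "\<exists>C :: nat \<Rightarrow> 'a set. A n \<subseteq> (\<Union>i. C i) \<and> (\<forall>i. bounded (C i)) \<and> (\<Sum>i. diam_powr \<alpha> (C i)) < ennreal (\<epsilon> / 2 * (1/2) ^ Suc n)" for n
    using assms[of n] \<epsilon> unfolding null_content_def by simp
  then obtain C :: "nat \<Rightarrow> nat \<Rightarrow> 'a set" where C: "\<And>n. A n \<subseteq> (\<Union>i. C n i)" "\<And>n i. bounded (C n i)"
    "\<And>n. (\<Sum>i. diam_powr \<alpha> (C n i)) < ennreal (\<epsilon> / 2 * (1/2) ^ Suc n)" by metis
  define D where "D k = case_prod C (prod_decode k)" for k
  have "(\<Union>n. A n) \<subseteq> (\<Union>k. D k)"
  proof
    fix x assume "x \<in> (\<Union>n. A n)"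
    then obtain n i where "x \<in> C n i" using C(1) by blast
    hence "x \<in> D (prod_encode (n, i))" by (simp add: D_def)
    thus "x \<in> (\<Union>k. D k)" by blast
  qed
  moreover have "bounded (D k)" for k using C(2) by (auto simp: D_def split: prod.splits)
  moreover have "(\<Sum>k. diam_powr \<alpha> (D k)) < ennreal \<epsilon>"
  proof -
    have "(\<Sum>k. diam_powr \<alpha> (case_prod C (prod_decode k))) = (\<Sum>n. \<Sum>i. diam_powr \<alpha> (C n i))"
      by (rule suminf_ennreal_2dimen[where f = "\<lambda>p. diam_powr \<alpha> (case_prod C p)"]) simp
    also have "\<dots> \<le> (\<Sum>n. ennreal (\<epsilon> / 2 * (1/2) ^ Suc n))"
      using C(3) by (intro suminf_le) (auto intro: less_imp_le)
    also have "\<dots> = ennreal (\<Sum>n. \<epsilon> / 2 * (1/2) ^ Suc n)"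
      using \<epsilon> power_half_series by (intro suminf_ennreal2 summable_mult) (auto simp: sums_iff)
    also have "(\<Sum>n. \<epsilon> / 2 * (1/2) ^ Suc n) = \<epsilon> / 2"
      using power_half_series by (subst suminf_mult) (auto simp: sums_iff)
    also have "ennreal (\<epsilon> / 2) < ennreal \<epsilon>" using \<epsilon> by (simp add: ennreal_less_iff)
    finally show ?thesis by (simp add: D_def)
  qed
  ultimately show "\<exists>C. (\<Union>n. A n) \<subseteq> (\<Union>i. C i) \<and> (\<forall>i. bounded (C i)) \<and> (\<Sum>i. diam_powr \<alpha> (C i)) < ennreal \<epsilon>" by blast
qed

lemma null_content_Union_countable:
  fixes F :: "'a::metric_space set set"
  assumes "countable F" "\<And>A. A \<in> F \<Longrightarrow> null_content \<alpha> A"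
  shows "null_content \<alpha> (\<Union>F)"
proof (cases "F = {}")
  case True thus ?thesis by (simp add: null_content_empty)
next
  case False
  have "null_content \<alpha> (\<Union>n. from_nat_into F n)"
    using assms(2) from_nat_into[OF False] by (intro null_content_UN_nat) auto
  thus ?thesis using range_from_nat_into[OF False assms(1)] by simp
qed

definition content_support :: "real \<Rightarrow> 'a::metric_space set \<Rightarrow> 'a set" where
  "content_support \<alpha> E = {x \<in> E. \<forall>r>0. \<not> null_content \<alpha> (E \<inter> cball x r)}"

text \<open>By Lindelof, countably many null pieces cover all of \<open>E\<close> outside the
  support. A finite support would be null as well, as \<open>\<alpha> > 0\<close> makes points null,
  and then so would \<open>E\<close>.\<close>

lemma infinite_content_support:
  fixes E :: "'a::euclidean_space set"
  assumes \<alpha>: "0 < \<alpha>" and E: "\<not> null_content \<alpha> E"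
  shows "infinite (content_support \<alpha> E)"
proof
  assume fin: "finite (content_support \<alpha> E)"
  define F where "F = {ball x r | x r. x \<in> E \<and> 0 < r \<and> null_content \<alpha> (E \<inter> cball x r)}"
  obtain F' where F': "F' \<subseteq> F" "countable F'" "\<Union>F' = \<Union>F" using Lindelof[of F] by (auto simp: F_def)
  have "null_content \<alpha> (\<Union> ((\<lambda>U. E \<inter> U) ` F' \<union> (\<lambda>x. {x}) ` content_support \<alpha> E))"
  proof (rule null_content_Union_countable)
    show "countable ((\<lambda>U. E \<inter> U) ` F' \<union> (\<lambda>x. {x}) ` content_support \<alpha> E)"
      using F'(2) fin by (auto simp: uncountable_infinite intro: countable_finite)
    fix A assume "A \<in> (\<lambda>U. E \<inter> U) ` F' \<union> (\<lambda>x. {x}) ` content_support \<alpha> E"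
    thus "null_content \<alpha> A"
    proof
      assume "A \<in> (\<lambda>U. E \<inter> U) ` F'"
      then obtain x r where "A = E \<inter> ball x r" "null_content \<alpha> (E \<inter> cball x r)" using F'(1) by (auto simp: F_def)
      thus ?thesis using ball_subset_cball by (metis Int_mono null_content_subset order.refl)
    qed (use null_content_singleton[OF \<alpha>] in auto)
  qed
  moreover have "E \<subseteq> \<Union> ((\<lambda>U. E \<inter> U) ` F' \<union> (\<lambda>x. {x}) ` content_support \<alpha> E)"
  proof
    fix x assume x: "x \<in> E"
    show "x \<in> \<Union> ((\<lambda>U. E \<inter> U) ` F' \<union> (\<lambda>x. {x}) ` content_support \<alpha> E)"
    proof (cases "x \<in> content_support \<alpha> E")
      case False
      then obtain r where r: "0 < r" "null_content \<alpha> (E \<inter> cball x r)" using x by (auto simp: content_support_def)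
      hence "x \<in> \<Union>F" using x by (force simp: F_def)
      thus ?thesis using F'(3) x by blast
    qed auto
  qed
  ultimately show False using E null_content_subset by blast
qed

section \<open>Geometry of the three base points\<close>

lemma scalene_vertex_exists:
  fixes S :: "'a::euclidean_space set"
  assumes "infinite S" "bounded S"
  obtains a b c where "a \<in> S" "b \<in> S" "c \<in> S" "norm (a - b) \<noteq> norm (a - c)" "(a - b) \<bullet> (a - c) \<noteq> 0"
proof -
  \<comment> \<open>Two points \<open>b\<close> and \<open>c\<close> lie close together near an
    accumulation point, one point \<open>q\<close> lies far away; the sides ending at
    \<open>q\<close> are then longer than the side between \<open>b\<close> and
    \<open>c\<close>.\<close>
  obtain p where p: "p islimpt S" using bounded_infinite_imp_islimpt[of S S] assms by blast
  obtain q where q: "q \<in> S" "q \<noteq> p" using assms(1) by (metis finite.emptyI finite_insert insertI1 rev_finite_subset subsetI)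
  define r where "r = dist q p / 8"
  have r: "0 < r" using q by (simp add: r_def)
  have "infinite (S \<inter> ball p r)" using p r by (simp add: islimpt_eq_infinite_ball)
  then obtain b c where bc: "b \<in> S" "c \<in> S" "b \<noteq> c" "dist p b < r" "dist p c < r"
    by (metis (no_types, lifting) IntE finite.emptyI finite_insert insertI1 mem_ball rev_finite_subset subsetI)
  have bc2: "norm (b - c) < 2 * r" using bc dist_triangle2[of b c p] by (simp add: dist_norm norm_minus_commute)
  have qb: "7 * r < norm (q - b)" "7 * r < norm (q - c)"
    using bc dist_triangle[of q p b] dist_triangle[of q p c] by (auto simp: r_def dist_norm norm_minus_commute)
  show ?thesis
  proof (cases "(b - q) \<bullet> (b - c) = 0")
    case False
    show ?thesis using bc q qb bc2 False r by (intro that[of b q c]) (auto simp: norm_minus_commute)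
  next
    \<comment> \<open>The inner products at \<open>b\<close> and at \<open>c\<close> add up to
      \<open>(norm (b - c))\<^sup>2\<close>, which is positive: if the angle at \<open>b\<close> is
      right, the one at \<open>c\<close> is not.\<close>
    case True
    have "(c - q) \<bullet> (c - b) = (b - q) \<bullet> (c - b) + (c - b) \<bullet> (c - b)" by (simp add: inner_diff_left)
    also have "(b - q) \<bullet> (c - b) = 0" using True by (simp add: inner_diff_right)
    finally have "(c - q) \<bullet> (c - b) \<noteq> 0" using bc by simp
    thus ?thesis using bc q qb bc2 r by (intro that[of c q b]) (auto simp: norm_minus_commute)
  qed
qed

lemma inner_perturb:
  fixes u v u0 v0 :: "'a::euclidean_space"
  assumes "norm (u - u0) \<le> p" "norm (v - v0) \<le> q" "norm v \<le> V" "norm u0 \<le> U" "0 \<le> p" "0 \<le> U"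
  shows "\<bar>u \<bullet> v - u0 \<bullet> v0\<bar> \<le> p * V + U * q"
proof -
  have "u \<bullet> v - u0 \<bullet> v0 = (u - u0) \<bullet> v + u0 \<bullet> (v - v0)" by (simp add: inner_diff_left inner_diff_right)
  also have "\<bar>\<dots>\<bar> \<le> norm (u - u0) * norm v + norm u0 * norm (v - v0)"
    using Cauchy_Schwarz_ineq2[of "u - u0" v] Cauchy_Schwarz_ineq2[of u0 "v - v0"] by linarith
  also have "\<dots> \<le> p * V + U * q" using assms by (intro add_mono mult_mono) auto
  finally show ?thesis .
qed

lemma ratio_perturb:
  fixes u v A B :: real
  assumes "\<bar>u - A\<bar> \<le> e" "\<bar>v - B\<bar> \<le> e" "0 < B" "0 < A" "e \<le> B / 2"
  shows "\<bar>u / v - A / B\<bar> \<le> 2 * e * (A + B) / B\<^sup>2" "0 < v"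
proof -
  have v: "B / 2 \<le> v" using assms by (simp add: abs_le_iff)
  thus v0: "0 < v" using assms by linarith
  have e: "0 \<le> e" using assms by linarith
  have "u / v - A / B = ((u - A) * B - A * (v - B)) / (v * B)" using v0 assms by (simp add: field_simps)
  hence "\<bar>u / v - A / B\<bar> = \<bar>(u - A) * B - A * (v - B)\<bar> / (v * B)" using v0 assms by (simp add: abs_mult)
  also have "\<dots> \<le> (e * B + A * e) / (B / 2 * B)"
  proof (rule frac_le)
    have "\<bar>(u - A) * B - A * (v - B)\<bar> \<le> \<bar>u - A\<bar> * B + A * \<bar>v - B\<bar>"
      using abs_triangle_ineq4[of "(u - A) * B" "A * (v - B)"] assms by (simp add: abs_mult)
    also have "\<dots> \<le> e * B + A * e" using assms by (intro add_mono mult_mono) auto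
    finally show "\<bar>(u - A) * B - A * (v - B)\<bar> \<le> e * B + A * e" .
    show "B / 2 * B \<le> v * B" using v assms by (intro mult_right_mono) auto
  qed (use assms e in auto)
  also have "\<dots> = 2 * e * (A + B) / B\<^sup>2" using assms by (simp add: field_simps power2_eq_square)
  finally show "\<bar>u / v - A / B\<bar> \<le> 2 * e * (A + B) / B\<^sup>2" .
qed

lemma norm_diff_perturb:
  fixes x y a b :: "'a::real_normed_vector"
  assumes "norm (x - a) \<le> e" "norm (y - b) \<le> e"
  shows "norm ((x - y) - (a - b)) \<le> 2 * e" "\<bar>norm (x - y) - norm (a - b)\<bar> \<le> 2 * e"
proof -
  have eq: "(x - y) - (a - b) = (x - a) - (y - b)" by simp
  show 1: "norm ((x - y) - (a - b)) \<le> 2 * e" unfolding eq using norm_triangle_ineq4[of "x - a" "y - b"] assms by linarith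
  show "\<bar>norm (x - y) - norm (a - b)\<bar> \<le> 2 * e" using norm_triangle_ineq3[of "x - y" "a - b"] 1 by linarith
qed

text \<open>The sum \<open>(x - w) + (x' - w')\<close> is close to twice \<open>a - c\<close>, so
  its inner product with \<open>z - y\<close> is close to twice
  \<open>(a - b) \<bullet> (a - c)\<close>; an error as large as \<open>\<gamma>\<close> still
  leaves \<open>\<gamma>\<close>. As \<open>x\<close> and \<open>z\<close> share the centre
  \<open>a\<close>, the variant with \<open>b\<close> and \<open>c\<close> exchanged holds with the
  same constant.\<close>

lemma cluster_geometry:
  fixes a b c :: "'a::euclidean_space"
  assumes ne: "norm (a - b) \<noteq> norm (a - c)" and nz: "(a - b) \<bullet> (a - c) \<noteq> 0" and \<kappa>: "0 < \<kappa>"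
  obtains \<eta> where "0 < \<eta>" "\<eta> \<le> 1"
    "\<And>x y z w. x \<in> cball a \<eta> \<Longrightarrow> y \<in> cball b \<eta> \<Longrightarrow> z \<in> cball a \<eta> \<Longrightarrow> w \<in> cball c \<eta> \<Longrightarrow>
       z \<noteq> w \<and> z \<noteq> y \<and> \<bar>norm (x - y) / norm (z - w) - norm (a - b) / norm (a - c)\<bar> \<le> \<kappa> \<and>
       \<bar>norm (x - w) / norm (z - y) - norm (a - c) / norm (a - b)\<bar> \<le> \<kappa>"
    "\<And>x y z w x' w'. x \<in> cball a \<eta> \<Longrightarrow> y \<in> cball b \<eta> \<Longrightarrow> z \<in> cball a \<eta> \<Longrightarrow> w \<in> cball c \<eta> \<Longrightarrow> x' \<in> cball a \<eta> \<Longrightarrow> w' \<in> cball c \<eta> \<Longrightarrow>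
       \<bar>(a - b) \<bullet> (a - c)\<bar> \<le> \<bar>(z - y) \<bullet> ((x - w) + (x' - w'))\<bar>"
    "\<And>x y z w x' y'. x \<in> cball a \<eta> \<Longrightarrow> y \<in> cball b \<eta> \<Longrightarrow> z \<in> cball a \<eta> \<Longrightarrow> w \<in> cball c \<eta> \<Longrightarrow> x' \<in> cball a \<eta> \<Longrightarrow> y' \<in> cball b \<eta> \<Longrightarrow>
       \<bar>(a - b) \<bullet> (a - c)\<bar> \<le> \<bar>(z - w) \<bullet> ((x - y) + (x' - y'))\<bar>"
proof -
  define A where "A = norm (a - b)"
  define B where "B = norm (a - c)"
  define \<gamma> where "\<gamma> = \<bar>(a - b) \<bullet> (a - c)\<bar>"
  have A: "0 < A" using nz by (auto simp: A_def)
  have B: "0 < B" using nz by (auto simp: B_def)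
  have \<gamma>: "0 < \<gamma>" using nz by (simp add: \<gamma>_def)
  define L where "L = 8 * (A + B + 2)"
  have L: "0 < L" using A B by (simp add: L_def)
  \<comment> \<open>In turn: boundedness, denominators staying above half their value, the inner
    product error, and the two ratio errors.\<close>
  define S where "S = {1, A / 4, B / 4, \<gamma> / L, \<kappa> * B\<^sup>2 / (4 * (A + B)), \<kappa> * A\<^sup>2 / (4 * (A + B))}"
  have S: "finite S" "S \<noteq> {}" "\<And>v. v \<in> S \<Longrightarrow> 0 < v" using A B \<gamma> \<kappa> L by (auto simp: S_def)
  define \<eta> where "\<eta> = Min S"
  have \<eta>0: "0 < \<eta>" using S by (simp add: \<eta>_def)
  have \<eta>le: "\<eta> \<le> 1" "\<eta> \<le> A / 4" "\<eta> \<le> B / 4" "\<eta> \<le> \<gamma> / L" "\<eta> \<le> \<kappa> * B\<^sup>2 / (4 * (A + B))" "\<eta> \<le> \<kappa> * A\<^sup>2 / (4 * (A + B))"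
    unfolding \<eta>_def by (intro Min_le[OF S(1)]; simp add: S_def)+
  have k1: "2 * (2 * \<eta>) * (A + B) / B\<^sup>2 \<le> \<kappa>" using \<eta>le(5) A B by (simp add: field_simps)
  have k2: "2 * (2 * \<eta>) * (B + A) / A\<^sup>2 \<le> \<kappa>" using \<eta>le(6) A B by (simp add: field_simps)
  have key: "\<gamma> \<le> \<bar>u \<bullet> v\<bar>" if u: "norm (u - u0) \<le> 2 * \<eta>" and v: "norm (v - 2 *\<^sub>R v0) \<le> 4 * \<eta>"
    and nu: "norm u0 \<le> A + B" and nv: "norm v0 \<le> A + B" and uv: "\<bar>u0 \<bullet> v0\<bar> = \<gamma>" for u v u0 v0 :: 'a
  proof -
    have "norm v \<le> norm (2 *\<^sub>R v0) + norm (v - 2 *\<^sub>R v0)" by (rule norm_triangle_sub)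
    hence "norm v \<le> 2 * (A + B) + 4" using v nv \<eta>le(1) by simp
    hence "\<bar>u \<bullet> v - u0 \<bullet> (2 *\<^sub>R v0)\<bar> \<le> 2 * \<eta> * (2 * (A + B) + 4) + (A + B) * (4 * \<eta>)"
      using u v nu \<eta>0 A B by (intro inner_perturb) auto
    also have "\<dots> \<le> L * \<eta>" using \<eta>0 A B by (simp add: L_def algebra_simps)
    also have "\<dots> \<le> \<gamma>" using \<eta>le(4) L by (simp add: field_simps)
    finally have "\<bar>u \<bullet> v - 2 * (u0 \<bullet> v0)\<bar> \<le> \<gamma>" by simp
    thus ?thesis using uv by linarith
  qed
  show ?thesis
  proof (rule that[OF \<eta>0 \<eta>le(1)])
    fix x y z w :: 'a
    assume "x \<in> cball a \<eta>" "y \<in> cball b \<eta>" "z \<in> cball a \<eta>" "w \<in> cball c \<eta>"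
    hence n: "norm (x - a) \<le> \<eta>" "norm (y - b) \<le> \<eta>" "norm (z - a) \<le> \<eta>" "norm (w - c) \<le> \<eta>"
      by (auto simp: dist_norm norm_minus_commute)
    note p = norm_diff_perturb(2)[OF n(1,2), folded A_def] norm_diff_perturb(2)[OF n(3,4), folded B_def] norm_diff_perturb(2)[OF n(1,4), folded B_def] norm_diff_perturb(2)[OF n(3,2), folded A_def]
    have "\<bar>norm (x - y) / norm (z - w) - A / B\<bar> \<le> 2 * (2 * \<eta>) * (A + B) / B\<^sup>2" "0 < norm (z - w)"
      using \<eta>le by (intro ratio_perturb[OF p(1,2) B A]; simp)+
    moreover have "\<bar>norm (x - w) / norm (z - y) - B / A\<bar> \<le> 2 * (2 * \<eta>) * (B + A) / A\<^sup>2" "0 < norm (z - y)"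
      using \<eta>le by (intro ratio_perturb[OF p(3,4) A B]; simp)+
    ultimately show "z \<noteq> w \<and> z \<noteq> y \<and> \<bar>norm (x - y) / norm (z - w) - norm (a - b) / norm (a - c)\<bar> \<le> \<kappa> \<and>
       \<bar>norm (x - w) / norm (z - y) - norm (a - c) / norm (a - b)\<bar> \<le> \<kappa>"
      unfolding A_def[symmetric] B_def[symmetric] using k1 k2 by auto
  next
    fix x y z w x' w' :: 'a
    assume "x \<in> cball a \<eta>" "y \<in> cball b \<eta>" "z \<in> cball a \<eta>" "w \<in> cball c \<eta>" "x' \<in> cball a \<eta>" "w' \<in> cball c \<eta>"
    hence n: "norm (x - a) \<le> \<eta>" "norm (y - b) \<le> \<eta>" "norm (z - a) \<le> \<eta>" "norm (w - c) \<le> \<eta>" "norm (x' - a) \<le> \<eta>" "norm (w' - c) \<le> \<eta>"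
      by (auto simp: dist_norm norm_minus_commute)
    have "norm ((x - w) + (x' - w') - 2 *\<^sub>R (a - c)) \<le> 4 * \<eta>"
    proof -
      have eq: "(x - w) + (x' - w') - 2 *\<^sub>R (a - c) = ((x - w) - (a - c)) + ((x' - w') - (a - c))" by (simp add: scaleR_2)
      show ?thesis unfolding eq using norm_triangle_ineq[of "(x - w) - (a - c)" "(x' - w') - (a - c)"] norm_diff_perturb(1)[OF n(1,4)] norm_diff_perturb(1)[OF n(5,6)] by linarith
    qed
    thus "\<bar>(a - b) \<bullet> (a - c)\<bar> \<le> \<bar>(z - y) \<bullet> ((x - w) + (x' - w'))\<bar>"
      using key[OF norm_diff_perturb(1)[OF n(3,2)], of "(x - w) + (x' - w')" "a - c"] A B by (simp add: A_def B_def \<gamma>_def)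
  next
    fix x y z w x' y' :: 'a
    assume "x \<in> cball a \<eta>" "y \<in> cball b \<eta>" "z \<in> cball a \<eta>" "w \<in> cball c \<eta>" "x' \<in> cball a \<eta>" "y' \<in> cball b \<eta>"
    hence n: "norm (x - a) \<le> \<eta>" "norm (y - b) \<le> \<eta>" "norm (z - a) \<le> \<eta>" "norm (w - c) \<le> \<eta>" "norm (x' - a) \<le> \<eta>" "norm (y' - b) \<le> \<eta>"
      by (auto simp: dist_norm norm_minus_commute)
    have "norm ((x - y) + (x' - y') - 2 *\<^sub>R (a - b)) \<le> 4 * \<eta>"
    proof -
      have eq: "(x - y) + (x' - y') - 2 *\<^sub>R (a - b) = ((x - y) - (a - b)) + ((x' - y') - (a - b))" by (simp add: scaleR_2)
      show ?thesis unfolding eq using norm_triangle_ineq[of "(x - y) - (a - b)" "(x' - y') - (a - b)"] norm_diff_perturb(1)[OF n(1,2)] norm_diff_perturb(1)[OF n(5,6)] by linarith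
    qed
    thus "\<bar>(a - b) \<bullet> (a - c)\<bar> \<le> \<bar>(z - w) \<bullet> ((x - y) + (x' - y'))\<bar>"
      using key[OF norm_diff_perturb(1)[OF n(3,4)], of "(x - y) + (x' - y')" "a - b"] A B by (simp add: A_def B_def \<gamma>_def inner_commute)
  qed
qed

subsection \<open>Convergence of the smoothed counts\<close>

lemma qsum_add: "qsum Px mx Py my Pz mz Pw mw (\<lambda>x y z w. f x y z w + g x y z w) =
   qsum Px mx Py my Pz mz Pw mw f + qsum Px mx Py my Pz mz Pw mw g"
  by (simp add: qsum_def scaleR_add_right sum.distrib)

lemma qsum_sum:
  assumes "finite I"
  shows "qsum Px mx Py my Pz mz Pw mw (\<lambda>x y z w. \<Sum>i\<in>I. f i x y z w) = (\<Sum>i\<in>I. qsum Px mx Py my Pz mz Pw mw (f i))"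
  using assms by (induction I rule: finite_induct) (simp_all add: qsum_add, simp add: qsum_def)

lemma qsum_mono:
  fixes f g :: "'a \<Rightarrow> 'a \<Rightarrow> 'a \<Rightarrow> 'a \<Rightarrow> real"
  assumes "\<And>x. x \<in> Px \<Longrightarrow> 0 \<le> mx x" "\<And>x. x \<in> Py \<Longrightarrow> 0 \<le> my x" "\<And>x. x \<in> Pz \<Longrightarrow> 0 \<le> mz x" "\<And>x. x \<in> Pw \<Longrightarrow> 0 \<le> mw x"
    and "\<And>x y z w. x \<in> Px \<Longrightarrow> y \<in> Py \<Longrightarrow> z \<in> Pz \<Longrightarrow> w \<in> Pw \<Longrightarrow> f x y z w \<le> g x y z w"
  shows "qsum Px mx Py my Pz mz Pw mw f \<le> qsum Px mx Py my Pz mz Pw mw g"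
  unfolding qsum_def using assms by (intro sum_mono scaleR_left_mono) auto

lemma qsum_const: "qsum Px mx Py my Pz mz Pw mw (\<lambda>x y z w. B :: real) = sum mx Px * sum my Py * sum mz Pz * sum mw Pw * B"
  by (simp add: qsum_def sum_distrib_left[symmetric] sum_distrib_right[symmetric] mult.assoc)

text \<open>With \<open>s'\<close> the true ratio, the defect is
  \<open>|z-w|\<^sup>2 (s'-s) (s'+s)\<close>; the factors are at most
  \<open>(2 * R)\<^sup>2\<close>, \<open>2 * h\<close> and \<open>2 * T\<close>, hence
  \<open>16\<close>.\<close>

lemma dist_defect_small:
  assumes "z \<noteq> w" "norm z \<le> R" "norm w \<le> R" "0 \<le> s" "s \<le> T" "norm (x - y) / norm (z - w) \<le> T"
    and "\<bar>s - norm (x - y) / norm (z - w)\<bar> \<le> 2 * h"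
  shows "\<bar>dist_defect s x y z w\<bar> \<le> 16 * T * R\<^sup>2 * h"
proof -
  define s' where "s' = norm (x - y) / norm (z - w)"
  have h: "0 \<le> h" using assms by linarith
  have T: "0 \<le> T" using assms by linarith
  have s': "norm (x - y) = s' * norm (z - w)" "0 \<le> s'" using assms(1) by (simp_all add: s'_def)
  have "dist_defect s x y z w = (norm (z - w))\<^sup>2 * ((s' - s) * (s' + s))"
    unfolding dist_defect_def s'(1) by (simp add: power2_eq_square algebra_simps)
  hence "\<bar>dist_defect s x y z w\<bar> = (norm (z - w))\<^sup>2 * (\<bar>s' - s\<bar> * (s' + s))"
    using s' assms by (simp add: abs_mult)
  also have "\<dots> \<le> (2 * R)\<^sup>2 * ((2 * h) * (2 * T))"
  proof (intro mult_mono)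
    have "norm (z - w) \<le> 2 * R" using norm_triangle_ineq4[of z w] assms by linarith
    thus "(norm (z - w))\<^sup>2 \<le> (2 * R)\<^sup>2" by (intro power_mono) auto
    show "\<bar>s' - s\<bar> \<le> 2 * h" "s' + s \<le> 2 * T" using assms by (auto simp: s'_def abs_minus_commute)
  qed (use h T s' assms in auto)
  finally show ?thesis by (simp add: power2_eq_square algebra_simps)
qed

text \<open>Pigeonhole over the grid of ratio pairs: some cell carries mass at least
  \<open>c0 ^ 4 / (n + 1)\<^sup>2\<close>. As \<open>n + 1\<close> is \<open>O(1/\<delta>)\<close>,
  this compensates the normalisation \<open>1/\<delta>\<^sup>2\<close>, so the lower bound does not
  depend on \<open>\<delta>\<close>. A parameter closer than \<open>h\<close> to the lower corner is
  within \<open>2 * h\<close> of every ratio in the cell; \<open>h\<close> is tied to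
  \<open>\<delta>\<close> so that the defects are then at most \<open>\<delta>\<close>, where the
  product of the two exponentials is at least \<open>exp (-1)\<close>.\<close>

lemma grid_lower_bound:
  fixes \<kappa> h s0 t0 T R \<delta> c0 :: real
  assumes nn: "\<And>x. x \<in> Px \<Longrightarrow> 0 \<le> mx x" "\<And>x. x \<in> Py \<Longrightarrow> 0 \<le> my x" "\<And>x. x \<in> Pz \<Longrightarrow> 0 \<le> mz x" "\<And>x. x \<in> Pw \<Longrightarrow> 0 \<le> mw x"
    and mass: "0 < c0" "c0 \<le> sum mx Px" "c0 \<le> sum my Py" "c0 \<le> sum mz Pz" "c0 \<le> sum mw Pw"
    and R: "1 \<le> R" "\<And>v. v \<in> Px \<union> Py \<union> Pz \<union> Pw \<Longrightarrow> norm v \<le> R"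
    and T: "1 \<le> T" "s0 + 2 * \<kappa> \<le> T" "t0 + 2 * \<kappa> \<le> T" "2 * \<kappa> \<le> s0" "2 * \<kappa> \<le> t0"
    and h: "0 < h" "h \<le> \<kappa>" "16 * T * R\<^sup>2 * h = \<delta>"
    and ratio: "\<And>x y z w. x \<in> Px \<Longrightarrow> y \<in> Py \<Longrightarrow> z \<in> Pz \<Longrightarrow> w \<in> Pw \<Longrightarrow> z \<noteq> w \<and> z \<noteq> y \<and>
       \<bar>norm (x - y) / norm (z - w) - s0\<bar> \<le> \<kappa> \<and> \<bar>norm (x - w) / norm (z - y) - t0\<bar> \<le> \<kappa>"
  shows "\<exists>i\<le>nat \<lfloor>2 * \<kappa> / h\<rfloor>. \<exists>j\<le>nat \<lfloor>2 * \<kappa> / h\<rfloor>. \<forall>s t. \<bar>s - (s0 - \<kappa> + real i * h)\<bar> < h \<longrightarrow> \<bar>t - (t0 - \<kappa> + real j * h)\<bar> < h \<longrightarrow>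
     exp (-1) * c0 ^ 4 / (48 * \<kappa> * T * R\<^sup>2)\<^sup>2 \<le> mix Px mx Py my Pz mz Pw mw s t \<delta> \<delta>"
proof -
  define n where "n = nat \<lfloor>2 * \<kappa> / h\<rfloor>"
  have \<kappa>: "0 < \<kappa>" using h by linarith
  have \<delta>: "0 < \<delta>" using h R T by (auto simp flip: h(3))
  define S where "S x y z w = norm (x - y) / norm (z - w)" for x y z w :: 'a
  define ix where "ix u u0 = nat \<lfloor>(u - (u0 - \<kappa>)) / h\<rfloor>" for u u0
  have ix: "ix u u0 \<le> n" "u0 - \<kappa> + real (ix u u0) * h \<le> u" "u < u0 - \<kappa> + real (ix u u0) * h + h" if "\<bar>u - u0\<bar> \<le> \<kappa>" for u u0
  proof -
    have "(u - (u0 - \<kappa>)) / h \<le> 2 * \<kappa> / h" using that h by (intro divide_right_mono) auto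
    thus "ix u u0 \<le> n" unfolding ix_def n_def by (intro nat_mono floor_mono)
    have "0 \<le> (u - (u0 - \<kappa>)) / h" using that h by (intro divide_nonneg_nonneg) auto
    hence "real (ix u u0) = of_int \<lfloor>(u - (u0 - \<kappa>)) / h\<rfloor>" by (simp add: ix_def)
    hence "real (ix u u0) \<le> (u - (u0 - \<kappa>)) / h" "(u - (u0 - \<kappa>)) / h < real (ix u u0) + 1" by linarith+
    thus "u0 - \<kappa> + real (ix u u0) * h \<le> u" "u < u0 - \<kappa> + real (ix u u0) * h + h" using h by (simp_all add: field_simps)
  qed
  define ind where "ind p x y z w = (if p = (ix (S x y z w) s0, ix (S x w z y) t0) then 1 else 0 :: real)" for p x y z w
  define B where "B = {..n} \<times> {..n}"
  have fB: "finite B" and cB: "real (card B) = (real n + 1)\<^sup>2" by (auto simp: B_def power2_eq_square algebra_simps)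
  have "c0 ^ 4 \<le> qsum Px mx Py my Pz mz Pw mw (\<lambda>x y z w. 1 :: real)"
  proof -
    have "c0 * c0 * c0 * c0 \<le> sum mx Px * sum my Py * sum mz Pz * sum mw Pw"
      using mass by (intro mult_mono mult_nonneg_nonneg) auto
    thus ?thesis by (simp add: qsum_const power4_eq_xxxx)
  qed
  also have "\<dots> \<le> qsum Px mx Py my Pz mz Pw mw (\<lambda>x y z w. \<Sum>p\<in>B. ind p x y z w)"
  proof (rule qsum_mono[OF nn])
    fix x y z w assume "x \<in> Px" "y \<in> Py" "z \<in> Pz" "w \<in> Pw"
    hence "(ix (S x y z w) s0, ix (S x w z y) t0) \<in> B" using ratio ix(1) by (auto simp: B_def S_def)
    thus "1 \<le> (\<Sum>p\<in>B. ind p x y z w)" using fB by (simp add: ind_def)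
  qed
  also have "\<dots> = (\<Sum>p\<in>B. qsum Px mx Py my Pz mz Pw mw (ind p))" by (rule qsum_sum[OF fB])
  finally have tot: "c0 ^ 4 \<le> (\<Sum>p\<in>B. qsum Px mx Py my Pz mz Pw mw (ind p))" .
  have "\<exists>p\<in>B. c0 ^ 4 / (real n + 1)\<^sup>2 \<le> qsum Px mx Py my Pz mz Pw mw (ind p)"
  proof (rule ccontr)
    assume "\<not> ?thesis"
    hence "(\<Sum>p\<in>B. qsum Px mx Py my Pz mz Pw mw (ind p)) < (\<Sum>p\<in>B. c0 ^ 4 / (real n + 1)\<^sup>2)"
      using fB by (intro sum_strict_mono) (auto simp: B_def not_le)
    thus False using tot by (simp add: cB)
  qed
  then obtain i j where ij: "i \<le> n" "j \<le> n" "c0 ^ 4 / (real n + 1)\<^sup>2 \<le> qsum Px mx Py my Pz mz Pw mw (ind (i, j))"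
    by (auto simp: B_def)
  \<comment> \<open>\<open>48 = 3 * 16\<close>: since \<open>h \<le> \<kappa>\<close>,
    \<open>n + 1\<close> is at most \<open>3 * \<kappa> / h\<close>, and \<open>h\<close> is
    \<open>\<delta> / (16 * T * R\<^sup>2)\<close>.\<close>
  have n1: "real n + 1 \<le> 48 * \<kappa> * T * R\<^sup>2 / \<delta>"
  proof -
    have "real n \<le> 2 * \<kappa> / h" using \<kappa> h by (simp add: n_def)
    moreover have "1 \<le> \<kappa> / h" using h by simp
    ultimately have "real n + 1 \<le> 3 * \<kappa> / h" by simp
    also have "\<dots> = 48 * \<kappa> * T * R\<^sup>2 / \<delta>" using h R T by (simp flip: h(3))
    finally show ?thesis .
  qed
  have "exp (-1) * c0 ^ 4 / (48 * \<kappa> * T * R\<^sup>2)\<^sup>2 \<le> mix Px mx Py my Pz mz Pw mw s t \<delta> \<delta>"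
    if s: "\<bar>s - (s0 - \<kappa> + real i * h)\<bar> < h" and t: "\<bar>t - (t0 - \<kappa> + real j * h)\<bar> < h" for s t
  proof -
    have ih: "real i * h \<le> 2 * \<kappa>" if "i \<le> n" for i
    proof -
      have "real n \<le> 2 * \<kappa> / h" using \<kappa> h by (simp add: n_def)
      hence "real i \<le> 2 * \<kappa> / h" using that by linarith
      thus ?thesis using h by (simp add: field_simps)
    qed
    have i0: "0 \<le> real i * h" "0 \<le> real j * h" using h by auto
    have sT: "0 \<le> s" "s \<le> T" "0 \<le> t" "t \<le> T" using s t ih[OF ij(1)] ih[OF ij(2)] i0 T h by linarith+
    have "exp (-1) / \<delta>\<^sup>2 * qsum Px mx Py my Pz mz Pw mw (ind (i, j)) \<le> mix Px mx Py my Pz mz Pw mw s t \<delta> \<delta>"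
    proof -
      have "exp (-1) / \<delta>\<^sup>2 * qsum Px mx Py my Pz mz Pw mw (ind (i, j)) = qsum Px mx Py my Pz mz Pw mw (\<lambda>x y z w. exp (-1) / \<delta>\<^sup>2 * ind (i, j) x y z w)"
        using qsum_scaleR[of Px mx Py my Pz mz Pw mw "exp (-1) / \<delta>\<^sup>2" "ind (i, j)"] by (simp only: real_scaleR_def)
      also have "\<dots> \<le> mix Px mx Py my Pz mz Pw mw s t \<delta> \<delta>"
        unfolding mix_def
    proof (rule qsum_mono[OF nn])
      fix x y z w assume P: "x \<in> Px" "y \<in> Py" "z \<in> Pz" "w \<in> Pw"
      have gen: "exp (- (1/2)) / \<delta> \<le> exp (- (dist_defect s' x' y' z' w')\<^sup>2 / (2 * \<delta>\<^sup>2)) / \<delta>" if "\<bar>dist_defect s' x' y' z' w'\<bar> \<le> \<delta>" for s' and x' y' z' w' :: 'a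
      proof -
        have "\<bar>dist_defect s' x' y' z' w'\<bar>\<^sup>2 \<le> \<delta>\<^sup>2" using that by (intro power_mono) auto
        hence "(dist_defect s' x' y' z' w')\<^sup>2 / (2 * \<delta>\<^sup>2) \<le> 1/2" using \<delta> by (simp add: field_simps)
        thus ?thesis using \<delta> by (intro divide_right_mono) auto
      qed
      show "exp (-1) / \<delta>\<^sup>2 * ind (i, j) x y z w \<le> exp (- (dist_defect s x y z w)\<^sup>2 / (2 * \<delta>\<^sup>2)) / \<delta> * (exp (- (dist_defect t x w z y)\<^sup>2 / (2 * \<delta>\<^sup>2)) / \<delta>)"
      proof (cases "(i, j) = (ix (S x y z w) s0, ix (S x w z y) t0)")
        case False
        hence "ind (i, j) x y z w = 0" unfolding ind_def by (simp only: if_False)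
        thus ?thesis using \<delta> by simp
      next
        case True
        note r = ratio[OF P]
        have rS: "\<bar>S x y z w - s0\<bar> \<le> \<kappa>" "\<bar>S x w z y - t0\<bar> \<le> \<kappa>" using r by (auto simp: S_def)
        have "\<bar>s - S x y z w\<bar> \<le> 2 * h" "\<bar>t - S x w z y\<bar> \<le> 2 * h"
          using ix(2,3)[OF rS(1)] ix(2,3)[OF rS(2)] s t True by auto
        moreover have "S x y z w \<le> T" "S x w z y \<le> T" using rS T h by linarith+
        ultimately have "\<bar>dist_defect s x y z w\<bar> \<le> \<delta>" "\<bar>dist_defect t x w z y\<bar> \<le> \<delta>"
          unfolding h(3)[symmetric] using r sT R(2) P by (intro dist_defect_small; simp add: S_def)+
        hence "exp (- (1/2)) / \<delta> * (exp (- (1/2)) / \<delta>) \<le> exp (- (dist_defect s x y z w)\<^sup>2 / (2 * \<delta>\<^sup>2)) / \<delta> * (exp (- (dist_defect t x w z y)\<^sup>2 / (2 * \<delta>\<^sup>2)) / \<delta>)"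
          using gen \<delta> by (intro mult_mono) auto
        moreover have "exp (- (1/2)) / \<delta> * (exp (- (1/2)) / \<delta>) = exp (-1) / \<delta>\<^sup>2" by (simp add: power2_eq_square flip: exp_add)
        moreover have "ind (i, j) x y z w = 1" using True by (simp add: ind_def)
        ultimately show ?thesis by simp
      qed
      qed
      finally show ?thesis .
    qed
    moreover have "exp (-1) * c0 ^ 4 / (48 * \<kappa> * T * R\<^sup>2)\<^sup>2 \<le> exp (-1) / \<delta>\<^sup>2 * qsum Px mx Py my Pz mz Pw mw (ind (i, j))"
    proof -
      have "(real n + 1)\<^sup>2 \<le> (48 * \<kappa> * T * R\<^sup>2 / \<delta>)\<^sup>2" using n1 by (intro power_mono) auto
      hence "c0 ^ 4 / (48 * \<kappa> * T * R\<^sup>2 / \<delta>)\<^sup>2 \<le> c0 ^ 4 / (real n + 1)\<^sup>2"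
        using mass \<kappa> T R \<delta> by (intro divide_left_mono mult_pos_pos) auto
      hence "c0 ^ 4 / (48 * \<kappa> * T * R\<^sup>2 / \<delta>)\<^sup>2 \<le> qsum Px mx Py my Pz mz Pw mw (ind (i, j))" using ij by linarith
      hence "exp (-1) / \<delta>\<^sup>2 * (c0 ^ 4 / (48 * \<kappa> * T * R\<^sup>2 / \<delta>)\<^sup>2) \<le> exp (-1) / \<delta>\<^sup>2 * qsum Px mx Py my Pz mz Pw mw (ind (i, j))"
        by (intro mult_left_mono) auto
      moreover have "exp (-1) / \<delta>\<^sup>2 * (c0 ^ 4 / (48 * \<kappa> * T * R\<^sup>2 / \<delta>)\<^sup>2) = exp (-1) * c0 ^ 4 / (48 * \<kappa> * T * R\<^sup>2)\<^sup>2"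
        using \<delta> by (simp add: power_divide)
      ultimately show ?thesis by linarith
    qed
    ultimately show ?thesis by linarith
  qed
  thus ?thesis using ij(1,2) unfolding n_def by blast
qed

text \<open>From scale \<open>(1/2) ^ k\<close> to the next, the width of the first defect is halved
  with the second fixed, and then, after \<open>mix_swap\<close>, that of the second; the latter
  uses admissibility of the exchanged configuration. Each halving costs \<open>C * q ^ k\<close>
  with \<open>q = (1/2) powr (\<epsilon>/4)\<close>, and the geometric series gives the factor
  \<open>2 / (1 - q)\<close>. The chain stops at \<open>N\<close> since the weights are Frostman
  only down to that scale.\<close>

lemma mix_telescope:
  fixes R \<gamma> \<sigma> t1 T \<alpha> K \<mu> \<epsilon> :: real
  assumes d: "2 \<le> DIM('a::euclidean_space)"
    and pos: "1 \<le> R" "0 < \<gamma>" "0 < \<sigma>" "0 < t1" "1 \<le> T" "0 < K"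
    and \<epsilon>: "0 < \<epsilon>" "\<alpha> = DIM('a) / 2 + 3 / 4 + \<epsilon>" "\<epsilon> \<le> 1"
  obtains C q where "0 < C" "0 < q" "q < 1"
    "\<And>s t N k0 (Px :: 'a set) mx Py my Pz mz Pw mw.
      admissible R \<gamma> \<sigma> t1 T \<alpha> K ((1/2) ^ N) s t Px mx Py my Pz mz Pw mw \<Longrightarrow>
      admissible R \<gamma> \<sigma> t1 T \<alpha> K ((1/2) ^ N) t s Px mx Pw mw Pz mz Py my \<Longrightarrow> k0 \<le> N \<Longrightarrow>
      mix Px mx Py my Pz mz Pw mw s t ((1/2) ^ k0) ((1/2) ^ k0) - C * q ^ k0 \<le> mix Px mx Py my Pz mz Pw mw s t ((1/2) ^ N) ((1/2) ^ N)"
proof -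
  have \<alpha>: "0 < \<alpha>" using \<epsilon> by simp
  define D where "D = 3 * real DIM('a) + 1 + 4 * \<alpha>"
  have D: "0 < D" using \<alpha> by (simp add: D_def add_pos_pos)
  define \<mu> where "\<mu> = min (\<epsilon> / 2) (2 * \<epsilon> / D)"
  have \<mu>: "0 < \<mu>" "\<mu> \<le> \<epsilon> / 2" using \<epsilon> D by (auto simp: \<mu>_def)
  have "\<mu> * D \<le> 2 * \<epsilon> / D * D" using D by (intro mult_right_mono) (auto simp: \<mu>_def)
  hence \<mu>D: "\<mu> * (3 * DIM('a) + 1 + 4 * \<alpha>) \<le> 2 * \<epsilon>" using D by (simp add: D_def add.commute)
  obtain C where C: "0 < C" and diff: "\<And>\<delta> \<delta>2 s t r0 (Px :: 'a set) mx Py my Pz mz Pw mw.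
      admissible R \<gamma> \<sigma> t1 T \<alpha> K r0 s t Px mx Py my Pz mz Pw mw \<Longrightarrow>
      r0 \<le> \<delta>2 \<Longrightarrow> 0 < \<delta>2 \<Longrightarrow> \<delta>2 \<le> \<delta> \<Longrightarrow> \<delta> \<le> 2 * \<delta>2 \<Longrightarrow> \<delta> \<le> 1 \<Longrightarrow>
      \<bar>mix Px mx Py my Pz mz Pw mw s t \<delta> \<delta>2 - mix Px mx Py my Pz mz Pw mw s t (\<delta> / 2) \<delta>2\<bar> \<le> C * \<delta> powr (\<epsilon> / 4)"
  proof (rule mix_scale_difference[OF d pos(1-5) \<alpha> pos(6) \<mu> \<epsilon>(1,2) \<mu>D \<epsilon>(3)], goal_cases)
    case (1 C)
    show ?case by (rule 1(1)[OF 1(2)]) (rule 1(3); assumption)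
  qed
  define q where "q = (1/2 :: real) powr (\<epsilon> / 4)"
  have "(1/2 :: real) powr (\<epsilon> / 4) < 1 powr (\<epsilon> / 4)" using \<epsilon> by (intro powr_less_mono2) auto
  hence q: "0 < q" "q < 1" by (auto simp: q_def)
  show ?thesis
  proof (rule that[of "2 * C / (1 - q)" q])
    show "0 < 2 * C / (1 - q)" using C q by simp
    fix s t :: real and N k0 :: nat and Px Py Pz Pw :: "'a set" and mx my mz mw
    assume adm: "admissible R \<gamma> \<sigma> t1 T \<alpha> K ((1/2) ^ N) s t Px mx Py my Pz mz Pw mw"
      "admissible R \<gamma> \<sigma> t1 T \<alpha> K ((1/2) ^ N) t s Px mx Pw mw Pz mz Py my" and k0: "k0 \<le> N"
    define F where "F k = mix Px mx Py my Pz mz Pw mw s t ((1/2) ^ k) ((1/2) ^ k)" for k :: nat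
    have step: "F k - 2 * C * q ^ k \<le> F (Suc k)" if "Suc k \<le> N" for k
    proof -
      let ?\<delta> = "(1/2 :: real) ^ k"
      have half: "?\<delta> / 2 = (1/2) ^ Suc k" by simp
      have le: "(1/2 :: real) ^ N \<le> (1/2) ^ k" "(1/2 :: real) ^ N \<le> ?\<delta> / 2" unfolding half using that by (intro power_decreasing; simp)+
      have d1: "?\<delta> \<le> 1" by (simp add: power_le_one)
      have q_eq: "?\<delta> powr (\<epsilon> / 4) = q ^ k" by (simp add: q_def powr_powr mult.commute flip: powr_realpow)
      have "\<bar>mix Px mx Py my Pz mz Pw mw s t ?\<delta> ?\<delta> - mix Px mx Py my Pz mz Pw mw s t (?\<delta> / 2) ?\<delta>\<bar> \<le> C * q ^ k"
        using diff[OF adm(1), of ?\<delta> ?\<delta>] le d1 unfolding q_eq by simp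
      moreover have "\<bar>mix Px mx Pw mw Pz mz Py my t s ?\<delta> (?\<delta> / 2) - mix Px mx Pw mw Pz mz Py my t s (?\<delta> / 2) (?\<delta> / 2)\<bar> \<le> C * q ^ k"
        using diff[OF adm(2), of "?\<delta> / 2" ?\<delta>] le d1 unfolding q_eq by simp
      moreover have "mix Px mx Pw mw Pz mz Py my t s ?\<delta> (?\<delta> / 2) = mix Px mx Py my Pz mz Pw mw s t (?\<delta> / 2) ?\<delta>"
        "mix Px mx Pw mw Pz mz Py my t s (?\<delta> / 2) (?\<delta> / 2) = F (Suc k)"
        by (subst mix_swap, simp add: F_def)+
      ultimately show ?thesis unfolding F_def[of k] by linarith
    qed
    define C' where "C' = 2 * C / (1 - q)"
    have C': "0 < C'" using C q by (simp add: C'_def)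
    \<comment> \<open>The partial geometric sum is carried along, since a bound by
      \<open>q ^ k0\<close> alone would not pass through the induction.\<close>
    have "F k0 - C' * (q ^ k0 - q ^ n) \<le> F n" if "k0 \<le> n" "n \<le> N" for n
      using that
    proof (induction n rule: dec_induct)
      case (step n)
      have "C' * (q ^ n - q ^ Suc n) = C' * (1 - q) * q ^ n" by (simp add: algebra_simps)
      also have "C' * (1 - q) = 2 * C" using q by (simp add: C'_def)
      finally have "C' * (q ^ k0 - q ^ Suc n) = C' * (q ^ k0 - q ^ n) + 2 * C * q ^ n" by (simp add: algebra_simps)
      thus ?case using step \<open>\<And>k. Suc k \<le> N \<Longrightarrow> F k - 2 * C * q ^ k \<le> F (Suc k)\<close>[of n] by simp
    qed simp
    from this[OF k0 order.refl] have "F k0 - C' * (q ^ k0 - q ^ N) \<le> F N" .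
    moreover have "C' * (q ^ k0 - q ^ N) \<le> C' * q ^ k0" using C' q by (intro mult_left_mono) auto
    ultimately show "mix Px mx Py my Pz mz Pw mw s t ((1/2) ^ k0) ((1/2) ^ k0) - 2 * C / (1 - q) * q ^ k0 \<le> mix Px mx Py my Pz mz Pw mw s t ((1/2) ^ N) ((1/2) ^ N)"
      unfolding F_def C'_def by linarith
  qed (use q in auto)
qed

lemma frostman_mono:
  assumes "frostman \<alpha> K r0 P m" "K \<le> K'"
  shows "frostman \<alpha> K' r0 P m"
  unfolding frostman_def
proof (intro conjI allI impI)
  fix x r assume "r0 \<le> r"
  hence "(\<Sum>y | y \<in> P \<and> dist x y \<le> r. m y) \<le> K * r powr \<alpha>" using assms by (simp add: frostman_def)
  also have "\<dots> \<le> K' * r powr \<alpha>" using assms(2) by (intro mult_right_mono) auto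
  finally show "(\<Sum>y | y \<in> P \<and> dist x y \<le> r. m y) \<le> K' * r powr \<alpha>" .
qed (use assms in \<open>auto simp: frostman_def\<close>)

subsection \<open>Exact solutions\<close>

definition ratio_pairs :: "'a::real_normed_vector set \<Rightarrow> (real \<times> real) set" where
  "ratio_pairs E = {(norm (x - y) / norm (z - w), norm (x - w) / norm (z - y)) | x y z w.
            x \<in> E \<and> y \<in> E \<and> z \<in> E \<and> w \<in> E \<and> z \<noteq> w \<and> z \<noteq> y}"

text \<open>Without an exact solution the defects are bounded away from zero by compactness, and then the
  smoothed counts tend to zero.\<close>
lemma exact_solution:
  fixes Ex Ey Ez Ew :: "'a::euclidean_space set"
  assumes comp: "compact Ex" "compact Ey" "compact Ez" "compact Ew"
    and nz: "\<And>x y z w. x \<in> Ex \<Longrightarrow> y \<in> Ey \<Longrightarrow> z \<in> Ez \<Longrightarrow> w \<in> Ew \<Longrightarrow> z \<noteq> w \<and> z \<noteq> y"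
    and st: "0 \<le> s" "0 \<le> t" and c: "0 < c" and M: "0 \<le> M"
    and inf: "infinite A" and lower: "\<And>N. N \<in> A \<Longrightarrow> \<exists>Px mx Py my Pz mz Pw mw. Px \<subseteq> Ex \<and> Py \<subseteq> Ey \<and> Pz \<subseteq> Ez \<and> Pw \<subseteq> Ew \<and>
       (\<forall>x\<in>Px. 0 \<le> mx x) \<and> (\<forall>x\<in>Py. 0 \<le> my x) \<and> (\<forall>x\<in>Pz. 0 \<le> mz x) \<and> (\<forall>x\<in>Pw. 0 \<le> mw x) \<and>
       sum mx Px \<le> M \<and> sum my Py \<le> M \<and> sum mz Pz \<le> M \<and> sum mw Pw \<le> M \<and> c \<le> mix Px mx Py my Pz mz Pw mw s t ((1/2) ^ N) ((1/2) ^ N)"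
  shows "\<exists>x\<in>Ex. \<exists>y\<in>Ey. \<exists>z\<in>Ez. \<exists>w\<in>Ew. s = norm (x - y) / norm (z - w) \<and> t = norm (x - w) / norm (z - y)"
proof -
  define g where "g x y z w = (dist_defect s x y z w)\<^sup>2 + (dist_defect t x w z y)\<^sup>2" for x y z w :: 'a
  define Q where "Q = Ex \<times> Ey \<times> Ez \<times> Ew"
  have Q: "compact Q" unfolding Q_def by (intro compact_Times comp)
  have zero: "\<exists>x\<in>Ex. \<exists>y\<in>Ey. \<exists>z\<in>Ez. \<exists>w\<in>Ew. g x y z w = 0"
  proof (rule ccontr)
    assume no: "\<not> ?thesis"
    have "\<exists>\<rho>>0. \<forall>x\<in>Ex. \<forall>y\<in>Ey. \<forall>z\<in>Ez. \<forall>w\<in>Ew. \<rho> \<le> g x y z w"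
    proof (cases "Q = {}")
      case True
      thus ?thesis by (intro exI[of _ 1]) (auto simp: Q_def)
    next
      case False
      have "continuous_on Q (\<lambda>(x, y, z, w). g x y z w)"
        unfolding g_def dist_defect_def split_beta' by (intro continuous_intros)
      then obtain p where p: "p \<in> Q" "\<And>p'. p' \<in> Q \<Longrightarrow> (\<lambda>(x, y, z, w). g x y z w) p \<le> (\<lambda>(x, y, z, w). g x y z w) p'"
        using continuous_attains_inf[OF Q False] by metis
      obtain x y z w where pe: "p = (x, y, z, w)" by (metis prod_cases4)
      have "g x y z w \<noteq> 0" using no p(1) by (auto simp: Q_def pe)
      moreover have "0 \<le> g x y z w" by (simp add: g_def)
      ultimately show ?thesis using p(2) by (intro exI[of _ "g x y z w"]) (auto simp: Q_def pe)
    qed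
    then obtain \<rho> where \<rho>: "0 < \<rho>" "\<And>x y z w. x \<in> Ex \<Longrightarrow> y \<in> Ey \<Longrightarrow> z \<in> Ez \<Longrightarrow> w \<in> Ew \<Longrightarrow> \<rho> \<le> g x y z w" by blast
    \<comment> \<open>The normalisation costs \<open>\<delta>\<^sup>2\<close>; with the exponent
      \<open>3\<close> the counts are still \<open>O(\<delta>)\<close>.\<close>
    obtain C2 where C2: "0 < C2" "\<And>l. 0 < l \<Longrightarrow> exp (- (\<rho> / 2) * l powr (- 2)) \<le> C2 * l powr 3"
    proof (rule exp_neg_le_powr[of "\<rho> / 2" 2 3], goal_cases)
      case (4 C)
      show ?case by (rule 4(1)[OF 4(2)]) (rule 4(3))
    qed (use \<rho> in auto)
    have "\<exists>n. C2 * (M * M * M * M) * (1/2) ^ n < c"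
    proof -
      have "(\<lambda>n. C2 * (M * M * M * M) * (1/2 :: real) ^ n) \<longlonglongrightarrow> C2 * (M * M * M * M) * 0"
        by (intro tendsto_intros LIMSEQ_realpow_zero) auto
      hence "eventually (\<lambda>n. C2 * (M * M * M * M) * (1/2 :: real) ^ n < c) sequentially"
        using c by (intro order_tendstoD) auto
      thus ?thesis by (auto simp: eventually_sequentially)
    qed
    then obtain n where n: "C2 * (M * M * M * M) * (1/2) ^ n < c" by blast
    obtain N where N: "N \<in> A" "n \<le> N" using inf by (meson infinite_nat_iff_unbounded_le)
    obtain Px mx Py my Pz mz Pw mw where P: "Px \<subseteq> Ex" "Py \<subseteq> Ey" "Pz \<subseteq> Ez" "Pw \<subseteq> Ew"
       "\<forall>x\<in>Px. 0 \<le> mx x" "\<forall>x\<in>Py. 0 \<le> my x" "\<forall>x\<in>Pz. 0 \<le> mz x" "\<forall>x\<in>Pw. 0 \<le> mw x"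
       "sum mx Px \<le> M" "sum my Py \<le> M" "sum mz Pz \<le> M" "sum mw Pw \<le> M" "c \<le> mix Px mx Py my Pz mz Pw mw s t ((1/2) ^ N) ((1/2) ^ N)"
      using lower[OF N(1)] by auto
    define \<delta> :: real where "\<delta> = (1/2) ^ N"
    have \<delta>: "0 < \<delta>" by (simp add: \<delta>_def)
    have "norm (mix Px mx Py my Pz mz Pw mw s t \<delta> \<delta>) \<le> sum mx Px * sum my Py * sum mz Pz * sum mw Pw * (C2 * \<delta>)"
      unfolding mix_def
    proof (rule norm_qsum_le)
      fix x y z w assume "x \<in> Px" "y \<in> Py" "z \<in> Pz" "w \<in> Pw"
      hence g: "\<rho> \<le> g x y z w" using P \<rho>(2) by blast
      have "norm (exp (- (dist_defect s x y z w)\<^sup>2 / (2 * \<delta>\<^sup>2)) / \<delta> * (exp (- (dist_defect t x w z y)\<^sup>2 / (2 * \<delta>\<^sup>2)) / \<delta>)) = exp (- g x y z w / (2 * \<delta>\<^sup>2)) / \<delta>\<^sup>2"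
        using \<delta> by (simp add: g_def power2_eq_square diff_divide_distrib flip: exp_add)
      also have "\<dots> \<le> exp (- (\<rho> / 2) * \<delta> powr (-2)) / \<delta>\<^sup>2"
      proof (intro divide_right_mono)
        have "\<rho> / (2 * \<delta>\<^sup>2) \<le> g x y z w / (2 * \<delta>\<^sup>2)" using g by (intro divide_right_mono) auto
        thus "exp (- g x y z w / (2 * \<delta>\<^sup>2)) \<le> exp (- (\<rho> / 2) * \<delta> powr (-2))" using \<delta> by (simp add: powr_minus_divide)
      qed auto
      also have "\<dots> \<le> (C2 * \<delta> powr 3) / \<delta>\<^sup>2" using C2(2)[OF \<delta>] by (intro divide_right_mono) auto
      also have "\<dots> = C2 * \<delta>" using \<delta> by (simp add: power3_eq_cube power2_eq_square)
      finally show "norm (exp (- (dist_defect s x y z w)\<^sup>2 / (2 * \<delta>\<^sup>2)) / \<delta> * (exp (- (dist_defect t x w z y)\<^sup>2 / (2 * \<delta>\<^sup>2)) / \<delta>)) \<le> C2 * \<delta>" .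
    qed (use P in auto)
    also have "\<dots> \<le> M * M * M * M * (C2 * \<delta>)"
      using P M C2(1) \<delta> by (intro mult_mono mult_nonneg_nonneg sum_nonneg) auto
    also have "\<dots> = C2 * (M * M * M * M) * \<delta>" by simp
    also have "\<dots> \<le> C2 * (M * M * M * M) * (1/2) ^ n"
      unfolding \<delta>_def using N C2(1) M by (intro mult_left_mono power_decreasing mult_nonneg_nonneg) auto
    also note n
    finally show False using P(13) by (simp add: \<delta>_def)
  qed
  then obtain x y z w where xyzw: "x \<in> Ex" "y \<in> Ey" "z \<in> Ez" "w \<in> Ew" "g x y z w = 0" by blast
  have ne: "z \<noteq> w" "z \<noteq> y" using nz xyzw by blast+
  have "dist_defect s x y z w = 0" "dist_defect t x w z y = 0" using xyzw(5) by (auto simp: g_def sum_power2_eq_zero_iff)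
  hence "(norm (x - y))\<^sup>2 = (s * norm (z - w))\<^sup>2" "(norm (x - w))\<^sup>2 = (t * norm (z - y))\<^sup>2"
    by (auto simp: dist_defect_def power_mult_distrib)
  hence "norm (x - y) = s * norm (z - w)" "norm (x - w) = t * norm (z - y)"
    using st by (auto simp: power2_eq_iff_nonneg)
  thus ?thesis using xyzw ne by (intro bexI[of _ x] bexI[of _ y] bexI[of _ z] bexI[of _ w]) auto
qed

text \<open>The order of choices matters. The lower bound \<open>c5\<close> and the constants
  \<open>C\<close>, \<open>q\<close> depend neither on the coarse scale nor on \<open>N\<close>, so
  \<open>k0\<close> can be fixed with \<open>C * q ^ k0 < c5 / 2\<close>. The weights depend on
  \<open>N\<close>, but the grid then is the same for all \<open>N\<close>, which leaves finitely
  many cells to choose from.\<close>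

lemma interior_ratio_pairs:
  fixes E :: "'a::euclidean_space set"
  assumes d: "2 \<le> DIM('a)" and E: "compact E" and \<epsilon>: "0 < \<epsilon>" "\<alpha> = DIM('a) / 2 + 3 / 4 + \<epsilon>" "\<epsilon> \<le> 1"
    and nn: "\<not> null_content \<alpha> E"
  shows "interior (ratio_pairs E) \<noteq> {}"
proof -
  have \<alpha>: "0 < \<alpha>" using \<epsilon> by simp
  have bE: "bounded E" using E by (rule compact_imp_bounded)
  obtain R where R: "1 \<le> R" "\<And>x. x \<in> E \<Longrightarrow> norm x \<le> R"
    using bE unfolding bounded_iff by (metis max.cobounded1 max.cobounded2 order.trans)
  have supp: "content_support \<alpha> E \<subseteq> E" by (auto simp: content_support_def)
  obtain a b c where abc: "a \<in> content_support \<alpha> E" "b \<in> content_support \<alpha> E" "c \<in> content_support \<alpha> E"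
    and ne: "norm (a - b) \<noteq> norm (a - c)" and nz: "(a - b) \<bullet> (a - c) \<noteq> 0"
    using scalene_vertex_exists[OF infinite_content_support[OF \<alpha> nn] bounded_subset[OF bE supp]] by metis
  have AB: "0 < norm (a - b)" "0 < norm (a - c)" using nz by auto
  define s0 where "s0 = norm (a - b) / norm (a - c)"
  define t0 where "t0 = norm (a - c) / norm (a - b)"
  have st0: "0 < s0" "0 < t0" "s0 \<noteq> 1" "t0 \<noteq> 1" using AB ne by (auto simp: s0_def t0_def)
  \<comment> \<open>All parameters met later lie within \<open>2 * \<kappa>\<close> of
    \<open>s0\<close> or \<open>t0\<close>: grid corners reach \<open>\<kappa>\<close>, and the
    boxes about them extend by \<open>h \<le> \<kappa>\<close>. A quarter of the distances to
    \<open>0\<close> and \<open>1\<close> keeps such parameters \<open>2 * \<kappa>\<close> away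
    from both.\<close>
  define \<kappa> where "\<kappa> = Min {\<bar>s0 - 1\<bar>, \<bar>t0 - 1\<bar>, s0, t0} / 4"
  have \<kappa>: "0 < \<kappa>" using st0 by (auto simp: \<kappa>_def)
  have "Min {\<bar>s0 - 1\<bar>, \<bar>t0 - 1\<bar>, s0, t0} \<le> v" if "v \<in> {\<bar>s0 - 1\<bar>, \<bar>t0 - 1\<bar>, s0, t0}" for v
    using that by (intro Min_le) auto
  hence \<kappa>le: "4 * \<kappa> \<le> \<bar>s0 - 1\<bar>" "4 * \<kappa> \<le> \<bar>t0 - 1\<bar>" "4 * \<kappa> \<le> s0" "4 * \<kappa> \<le> t0" by (auto simp: \<kappa>_def)
  define T where "T = max 1 (max (s0 + 2 * \<kappa>) (t0 + 2 * \<kappa>))"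
  have T: "1 \<le> T" "s0 + 2 * \<kappa> \<le> T" "t0 + 2 * \<kappa> \<le> T" by (auto simp: T_def)
  have range: "2 * \<kappa> \<le> s" "s \<le> T" "2 * \<kappa> \<le> \<bar>s\<^sup>2 - 1\<bar>" if "\<bar>s - u\<bar> \<le> 2 * \<kappa>" "u \<in> {s0, t0}" for s u
  proof -
    have u: "4 * \<kappa> \<le> \<bar>u - 1\<bar>" "4 * \<kappa> \<le> u" "u + 2 * \<kappa> \<le> T" using that(2) \<kappa>le T by auto
    show s: "2 * \<kappa> \<le> s" "s \<le> T" using that(1) u by auto
    have "2 * \<kappa> \<le> \<bar>s - 1\<bar>" using that(1) u by linarith
    also have "\<bar>s - 1\<bar> * 1 \<le> \<bar>s - 1\<bar> * (s + 1)" using s \<kappa> by (intro mult_left_mono) auto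
    hence "\<bar>s - 1\<bar> \<le> \<bar>s\<^sup>2 - 1\<bar>" using s \<kappa> by (simp add: power2_eq_square square_diff_one_factored abs_mult mult.commute)
    finally show "2 * \<kappa> \<le> \<bar>s\<^sup>2 - 1\<bar>" .
  qed
  define \<gamma> where "\<gamma> = \<bar>(a - b) \<bullet> (a - c)\<bar>"
  have \<gamma>: "0 < \<gamma>" using nz by (simp add: \<gamma>_def)
  obtain \<eta> where \<eta>: "0 < \<eta>" and ratio: "\<And>x y z w. x \<in> cball a \<eta> \<Longrightarrow> y \<in> cball b \<eta> \<Longrightarrow> z \<in> cball a \<eta> \<Longrightarrow> w \<in> cball c \<eta> \<Longrightarrow>
       z \<noteq> w \<and> z \<noteq> y \<and> \<bar>norm (x - y) / norm (z - w) - s0\<bar> \<le> \<kappa> \<and> \<bar>norm (x - w) / norm (z - y) - t0\<bar> \<le> \<kappa>"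
    and tr1: "\<And>x y z w x' w'. x \<in> cball a \<eta> \<Longrightarrow> y \<in> cball b \<eta> \<Longrightarrow> z \<in> cball a \<eta> \<Longrightarrow> w \<in> cball c \<eta> \<Longrightarrow> x' \<in> cball a \<eta> \<Longrightarrow> w' \<in> cball c \<eta> \<Longrightarrow>
       \<gamma> \<le> \<bar>(z - y) \<bullet> ((x - w) + (x' - w'))\<bar>"
    and tr2: "\<And>x y z w x' y'. x \<in> cball a \<eta> \<Longrightarrow> y \<in> cball b \<eta> \<Longrightarrow> z \<in> cball a \<eta> \<Longrightarrow> w \<in> cball c \<eta> \<Longrightarrow> x' \<in> cball a \<eta> \<Longrightarrow> y' \<in> cball b \<eta> \<Longrightarrow>
       \<gamma> \<le> \<bar>(z - w) \<bullet> ((x - y) + (x' - y'))\<bar>"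
  proof (rule cluster_geometry[OF ne nz \<kappa>], goal_cases)
    case (1 \<eta>)
    show ?case
      by (rule 1(1)[OF 1(2)]) (unfold s0_def t0_def \<gamma>_def, (rule 1(4-6); assumption)+)
  qed
  define Ea where "Ea = E \<inter> cball a \<eta>"
  define Eb where "Eb = E \<inter> cball b \<eta>"
  define Ec where "Ec = E \<inter> cball c \<eta>"
  have sub: "Ea \<subseteq> E" "Eb \<subseteq> E" "Ec \<subseteq> E" by (auto simp: Ea_def Eb_def Ec_def)
  have comp: "compact Ea" "compact Eb" "compact Ec" using E by (auto simp: Ea_def Eb_def Ec_def intro!: compact_Int)
  have nnE: "\<not> null_content \<alpha> Ea" "\<not> null_content \<alpha> Eb" "\<not> null_content \<alpha> Ec"
    using abc \<eta> by (auto simp: content_support_def Ea_def Eb_def Ec_def)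
  have bnd: "bounded Ea" "bounded Eb" "bounded Ec" using comp by (auto intro: compact_imp_bounded)
  obtain ca Ka where a: "0 < ca" "0 < Ka" "\<And>N. \<exists>P m. P \<subseteq> Ea \<and> ca \<le> sum m P \<and> frostman \<alpha> Ka ((1/2) ^ N) P m"
    using frostman_weights_exist[OF bnd(1) \<alpha> nnE(1)] by metis
  obtain cb Kb where b: "0 < cb" "0 < Kb" "\<And>N. \<exists>P m. P \<subseteq> Eb \<and> cb \<le> sum m P \<and> frostman \<alpha> Kb ((1/2) ^ N) P m"
    using frostman_weights_exist[OF bnd(2) \<alpha> nnE(2)] by metis
  obtain cc Kc where c: "0 < cc" "0 < Kc" "\<And>N. \<exists>P m. P \<subseteq> Ec \<and> cc \<le> sum m P \<and> frostman \<alpha> Kc ((1/2) ^ N) P m"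
    using frostman_weights_exist[OF bnd(3) \<alpha> nnE(3)] by metis
  define K where "K = Ka + Kb + Kc"
  have K: "0 < K" "Ka \<le> K" "Kb \<le> K" "Kc \<le> K" using a b c by (auto simp: K_def)
  define c0 where "c0 = min ca (min cb cc)"
  have c0: "0 < c0" "c0 \<le> ca" "c0 \<le> cb" "c0 \<le> cc" using a b c by (auto simp: c0_def)
  obtain Pa ma where Pa: "\<And>N. Pa N \<subseteq> Ea \<and> ca \<le> sum (ma N) (Pa N) \<and> frostman \<alpha> Ka ((1/2) ^ N) (Pa N) (ma N)" using a(3) by metis
  obtain Pb mb where Pb: "\<And>N. Pb N \<subseteq> Eb \<and> cb \<le> sum (mb N) (Pb N) \<and> frostman \<alpha> Kb ((1/2) ^ N) (Pb N) (mb N)" using b(3) by metis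
  obtain Pc mc where Pc: "\<And>N. Pc N \<subseteq> Ec \<and> cc \<le> sum (mc N) (Pc N) \<and> frostman \<alpha> Kc ((1/2) ^ N) (Pc N) (mc N)" using c(3) by metis
  have F: "frostman \<alpha> K ((1/2) ^ N) (Pa N) (ma N)" "frostman \<alpha> K ((1/2) ^ N) (Pb N) (mb N)" "frostman \<alpha> K ((1/2) ^ N) (Pc N) (mc N)" for N
    using Pa[of N] Pb[of N] Pc[of N] K frostman_mono by blast+
  have inE: "Pa N \<subseteq> E" "Pb N \<subseteq> E" "Pc N \<subseteq> E" and inB: "Pa N \<subseteq> cball a \<eta>" "Pb N \<subseteq> cball b \<eta>" "Pc N \<subseteq> cball c \<eta>" for N
    using Pa[of N] Pb[of N] Pc[of N] by (auto simp: Ea_def Eb_def Ec_def)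
  have inR: "Pa N \<subseteq> cball 0 R" "Pb N \<subseteq> cball 0 R" "Pc N \<subseteq> cball 0 R" for N using inE[of N] R(2) by auto
  have pn: "\<And>x. x \<in> Pa N \<Longrightarrow> 0 \<le> ma N x" "\<And>x. x \<in> Pb N \<Longrightarrow> 0 \<le> mb N x" "\<And>x. x \<in> Pc N \<Longrightarrow> 0 \<le> mc N x" for N
    using F[of N] by (auto simp: frostman_def)
  have \<kappa>2: "0 < 2 * \<kappa>" using \<kappa> by simp
  have adm: "admissible R \<gamma> (2 * \<kappa>) (2 * \<kappa>) T \<alpha> K ((1/2) ^ N) s t (Pa N) (ma N) (Pb N) (mb N) (Pa N) (ma N) (Pc N) (mc N)"
    "admissible R \<gamma> (2 * \<kappa>) (2 * \<kappa>) T \<alpha> K ((1/2) ^ N) t s (Pa N) (ma N) (Pc N) (mc N) (Pa N) (ma N) (Pb N) (mb N)"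
    if "\<bar>s - s0\<bar> \<le> 2 * \<kappa>" "\<bar>t - t0\<bar> \<le> 2 * \<kappa>" for s t N
    unfolding admissible_def using F[of N] inR[of N] range[OF that(1)] range[OF that(2)] tr1 tr2 inB[of N]
    by (simp_all add: subset_iff)
  define G where "G N k s t = mix (Pa N) (ma N) (Pb N) (mb N) (Pa N) (ma N) (Pc N) (mc N) s t ((1/2) ^ k) ((1/2) ^ k)" for N k s t
  obtain C q where Cq: "0 < C" "0 < q" "q < 1" and tel: "\<And>s t N k0. \<bar>s - s0\<bar> \<le> 2 * \<kappa> \<Longrightarrow> \<bar>t - t0\<bar> \<le> 2 * \<kappa> \<Longrightarrow> k0 \<le> N \<Longrightarrow>
      G N k0 s t - C * q ^ k0 \<le> G N N s t"
  proof (rule mix_telescope[OF d R(1) \<gamma> \<kappa>2 \<kappa>2 T(1) K(1) \<epsilon>], goal_cases)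
    case (1 C q)
    show ?case by (rule 1(1)[OF 1(2-4)]) (unfold G_def, rule 1(5); (rule adm | assumption); assumption)
  qed
  define c5 where "c5 = exp (-1) * c0 ^ 4 / (48 * \<kappa> * T * R\<^sup>2)\<^sup>2"
  have c5: "0 < c5" using c0 \<kappa> T R by (simp add: c5_def)
  have RT: "0 < 16 * T * R\<^sup>2" using R T by simp
  obtain k0 where k0: "(1/2) ^ k0 / (16 * T * R\<^sup>2) < \<kappa>" "C * q ^ k0 < c5 / 2"
  proof -
    have "(\<lambda>k. (1/2 :: real) ^ k / (16 * T * R\<^sup>2)) \<longlonglongrightarrow> 0 / (16 * T * R\<^sup>2)" using RT by (intro tendsto_intros LIMSEQ_realpow_zero) auto
    hence e1: "eventually (\<lambda>k. (1/2 :: real) ^ k / (16 * T * R\<^sup>2) < \<kappa>) sequentially" using \<kappa> by (intro order_tendstoD) auto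
    have "(\<lambda>k. C * q ^ k) \<longlonglongrightarrow> C * 0" using Cq by (intro tendsto_intros LIMSEQ_realpow_zero) auto
    hence e2: "eventually (\<lambda>k. C * q ^ k < c5 / 2) sequentially" using c5 by (intro order_tendstoD) auto
    show ?thesis using that eventually_happens'[OF sequentially_bot eventually_conj[OF e1 e2]] by blast
  qed
  define h where "h = (1/2) ^ k0 / (16 * T * R\<^sup>2)"
  have h: "0 < h" "h \<le> \<kappa>" "16 * T * R\<^sup>2 * h = (1/2) ^ k0" using k0 RT by (auto simp: h_def)
  define n where "n = nat \<lfloor>2 * \<kappa> / h\<rfloor>"
  define cell_ok where "cell_ok N p \<longleftrightarrow> (\<forall>s t. \<bar>s - (s0 - \<kappa> + real (fst p) * h)\<bar> < h \<longrightarrow> \<bar>t - (t0 - \<kappa> + real (snd p) * h)\<bar> < h \<longrightarrow> c5 \<le> G N k0 s t)" for N p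
  have "\<exists>p\<in>{..n} \<times> {..n}. cell_ok N p" for N
  proof -
    have "\<exists>i\<le>n. \<exists>j\<le>n. \<forall>s t. \<bar>s - (s0 - \<kappa> + real i * h)\<bar> < h \<longrightarrow> \<bar>t - (t0 - \<kappa> + real j * h)\<bar> < h \<longrightarrow> c5 \<le> G N k0 s t"
      unfolding n_def c5_def G_def
    proof (rule grid_lower_bound[OF pn(1,2,1,3) c0(1) _ _ _ _ R(1) _ T _ _ h])
      show "c0 \<le> sum (ma N) (Pa N)" "c0 \<le> sum (mb N) (Pb N)" "c0 \<le> sum (ma N) (Pa N)" "c0 \<le> sum (mc N) (Pc N)"
        using Pa[of N] Pb[of N] Pc[of N] c0 by auto
      show "norm v \<le> R" if "v \<in> Pa N \<union> Pb N \<union> Pa N \<union> Pc N" for v using that inE[of N] R(2) by auto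
      show "z \<noteq> w \<and> z \<noteq> y \<and> \<bar>norm (x - y) / norm (z - w) - s0\<bar> \<le> \<kappa> \<and> \<bar>norm (x - w) / norm (z - y) - t0\<bar> \<le> \<kappa>"
        if "x \<in> Pa N" "y \<in> Pb N" "z \<in> Pa N" "w \<in> Pc N" for x y z w
        using that inB[of N] by (intro ratio) auto
    qed (use \<kappa>le \<kappa> in auto)
    thus ?thesis unfolding cell_ok_def by force
  qed
  hence "\<exists>p\<in>{..n} \<times> {..n}. infinite {N \<in> {k0..}. cell_ok N p}"
    by (intro pigeonhole_infinite_rel) (auto simp: infinite_Ici)
  then obtain i j where ij: "i \<le> n" "j \<le> n" "infinite {N \<in> {k0..}. cell_ok N (i, j)}" by auto
  define S where "S = {s0 - \<kappa> + real i * h - h<..<s0 - \<kappa> + real i * h + h} \<times> {t0 - \<kappa> + real j * h - h<..<t0 - \<kappa> + real j * h + h}"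
  have "S \<subseteq> ratio_pairs E"
  proof
    fix p assume "p \<in> S"
    then obtain s t where p: "p = (s, t)" and s: "\<bar>s - (s0 - \<kappa> + real i * h)\<bar> < h" and t: "\<bar>t - (t0 - \<kappa> + real j * h)\<bar> < h"
      by (auto simp: S_def abs_less_iff)
    have ih: "0 \<le> real i * h" "real i * h \<le> 2 * \<kappa>" if "i \<le> n" for i
    proof -
      have "real n \<le> 2 * \<kappa> / h" using \<kappa> h by (simp add: n_def)
      hence "real i \<le> 2 * \<kappa> / h" using that by linarith
      thus "real i * h \<le> 2 * \<kappa>" using h by (simp add: field_simps)
    qed (use h in simp)
    have st: "\<bar>s - s0\<bar> \<le> 2 * \<kappa>" "\<bar>t - t0\<bar> \<le> 2 * \<kappa>"
      using s t ih[OF ij(1)] ih[OF ij(2)] h by linarith+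
    have stp: "0 \<le> s" "0 \<le> t" using range(1)[OF st(1)] range(1)[OF st(2)] \<kappa> by auto
    have "\<exists>x\<in>Ea. \<exists>y\<in>Eb. \<exists>z\<in>Ea. \<exists>w\<in>Ec. s = norm (x - y) / norm (z - w) \<and> t = norm (x - w) / norm (z - y)"
    proof (rule exact_solution[OF comp(1,2,1,3) _ stp _ _ ij(3)])
      show "z \<noteq> w \<and> z \<noteq> y" if "x \<in> Ea" "y \<in> Eb" "z \<in> Ea" "w \<in> Ec" for x y z w
        using ratio[of x y z w] that by (auto simp: Ea_def Eb_def Ec_def)
      show "0 < c5 / 2" using c5 by simp
      show "0 \<le> K * R powr \<alpha>" using K R by simp
      fix N assume N: "N \<in> {N \<in> {k0..}. cell_ok N (i, j)}"
      have "c5 \<le> G N k0 s t" using N s t by (auto simp: cell_ok_def)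
      hence lower: "c5 / 2 \<le> mix (Pa N) (ma N) (Pb N) (mb N) (Pa N) (ma N) (Pc N) (mc N) s t ((1/2) ^ N) ((1/2) ^ N)" unfolding G_def[symmetric] using tel[OF st, of k0 N] k0 N by auto
      have sub': "Pa N \<subseteq> Ea" "Pb N \<subseteq> Eb" "Pc N \<subseteq> Ec" using Pa Pb Pc by blast+
      have pn': "\<forall>x\<in>Pa N. 0 \<le> ma N x" "\<forall>x\<in>Pb N. 0 \<le> mb N x" "\<forall>x\<in>Pc N. 0 \<le> mc N x" using pn by blast+
      have "(1/2) ^ N \<le> R" using R(1) power_le_one[of "1/2 :: real" N] by simp
      hence "sum (ma N) (Pa N) \<le> K * R powr \<alpha>" "sum (mb N) (Pb N) \<le> K * R powr \<alpha>" "sum (mc N) (Pc N) \<le> K * R powr \<alpha>"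
        using frostman_total_le[OF F(1) inR(1)] frostman_total_le[OF F(2) inR(2)] frostman_total_le[OF F(3) inR(3)] by auto
      thus "\<exists>Px mx Py my Pz mz Pw mw. Px \<subseteq> Ea \<and> Py \<subseteq> Eb \<and> Pz \<subseteq> Ea \<and> Pw \<subseteq> Ec \<and>
       (\<forall>x\<in>Px. 0 \<le> mx x) \<and> (\<forall>x\<in>Py. 0 \<le> my x) \<and> (\<forall>x\<in>Pz. 0 \<le> mz x) \<and> (\<forall>x\<in>Pw. 0 \<le> mw x) \<and>
       sum mx Px \<le> K * R powr \<alpha> \<and> sum my Py \<le> K * R powr \<alpha> \<and> sum mz Pz \<le> K * R powr \<alpha> \<and> sum mw Pw \<le> K * R powr \<alpha> \<and>
       c5 / 2 \<le> mix Px mx Py my Pz mz Pw mw s t ((1/2) ^ N) ((1/2) ^ N)"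
        using sub' pn' lower
        by (intro exI[of _ "Pa N"] exI[of _ "ma N"] exI[of _ "Pb N"] exI[of _ "mb N"] exI[of _ "Pa N"] exI[of _ "ma N"] exI[of _ "Pc N"] exI[of _ "mc N"])
           (intro conjI; assumption)
    qed
    then obtain x y z w where xyzw: "x \<in> Ea" "y \<in> Eb" "z \<in> Ea" "w \<in> Ec" "s = norm (x - y) / norm (z - w)" "t = norm (x - w) / norm (z - y)" by blast
    moreover have "z \<noteq> w \<and> z \<noteq> y" using ratio[of x y z w] xyzw by (auto simp: Ea_def Eb_def Ec_def)
    ultimately show "p \<in> ratio_pairs E" unfolding p ratio_pairs_def using sub by blast
  qed
  moreover have "open S" unfolding S_def by (intro open_Times open_greaterThanLessThan)
  ultimately have "S \<subseteq> interior (ratio_pairs E)" by (rule interior_maximal)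
  moreover have "(s0 - \<kappa> + real i * h, t0 - \<kappa> + real j * h) \<in> S" using h by (auto simp: S_def)
  ultimately show ?thesis by blast
qed

lemma not_null_content_of_hausdorff_dim:
  assumes "0 < \<alpha>" "ereal \<alpha> < hausdorff_dim E"
  shows "\<not> null_content \<alpha> E"
proof
  assume "null_content \<alpha> E"
  hence "hausdorff_measure \<alpha> E = 0" by (rule hausdorff_measure_eq_0[OF assms(1)])
  hence "hausdorff_dim E \<le> ereal \<alpha>" unfolding hausdorff_dim_def using assms(1) by (intro INF_lower) auto
  thus False using assms(2) by simp
qed

theorem theorem1p2:
  fixes E :: "(real ^ 'n) set"
  assumes "CARD('n) \<ge> 2"
    and "compact E"
    and "hausdorff_dim E > ereal ((3 * real CARD('n) + 1) / 4)"
  shows "interior {(norm (x - y) / norm (z - w), norm (x - w) / norm (z - y)) | x y z w.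
            x \<in> E \<and> y \<in> E \<and> z \<in> E \<and> w \<in> E \<and> z \<noteq> w \<and> z \<noteq> y} \<noteq> ({} :: (real \<times> real) set)"
proof -
  define d where "d = real CARD('n)"
  have d: "2 \<le> d" using assms(1) by (simp add: d_def)
  \<comment> \<open>The difference of the two sides is \<open>(d - 2) / 4\<close>.\<close>
  have d34: "d / 2 + 3 / 4 \<le> (3 * d + 1) / 4" using d by simp
  obtain \<beta> where \<beta>: "ereal ((3 * d + 1) / 4) < ereal \<beta>" "ereal \<beta> < hausdorff_dim E"
    using ereal_dense3[of "ereal ((3 * d + 1) / 4)" "hausdorff_dim E"] ereal_dense2[OF assms(3)] unfolding d_def by blast
  \<comment> \<open>The cap at \<open>1\<close> suits \<open>mix_scale_difference\<close>, whose
    lowest frequency range yields \<open>\<delta> powr (5/4)\<close> and has to stay below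
    \<open>\<delta> powr (1 + \<epsilon>/4)\<close>. Lowering the exponent to at most
    \<open>\<beta>\<close> keeps it below the dimension.\<close>
  define \<epsilon> where "\<epsilon> = min 1 (\<beta> - (d / 2 + 3 / 4))"
  define \<alpha> where "\<alpha> = d / 2 + 3 / 4 + \<epsilon>"
  have \<epsilon>: "0 < \<epsilon>" "\<epsilon> \<le> 1" using \<beta>(1) d34 by (auto simp: \<epsilon>_def)
  have "\<alpha> \<le> \<beta>" by (simp add: \<alpha>_def \<epsilon>_def)
  hence "ereal \<alpha> < hausdorff_dim E" using \<beta>(2) by (meson ereal_less_eq(3) order.strict_trans1)
  moreover have "0 < \<alpha>" using \<epsilon> d by (simp add: \<alpha>_def)
  ultimately have "\<not> null_content \<alpha> E" by (intro not_null_content_of_hausdorff_dim)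
  hence "interior (ratio_pairs E) \<noteq> {}"
    using assms(1,2) \<epsilon> by (intro interior_ratio_pairs[of E \<epsilon> \<alpha>]) (auto simp: \<alpha>_def d_def)
  thus ?thesis unfolding ratio_pairs_def .
qed

end
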